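(* Let $\mathcal{F}$ be a non-empty set of finite undirected graphs. Then the almost-sure theory of $\mathrm{Forb}(\mathcal{F})$ equals the first-order theory of the generic $(k_{\mathcal{F}}-1)$-partite graph.
   Context: For a set $\mathcal{F}$ of finite undirected graphs, $\mathrm{Forb}(\mathcal{F})$ denotes the class of all finite undirected graphs $G$ such that no $F \in \mathcal{F}$ has a homomorphism to $G$. For non-empty $\mathcal{F}$, $k_{\mathcal{F}} := \min_{G \in \mathcal{F}} \chi(G)$, where $\chi(G)$ is the chromatic number (smallest $n$ with $G \to K_n$). The almost-sure theory of a class $\mathcal{C}$ is the set of first-order sentences whose probability of holding in a uniformly random member of $\mathcal{C}$ with vertex set $\{1,\dots,n\}$ tends to $1$. The generic $k$-partite graph is $U_{K_k}$: the countable model of the ($\omega$-categorical) model companion of the theory $\{\neg\phi \mid \phi \text{ primitive positive and } K_k \models \neg\phi\}$; a countable graph embeds into $U_{K_k}$ iff it maps homomorphically to $K_k$. *)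

theory Defs
  imports Complex_Main
begin

datatype fm = FTrue | Eq nat nat | Adj nat nat | Neg fm | Conj fm fm | Ex nat fm

fun fv :: "fm \<Rightarrow> nat set" where
  "fv FTrue = {}"
| "fv (Eq x y) = {x, y}"
| "fv (Adj x y) = {x, y}"
| "fv (Neg p) = fv p"
| "fv (Conj p q) = fv p \<union> fv q"
| "fv (Ex x p) = fv p - {x}"

definition sentence :: "fm \<Rightarrow> bool" where
  "sentence \<phi> \<longleftrightarrow> fv \<phi> = {}"

fun sat :: "'a set \<Rightarrow> ('a \<Rightarrow> 'a \<Rightarrow> bool) \<Rightarrow> (nat \<Rightarrow> 'a) \<Rightarrow> fm \<Rightarrow> bool" where
  "sat V E s FTrue = True"
| "sat V E s (Eq x y) = (s x = s y)"
| "sat V E s (Adj x y) = E (s x) (s y)"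
| "sat V E s (Neg p) = (\<not> sat V E s p)"
| "sat V E s (Conj p q) = (sat V E s p \<and> sat V E s q)"
| "sat V E s (Ex x p) = (\<exists>v\<in>V. sat V E (s(x := v)) p)"

text \<open>Truth of a sentence (the assignment is irrelevant for sentences).\<close>
definition models :: "'a set \<Rightarrow> ('a \<Rightarrow> 'a \<Rightarrow> bool) \<Rightarrow> fm \<Rightarrow> bool" where
  "models V E \<phi> \<longleftrightarrow> (\<forall>s. sat V E s \<phi>)"

fun pp :: "fm \<Rightarrow> bool" where
  "pp FTrue = True"
| "pp (Eq x y) = True"
| "pp (Adj x y) = True"
| "pp (Neg p) = False"
| "pp (Conj p q) = (pp p \<and> pp q)"
| "pp (Ex x p) = pp p"

fun qf :: "fm \<Rightarrow> bool" where
  "qf FTrue = True"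
| "qf (Eq x y) = True"
| "qf (Adj x y) = True"
| "qf (Neg p) = qf p"
| "qf (Conj p q) = (qf p \<and> qf q)"
| "qf (Ex x p) = False"

fun exf :: "fm \<Rightarrow> bool" where
  "exf (Ex x p) = exf p"
| "exf p = qf p"

definition graph :: "'a set \<Rightarrow> ('a \<Rightarrow> 'a \<Rightarrow> bool) \<Rightarrow> bool" where
  "graph V E \<longleftrightarrow> (\<forall>x y. E x y \<longrightarrow> x \<in> V \<and> y \<in> V) \<and> (\<forall>x y. E x y \<longrightarrow> E y x) \<and> (\<forall>x. \<not> E x x)"

definition hom :: "'a set \<Rightarrow> ('a \<Rightarrow> 'a \<Rightarrow> bool) \<Rightarrow> 'b set \<Rightarrow> ('b \<Rightarrow> 'b \<Rightarrow> bool) \<Rightarrow> ('a \<Rightarrow> 'b) \<Rightarrow> bool" where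
  "hom V E W D f \<longleftrightarrow> (\<forall>x\<in>V. f x \<in> W) \<and> (\<forall>x\<in>V. \<forall>y\<in>V. E x y \<longrightarrow> D (f x) (f y))"

definition homto :: "'a set \<Rightarrow> ('a \<Rightarrow> 'a \<Rightarrow> bool) \<Rightarrow> 'b set \<Rightarrow> ('b \<Rightarrow> 'b \<Rightarrow> bool) \<Rightarrow> bool" where
  "homto V E W D \<longleftrightarrow> (\<exists>f. hom V E W D f)"

definition emb :: "'a set \<Rightarrow> ('a \<Rightarrow> 'a \<Rightarrow> bool) \<Rightarrow> 'b set \<Rightarrow> ('b \<Rightarrow> 'b \<Rightarrow> bool) \<Rightarrow> ('a \<Rightarrow> 'b) \<Rightarrow> bool" where
  "emb V E W D f \<longleftrightarrow> inj_on f V \<and> f ` V \<subseteq> W \<and> (\<forall>x\<in>V. \<forall>y\<in>V. E x y \<longleftrightarrow> D (f x) (f y))"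

definition KV :: "nat \<Rightarrow> nat set" where
  "KV n = {..<n}"

definition KE :: "nat \<Rightarrow> nat \<Rightarrow> nat \<Rightarrow> bool" where
  "KE n i j \<longleftrightarrow> i < n \<and> j < n \<and> i \<noteq> j"

definition chi :: "'a set \<Rightarrow> ('a \<Rightarrow> 'a \<Rightarrow> bool) \<Rightarrow> nat" where
  "chi V E = (LEAST n. homto V E (KV n) (KE n))"

definition kF :: "('v set \<times> ('v \<Rightarrow> 'v \<Rightarrow> bool)) set \<Rightarrow> nat" where
  "kF F = (LEAST k. \<exists>(V, E)\<in>F. chi V E = k)"

definition in_Forb :: "('v set \<times> ('v \<Rightarrow> 'v \<Rightarrow> bool)) set \<Rightarrow> 'a set \<Rightarrow> ('a \<Rightarrow> 'a \<Rightarrow> bool) \<Rightarrow> bool" where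
  "in_Forb F W D \<longleftrightarrow> graph W D \<and> finite W \<and> (\<forall>(V, E)\<in>F. \<not> homto V E W D)"

definition Forb_n :: "('v set \<times> ('v \<Rightarrow> 'v \<Rightarrow> bool)) set \<Rightarrow> nat \<Rightarrow> (nat \<Rightarrow> nat \<Rightarrow> bool) set" where
  "Forb_n F n = {D. in_Forb F {1..n} D}"

definition prob_Forb :: "('v set \<times> ('v \<Rightarrow> 'v \<Rightarrow> bool)) set \<Rightarrow> fm \<Rightarrow> nat \<Rightarrow> real" where
  "prob_Forb F \<phi> n = real (card {D \<in> Forb_n F n. models {1..n} D \<phi>}) / real (card (Forb_n F n))"

definition as_theory :: "('v set \<times> ('v \<Rightarrow> 'v \<Rightarrow> bool)) set \<Rightarrow> fm set" where
  "as_theory F = {\<phi>. sentence \<phi> \<and> (prob_Forb F \<phi> \<longlonglongrightarrow> 1)}"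

definition modT :: "nat \<Rightarrow> 'a set \<Rightarrow> ('a \<Rightarrow> 'a \<Rightarrow> bool) \<Rightarrow> bool" where
  "modT k V E \<longleftrightarrow> graph V E \<and>
     (\<forall>\<phi>. pp \<phi> \<and> sentence \<phi> \<and> \<not> models (KV k) (KE k) \<phi> \<longrightarrow> \<not> models V E \<phi>)"

text \<open>Existentially closed models of T_k: existential formulas with parameters in the
  structure that hold in an extension (a model of T_k into which it embeds) already hold in
  the structure.  Extensions are taken with countable vertex sets (subsets of nat); since
  witnesses are finite this is no restriction.\<close>
definition ec_model :: "nat \<Rightarrow> 'a set \<Rightarrow> ('a \<Rightarrow> 'a \<Rightarrow> bool) \<Rightarrow> bool" where
  "ec_model k V E \<longleftrightarrow> modT k V E \<and>
     (\<forall>(W :: nat set) D f \<phi> s. modT k W D \<and> emb V E W D f \<and> exf \<phi> \<and> (\<forall>x\<in>fv \<phi>. s x \<in> V)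
        \<and> sat W D (f \<circ> s) \<phi> \<longrightarrow> sat V E s \<phi>)"

text \<open>First-order theory of the generic k-partite graph U_{K_k}, the countable model of the
  model companion of T_k, i.e. the countable existentially closed model of T_k
  (unique up to isomorphism by omega-categoricity).\<close>
definition generic_theory :: "nat \<Rightarrow> fm set" where
  "generic_theory k = {\<phi>. sentence \<phi> \<and> (\<forall>(V :: nat set) E. ec_model k V E \<longrightarrow> models V E \<phi>)}"

end

theory Submission
  imports Defs "HOL-Library.FuncSet" "HOL-Library.Nat_Bijection"
begin

text \<open>Let \<open>l = kF F - 1\<close>. Then \<open>Forb_n F n\<close> lies between the \<open>l\<close>-colourable graphs \<open>Col l\<close> and the graphs \<open>Kf l\<close>
  without \<open>K\<^sub>l\<^sub>+\<^sub>1\<close>. Sentences with at most \<open>m\<close> variables cannot distinguish two graphs having \<open>l\<close>-colourings with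
  the \<open>m\<close>-extension property \<open>ext\<close>, by a back-and-forth argument that also preserves colours, and every existentially
  closed model has such a colouring for all \<open>m\<close>. It remains to see that the number of graphs in \<open>Kf l\<close> without such a
  colouring is of smaller order than the number of graphs in \<open>Col l\<close>.

  This refines the theorem of Kolaitis, Proemel and Rothschild that almost all graphs without \<open>K\<^sub>l\<^sub>+\<^sub>1\<close> are
  \<open>l\<close>-colourable. Atypical graphs are counted by induction: after removal of a suitable bounded set of vertices the number
  of ways to put it back is exponentially smaller than for \<open>l\<close>-colourable graphs. In a typical graph the neighbourhood
  of every vertex \<open>x\<close> contains a large blow-up of \<open>K\<^sub>l\<^sub>-\<^sub>1\<close>; the set of vertices with a neighbour in every part of it
  has about \<open>n / l\<close> elements and is, up to a small error, the colour class of \<open>x\<close>.\<close>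

section \<open>Graphs on a finite set and removal of vertices\<close>

text \<open>The sandwich holds since some member of \<open>F\<close> maps to the clique on
  \<open>kF F\<close> vertices, which a graph in \<open>Forb_n F n\<close> therefore omits, while a
  homomorphism from a member of \<open>F\<close> to an \<open>l\<close>-colourable graph would
  colour that member with \<open>l\<close> colours, fewer than \<open>kF F\<close>. Hence
  \<open>F\<close>, which may be infinite, enters only through \<open>kF F\<close>. Exceptional
  graphs are counted in the larger family and compared with the size of the smaller one.

  Peeling off blow-ups alone bounds the number of graphs without a clique on \<open>l + 1\<close>
  vertices only up to a factor 2 to the \<open>\<epsilon> * n^2\<close>. This is too coarse for an
  atypical configuration of one or two vertices, which saves merely a factor exponential in
  \<open>n\<close>. Such savings are therefore measured against \<open>Col l\<close> on the smaller
  vertex set, by an induction whose constant \<open>C\<close> they eventually absorb. The rough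
  count is compared with \<open>Col l\<close> directly only where the saving is itself quadratic in
  the exponent: for graphs that cannot be tiled by blow-ups.\<close>

definition gr :: "'a set \<Rightarrow> ('a \<Rightarrow> 'a \<Rightarrow> bool) set" where
  "gr A = {E. graph A E}"

definition res :: "'a set \<Rightarrow> ('a \<Rightarrow> 'a \<Rightarrow> bool) \<Rightarrow> 'a \<Rightarrow> 'a \<Rightarrow> bool" where
  "res B E = (\<lambda>x y. x \<in> B \<and> y \<in> B \<and> E x y)"

definition nb :: "('a \<Rightarrow> 'a \<Rightarrow> bool) \<Rightarrow> 'a \<Rightarrow> 'a set" where
  "nb E x = {y. E x y}"

definition PU :: "(nat \<Rightarrow> 'a set) \<Rightarrow> nat \<Rightarrow> 'a set" where
  "PU P k = (\<Union>i<k. P i)"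

text \<open>\<open>P 0, \<dots>, P (k - 1)\<close> are the parts of a not necessarily induced complete \<open>k\<close>-partite subgraph;
  their disjointness follows from the irreflexivity of \<open>E\<close>.\<close>
definition blow :: "('a \<Rightarrow> 'a \<Rightarrow> bool) \<Rightarrow> 'a set \<Rightarrow> nat \<Rightarrow> nat \<Rightarrow> (nat \<Rightarrow> 'a set) \<Rightarrow> bool" where
  "blow E A k q P \<longleftrightarrow> (\<forall>i<k. P i \<subseteq> A \<and> finite (P i) \<and> card (P i) = q) \<and>
     (\<forall>i<k. \<forall>j<k. i \<noteq> j \<longrightarrow> (\<forall>u\<in>P i. \<forall>v\<in>P j. E u v))"

text \<open>A clique listed in order; its vertices are distinct whenever \<open>E\<close> is
  irreflexive.\<close>

definition tup :: "('a \<Rightarrow> 'a \<Rightarrow> bool) \<Rightarrow> 'a set \<Rightarrow> nat \<Rightarrow> (nat \<Rightarrow> 'a) \<Rightarrow> bool" where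
  "tup E A k f \<longleftrightarrow> (\<forall>i<k. f i \<in> A \<and> (\<forall>j<k. i \<noteq> j \<longrightarrow> E (f i) (f j)))"

definition Kf :: "nat \<Rightarrow> 'a set \<Rightarrow> ('a \<Rightarrow> 'a \<Rightarrow> bool) set" where
  "Kf l A = {E \<in> gr A. \<not> (\<exists>f. tup E A (Suc l) f)}"

definition proper :: "nat \<Rightarrow> 'a set \<Rightarrow> ('a \<Rightarrow> 'a \<Rightarrow> bool) \<Rightarrow> ('a \<Rightarrow> nat) \<Rightarrow> bool" where
  "proper l A E c \<longleftrightarrow> (\<forall>x\<in>A. c x < l) \<and> (\<forall>x y. E x y \<longrightarrow> c x \<noteq> c y)"

definition Col :: "nat \<Rightarrow> 'a set \<Rightarrow> ('a \<Rightarrow> 'a \<Rightarrow> bool) set" where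
  "Col l A = {E \<in> gr A. \<exists>c. proper l A E c}"

lemma gr_sym: "E \<in> gr A \<Longrightarrow> E x y \<Longrightarrow> E y x"
  by (auto simp: gr_def graph_def)

lemma gr_irrefl: "E \<in> gr A \<Longrightarrow> \<not> E x x"
  by (auto simp: gr_def graph_def)

lemma gr_dom: "E \<in> gr A \<Longrightarrow> E x y \<Longrightarrow> x \<in> A \<and> y \<in> A"
  by (auto simp: gr_def graph_def)

lemma nb_subset: "E \<in> gr A \<Longrightarrow> nb E x \<subseteq> A - {x}"
  by (auto simp: nb_def gr_def graph_def)

lemma res_gr: "E \<in> gr A \<Longrightarrow> B \<subseteq> A \<Longrightarrow> res B E \<in> gr B"
  by (auto simp: gr_def graph_def res_def)

lemma gr_inj: "inj_on (\<lambda>E. {(x, y). E x y}) X"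
  by (auto simp: inj_on_def fun_eq_iff)

lemma gr_finite: assumes "finite A" shows "finite (gr A)"
proof (rule inj_on_finite[OF gr_inj])
  show "(\<lambda>E. {(x, y). E x y}) ` gr A \<subseteq> Pow (A \<times> A)" by (auto simp: gr_def graph_def)
qed (use assms in auto)

lemma gr_card: assumes "finite A" shows "card (gr A) \<le> 2 ^ (card A)^2"
proof -
  have "card (gr A) \<le> card (Pow (A \<times> A))"
    by (rule card_inj_on_le[OF gr_inj]) (use assms in \<open>auto simp: gr_def graph_def\<close>)
  then show ?thesis using assms by (simp add: card_Pow card_cartesian_product power2_eq_square)
qed

lemma card_fibres:
  fixes c :: real
  assumes "finite X" "finite Y" "\<And>E. E \<in> X \<Longrightarrow> r E \<in> Y"
    and "\<And>H. H \<in> Y \<Longrightarrow> card {E \<in> X. r E = H} \<le> c"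
  shows "card X \<le> card Y * c"
proof -
  have "X = (\<Union>H\<in>Y. {E \<in> X. r E = H})" using assms(3) by auto
  then have "card X \<le> (\<Sum>H\<in>Y. card {E \<in> X. r E = H})"
    using card_UN_le[OF assms(2)] by metis
  then have "real (card X) \<le> (\<Sum>H\<in>Y. real (card {E \<in> X. r E = H}))"
    by (metis of_nat_mono of_nat_sum)
  also have "\<dots> \<le> (\<Sum>H\<in>Y. c)" by (intro sum_mono assms(4))
  finally show ?thesis by simp
qed

lemma card_UN_bound:
  fixes c :: real
  assumes "finite I" "X \<subseteq> (\<Union>i\<in>I. Z i)" "\<And>i. i \<in> I \<Longrightarrow> finite (Z i)" "\<And>i. i \<in> I \<Longrightarrow> card (Z i) \<le> c"
  shows "card X \<le> card I * c"
proof -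
  have "card X \<le> card (\<Union>i\<in>I. Z i)" by (rule card_mono) (use assms in auto)
  also have "\<dots> \<le> (\<Sum>i\<in>I. card (Z i))" by (rule card_UN_le[OF assms(1)])
  finally have "real (card X) \<le> (\<Sum>i\<in>I. real (card (Z i)))" by (metis of_nat_mono of_nat_sum)
  also have "\<dots> \<le> (\<Sum>i\<in>I. c)" by (intro sum_mono assms(4))
  finally show ?thesis by simp
qed

text \<open>A graph is recovered from its restrictions to \<open>A - S\<close> and to
  \<open>S\<close> and from a code \<open>g E\<close> of the edges between them. The bound for the
  restrictions to \<open>S\<close> is crude, but \<open>S\<close> stays bounded in all applications.
  The set of admissible codes may depend on the graph \<open>H\<close> that remains; this is what
  lets links and tilings of \<open>H\<close> limit the codes.\<close>

lemma card_removal: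
  fixes p :: real
  assumes "finite A" "S \<subseteq> A" "X \<subseteq> gr A" "finite Y" "\<And>E. E \<in> X \<Longrightarrow> res (A - S) E \<in> Y"
    and inj: "\<And>E E'. \<lbrakk>E \<in> X; E' \<in> X; res (A - S) E = res (A - S) E'; res S E = res S E'; g E = g E'\<rbrakk> \<Longrightarrow> E = E'"
    and fin: "\<And>H. H \<in> Y \<Longrightarrow> finite (\<Phi> H)" and p: "\<And>H. H \<in> Y \<Longrightarrow> card (\<Phi> H) \<le> p"
    and g: "\<And>E. E \<in> X \<Longrightarrow> g E \<in> \<Phi> (res (A - S) E)"
  shows "card X \<le> card Y * (2 ^ (card S)^2 * p)"
proof (rule card_fibres[where r = "res (A - S)"])
  have fS: "finite S" using assms(1,2) finite_subset by blast
  show "finite X" using assms(1,3) gr_finite finite_subset by blast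
  fix H assume H: "H \<in> Y"
  have "card {E \<in> X. res (A - S) E = H} \<le> card (gr S \<times> \<Phi> H)"
  proof (rule card_inj_on_le[where f = "\<lambda>E. (res S E, g E)"])
    show "inj_on (\<lambda>E. (res S E, g E)) {E \<in> X. res (A - S) E = H}"
      by (rule inj_onI) (use inj in auto)
    show "(\<lambda>E. (res S E, g E)) ` {E \<in> X. res (A - S) E = H} \<subseteq> gr S \<times> \<Phi> H"
      using g assms(2,3) res_gr by blast
    show "finite (gr S \<times> \<Phi> H)" using gr_finite[OF fS] fin[OF H] by simp
  qed
  also have "\<dots> = card (gr S) * card (\<Phi> H)" by (rule card_cartesian_product)
  finally have "real (card {E \<in> X. res (A - S) E = H}) \<le> real (card (gr S)) * real (card (\<Phi> H))"
    unfolding of_nat_mult[symmetric] by (rule of_nat_mono)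
  also have "\<dots> \<le> 2 ^ (card S)^2 * p"
  proof (rule mult_mono)
    show "real (card (gr S)) \<le> 2 ^ (card S)^2"
      using of_nat_mono[OF gr_card[OF fS], where 'a = real] by simp
  qed (use p[OF H] in auto)
  finally show "card {E \<in> X. res (A - S) E = H} \<le> 2 ^ (card S)^2 * p" .
qed (use assms in auto)

text \<open>The edges between \<open>S\<close> and its complement are coded in two dual ways: by the
  traces of the outside vertices on \<open>S\<close> if \<open>S\<close> is a blow-up, and by the
  outside neighbourhoods of the elements of \<open>S\<close> if it consists of one or two
  vertices.\<close>

lemma determined_by_traces:
  assumes "E \<in> gr A" "E' \<in> gr A" "S \<subseteq> A" "res (A - S) E = res (A - S) E'" "res S E = res S E'"
    and "\<And>v. v \<in> A - S \<Longrightarrow> nb E v \<inter> S = nb E' v \<inter> S"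
  shows "E = E'"
proof (intro ext)
  fix x y
  have 1: "E x y = E' x y" if "x \<in> A - S" "y \<in> A - S" for x y
    using fun_cong[OF fun_cong[OF assms(4)], of x y] that by (simp add: res_def)
  have 2: "E x y = E' x y" if "x \<in> S" "y \<in> S" for x y
    using fun_cong[OF fun_cong[OF assms(5)], of x y] that by (simp add: res_def)
  have 3: "E x y = E' x y" if "x \<in> A - S" "y \<in> S" for x y
    using assms(6)[OF that(1)] that by (auto simp: nb_def)
  show "E x y = E' x y"
    by (metis 1 2 3 Diff_iff assms(1,2) gr_dom gr_sym)
qed

lemma determined_by_nbhds:
  assumes "E \<in> gr A" "E' \<in> gr A" "S \<subseteq> A" "res (A - S) E = res (A - S) E'" "res S E = res S E'"
    and "\<And>u. u \<in> S \<Longrightarrow> nb E u - S = nb E' u - S"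
  shows "E = E'"
proof (rule determined_by_traces[OF assms(1-5)])
  fix v assume v: "v \<in> A - S"
  have "E v u = E' v u" if "u \<in> S" for u
  proof -
    have "E u v = E' u v" using assms(6)[OF that] v by (auto simp: nb_def)
    then show ?thesis using gr_sym[OF assms(1)] gr_sym[OF assms(2)] by blast
  qed
  then show "nb E v \<inter> S = nb E' v \<inter> S" by (auto simp: nb_def)
qed

lemma blow_mono: "blow E A k q P \<Longrightarrow> A \<subseteq> A' \<Longrightarrow> blow E A' k q P"
  unfolding blow_def by blast

lemma blow_res: "A \<subseteq> B \<Longrightarrow> blow (res B E) A k q P \<longleftrightarrow> blow E A k q P"
  unfolding blow_def res_def by (meson in_mono)

lemma tup_mono: "tup E A k f \<Longrightarrow> A \<subseteq> A' \<Longrightarrow> tup E A' k f"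
  unfolding tup_def by blast

lemma tup_res: "A \<subseteq> B \<Longrightarrow> tup (res B E) A k f \<longleftrightarrow> tup E A k f"
  unfolding tup_def res_def by (meson in_mono)

lemma tup_Suc: "tup E A k f \<Longrightarrow> x \<in> A \<Longrightarrow> E \<in> gr B \<Longrightarrow> (\<And>i. i < k \<Longrightarrow> E x (f i)) \<Longrightarrow> tup E A (Suc k) (f(k := x))"
  unfolding tup_def using gr_sym[of E B] by (auto simp: less_Suc_eq)

lemma PU_subset: "blow E A k q P \<Longrightarrow> PU P k \<subseteq> A"
  unfolding blow_def PU_def by blast

lemma PU_finite: "blow E A k q P \<Longrightarrow> finite (PU P k)"
  unfolding blow_def PU_def by blast

lemma PU_card:
  assumes "blow E A k q P" "E \<in> gr B"
  shows "card (PU P k) = k * q"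
proof -
  have "card (\<Union>i\<in>{..<k}. P i) = (\<Sum>i\<in>{..<k}. card (P i))"
  proof (rule card_UN_disjoint)
    show "\<forall>i\<in>{..<k}. \<forall>j\<in>{..<k}. i \<noteq> j \<longrightarrow> P i \<inter> P j = {}"
      using assms(1) gr_irrefl[OF assms(2)] unfolding blow_def by blast
  qed (use assms in \<open>auto simp: blow_def\<close>)
  then show ?thesis using assms(1) by (simp add: PU_def blow_def)
qed

lemma blow_tup: "blow E A k q P \<Longrightarrow> (\<And>i. i < k \<Longrightarrow> f i \<in> P i) \<Longrightarrow> tup E A k f"
  unfolding blow_def tup_def by blast

lemma blow_shrink:
  assumes "blow E A k q P" "\<And>i. i < k \<Longrightarrow> P' i \<subseteq> P i" "\<And>i. i < k \<Longrightarrow> card (P' i) = q'"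
  shows "blow E A k q' P'"
  using assms unfolding blow_def by (meson finite_subset order_trans subsetD)

lemma Kf_gr: "E \<in> Kf l A \<Longrightarrow> E \<in> gr A" by (simp add: Kf_def)

lemma Col_gr: "E \<in> Col l A \<Longrightarrow> E \<in> gr A" by (simp add: Col_def)

lemma Kf_finite: "finite A \<Longrightarrow> finite (Kf l A)"
  unfolding Kf_def by (rule finite_subset[OF _ gr_finite]) auto

lemma Col_finite: "finite A \<Longrightarrow> finite (Col l A)"
  unfolding Col_def by (rule finite_subset[OF _ gr_finite]) auto

lemma Kf_res: "E \<in> Kf l A \<Longrightarrow> B \<subseteq> A \<Longrightarrow> res B E \<in> Kf l B"
  using res_gr[of E A B] tup_res[of B B E] tup_mono[of E B "Suc l" _ A]
  unfolding Kf_def by blast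

text \<open>Candidates for the parts of a blow-up. Extensionality makes them finitely many, so that
  a union bound over all blow-ups costs a factor polynomial in \<open>card A\<close>.\<close>

definition BP :: "'a set \<Rightarrow> nat \<Rightarrow> nat \<Rightarrow> (nat \<Rightarrow> 'a set) set" where
  "BP A k q = PiE {..<k} (\<lambda>_. {B. B \<subseteq> A \<and> card B = q})"

lemma BP_finite: "finite A \<Longrightarrow> finite (BP A k q)"
  unfolding BP_def by (rule finite_PiE) auto

lemma BP_card: assumes "finite A" shows "card (BP A k q) \<le> card A ^ (k * q)"
proof -
  have "card (BP A k q) = (card A choose q) ^ k"
    unfolding BP_def using assms by (simp add: card_PiE n_subsets)
  moreover have "(card A choose q) \<le> card A ^ q"
    by (cases "q \<le> card A") (auto simp: binomial_le_pow binomial_eq_0)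
  ultimately show ?thesis by (metis mult.commute power_mono power_mult zero_le)
qed

lemma blow_cong: "(\<And>i. i < k \<Longrightarrow> P i = P' i) \<Longrightarrow> blow E A k q P \<longleftrightarrow> blow E A k q P'"
  unfolding blow_def by auto

lemma blow_BP: "blow E A k q P \<Longrightarrow> restrict P {..<k} \<in> BP A k q \<and> blow E A k q (restrict P {..<k})"
  unfolding BP_def using blow_cong[of k P "restrict P {..<k}"] by (auto simp: blow_def)

lemma BP_blow_ex: "(\<exists>P. blow E A k q P) \<longleftrightarrow> (\<exists>P\<in>BP A k q. blow E A k q P)"
  using blow_BP by blast

section \<open>Growth of the number of colourable graphs\<close>

lemma two_powr_card_Pow: "finite B \<Longrightarrow> real (card (Pow B)) = 2 powr (card B)"
  by (simp add: card_Pow powr_realpow)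

text \<open>Put the new vertex into a smallest colour class and join it arbitrarily to the other classes.\<close>
lemma Col_insert:
  assumes "finite B" "x \<notin> B" "l \<ge> 1"
  shows "card (Col l B) * 2 powr ((1 - 1/l) * card B) \<le> card (Col l (insert x B))"
proof -
  \<comment> \<open>One colouring per graph is fixed, so that the pairs counted below consist of a
    graph and a neighbourhood and no graph occurs with several colourings.\<close>
  define c where "c H = (SOME c. proper l B H c)" for H
  have c: "proper l B H (c H)" if "H \<in> Col l B" for H
    using that someI_ex[of "proper l B H"] unfolding c_def Col_def by blast
  define Z where "Z H i = {v \<in> B. c H v = i}" for H i
  have ex: "\<exists>i<l. card (Z H i) \<le> card B / l" if H: "H \<in> Col l B" for H
  proof (rule ccontr)
    assume "\<not> ?thesis"
    then have gt: "card B / l < card (Z H i)" if "i < l" for i using that by force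
    have "B = (\<Union>i<l. Z H i)" using c[OF H] by (auto simp: Z_def proper_def)
    then have "card B \<le> (\<Sum>i<l. card (Z H i))" using card_UN_le by (metis finite_lessThan)
    moreover have disj: "card (\<Union>i\<in>{..<l}. Z H i) = (\<Sum>i\<in>{..<l}. card (Z H i))"
      by (rule card_UN_disjoint) (auto simp: Z_def assms)
    then have "real (card B) = (\<Sum>i<l. real (card (Z H i)))"
      using \<open>B = (\<Union>i<l. Z H i)\<close> by (metis of_nat_sum)
    moreover have "(\<Sum>i<l. card B / l) < (\<Sum>i<l. real (card (Z H i)))"
      by (rule sum_strict_mono) (use gt assms(3) in \<open>auto simp: lessThan_empty_iff\<close>)
    ultimately show False using assms(3) by simp
  qed
  define i where "i H = (SOME i. i < l \<and> card (Z H i) \<le> card B / l)" for H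
  have i: "i H < l \<and> card (Z H (i H)) \<le> card B / l" if "H \<in> Col l B" for H
    unfolding i_def by (rule someI_ex[OF ex[OF that]])
  define N where "N H = Pow (B - Z H (i H))" for H
  define ins where "ins = (\<lambda>(H, M). \<lambda>u v. H u v \<or> (u = x \<and> v \<in> M) \<or> (v = x \<and> u \<in> (M::'a set)))"
  have grH: "H \<in> gr B" if "H \<in> Col l B" for H using that by (simp add: Col_def)
  have "card (Sigma (Col l B) N) \<le> card (Col l (insert x B))"
  proof (rule card_inj_on_le[where f = ins])
    show "inj_on ins (Sigma (Col l B) N)"
    proof (rule inj_onI, clarify)
      fix H M H' M' assume a: "H \<in> Col l B" "M \<in> N H" "H' \<in> Col l B" "M' \<in> N H'" "ins (H, M) = ins (H', M')"
      have e: "ins (H, M) u v = ins (H', M') u v" for u v using a(5) by simp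
      have M: "M \<subseteq> B" "M' \<subseteq> B" using a by (auto simp: N_def)
      have "H u v = H' u v" for u v
        using e[of u v] M assms(2) gr_dom[OF grH[OF a(1)], of u v] gr_dom[OF grH[OF a(3)], of u v]
        unfolding ins_def by auto
      moreover have "u \<in> M \<longleftrightarrow> u \<in> M'" for u
        using e[of x u] M assms(2) gr_dom[OF grH[OF a(1)], of x u] gr_dom[OF grH[OF a(3)], of x u]
        unfolding ins_def by auto
      ultimately show "H = H' \<and> M = M'" by (auto simp: fun_eq_iff)
    qed
    show "ins ` Sigma (Col l B) N \<subseteq> Col l (insert x B)"
    proof clarify
      fix H M assume a: "H \<in> Col l B" "M \<in> N H"
      have M: "M \<subseteq> B - Z H (i H)" using a by (simp add: N_def)
      have "ins (H, M) \<in> gr (insert x B)"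
        using grH[OF a(1)] M assms(2) unfolding ins_def gr_def graph_def by auto
      moreover have "proper l (insert x B) (ins (H, M)) ((c H)(x := i H))"
        using c[OF a(1)] i[OF a(1)] M assms(2) gr_dom[OF grH[OF a(1)]]
        unfolding proper_def ins_def Z_def by auto
      ultimately show "ins (H, M) \<in> Col l (insert x B)" unfolding Col_def by blast
    qed
  qed (rule Col_finite, use assms in simp)
  moreover have "card (Sigma (Col l B) N) = (\<Sum>H\<in>Col l B. card (N H))"
    by (rule card_SigmaI) (use Col_finite assms in \<open>auto simp: N_def\<close>)
  moreover have "(\<Sum>H\<in>Col l B. 2 powr ((1 - 1/l) * card B)) \<le> (\<Sum>H\<in>Col l B. real (card (N H)))"
  proof (rule sum_mono)
    fix H assume H: "H \<in> Col l B"
    have "card (B - Z H (i H)) = card B - card (Z H (i H))"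
      by (rule card_Diff_subset) (use assms in \<open>auto simp: Z_def\<close>)
    moreover have "card (Z H (i H)) \<le> card B" by (rule card_mono) (use assms in \<open>auto simp: Z_def\<close>)
    ultimately have "(1 - 1/l) * card B \<le> card (B - Z H (i H))"
      using i[OF H] by (simp add: algebra_simps)
    then show "2 powr ((1 - 1/l) * card B) \<le> card (N H)"
      unfolding N_def using assms by (subst two_powr_card_Pow) auto
  qed
  ultimately show ?thesis by (simp flip: of_nat_sum)
qed

text \<open>Summing \<open>a * p\<close> over the successive sizes gives
  \<open>a * (p^2 - b^2) / 2\<close> up to an error of \<open>a / 2\<close> per vertex, which the
  linear term pays for.\<close>

lemma Col_growth_step:
  fixes a p b :: real
  assumes "a \<le> 1"
  shows "a * ((p + 1)^2 - b^2) / 2 - (p + 1 - b) \<le> (a * (p^2 - b^2) / 2 - (p - b)) + a * p"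
proof -
  have "a * ((p + 1)^2 - b^2) / 2 = a * (p^2 - b^2) / 2 + a * p + a / 2"
    by (simp add: power2_eq_square field_simps)
  then show ?thesis using assms by linarith
qed

text \<open>The lower bound is relative to an arbitrary subset \<open>B\<close>: with
  \<open>B = A - S\<close> it prices the removal of \<open>S\<close> (\<open>Col_remove\<close>),
  with \<open>B = {}\<close> it gives the absolute bound \<open>Col_lower\<close>.\<close>

lemma Col_growth:
  assumes "finite A" "B \<subseteq> A" "l \<ge> 1"
  shows "card (Col l B) * 2 powr ((1 - 1/l) * ((real (card A))^2 - (real (card B))^2) / 2 - (real (card A) - card B))
    \<le> card (Col l A)"
proof -
  have fB: "finite B" using assms finite_subset by blast
  have "finite (A - B)" using assms by auto
  then show ?thesis using assms(1,2)
  proof (induction "A - B" arbitrary: A rule: finite_induct)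
    case empty then have "A = B" by auto then show ?case by simp
  next
    case (insert x D)
    let ?A = "A - {x}" let ?a = "1 - 1/real l"
    have x: "x \<in> A" "x \<notin> B" using insert by auto
    have cA: "real (card A) = real (card ?A) + 1" using card_Suc_Diff1[OF insert.prems(1) x(1)] by simp
    have IH: "card (Col l B) * 2 powr (?a * ((real (card ?A))^2 - (real (card B))^2) / 2 - (real (card ?A) - card B))
      \<le> card (Col l ?A)" using insert by (intro insert(3)) auto
    have step: "card (Col l ?A) * 2 powr (?a * card ?A) \<le> card (Col l A)"
      using Col_insert[of ?A x l] insert.prems assms(3) x by (simp add: insert_absorb)
    have "?a * ((real (card A))^2 - (real (card B))^2) / 2 - (real (card A) - card B)
       \<le> (?a * ((real (card ?A))^2 - (real (card B))^2) / 2 - (real (card ?A) - card B)) + ?a * card ?A"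
      unfolding cA by (rule Col_growth_step) simp
    then have "card (Col l B) * 2 powr (?a * ((real (card A))^2 - (real (card B))^2) / 2 - (real (card A) - card B))
      \<le> card (Col l B) * (2 powr (?a * ((real (card ?A))^2 - (real (card B))^2) / 2 - (real (card ?A) - card B)) * 2 powr (?a * card ?A))"
      by (intro mult_left_mono) (simp_all flip: powr_add)
    also have "\<dots> \<le> card (Col l ?A) * 2 powr (?a * card ?A)"
      using mult_right_mono[OF IH, of "2 powr (?a * card ?A)"] by (simp add: mult.assoc)
    also note step
    finally show ?case .
  qed
qed

section \<open>Traces on a blow-up\<close>

lemma nat_le_powr:
  fixes \<epsilon> :: real
  assumes "\<epsilon> > 0"
  shows "\<exists>C\<ge>0. \<forall>n::nat. real n \<le> 2 powr (\<epsilon> * n + C)"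
proof (intro exI conjI allI)
  let ?C = "max 0 (log 2 (1 / (\<epsilon> * ln 2)))"
  fix n :: nat
  have pos: "\<epsilon> * ln 2 > 0" using assms by simp
  have "\<epsilon> * ln 2 * n \<le> 2 powr (\<epsilon> * n)"
  proof -
    have "\<epsilon> * n * ln 2 \<le> exp (\<epsilon> * n * ln 2)"
      using exp_ge_add_one_self[of "\<epsilon> * n * ln 2"] by linarith
    then show ?thesis by (simp add: powr_def mult_ac)
  qed
  then have "n \<le> 2 powr (\<epsilon> * n) * (1 / (\<epsilon> * ln 2))"
    using pos by (simp add: field_simps)
  also have "1 / (\<epsilon> * ln 2) = 2 powr (log 2 (1 / (\<epsilon> * ln 2)))" using pos by simp
  also have "2 powr (\<epsilon> * n) * \<dots> \<le> 2 powr (\<epsilon> * n) * 2 powr ?C"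
    by (intro mult_left_mono) auto
  finally show "n \<le> 2 powr (\<epsilon> * n + ?C)" by (simp add: powr_add)
qed auto

lemma poly_le_powr:
  fixes K \<epsilon> :: real
  assumes "\<epsilon> > 0"
  shows "\<exists>Q0. \<forall>Q\<ge>Q0. K * (real Q + 1) ^ p \<le> 2 powr (\<epsilon> * Q)"
proof -
  \<comment> \<open>With this choice \<open>p * d \<le> \<epsilon> / 2\<close>: half of the exponent
    covers the power \<open>p\<close>, the other half all constants.\<close>
  define d where "d = \<epsilon> / (2 * (real p + 1))"
  have "d > 0" using assms by (simp add: d_def)
  from nat_le_powr[OF this] obtain C where C: "C \<ge> 0" "\<And>n::nat. real n \<le> 2 powr (d * n + C)" by blast
  define K' where "K' = log 2 (max K 1)"
  have K': "K \<le> 2 powr K'" unfolding K'_def by simp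
  let ?Q0 = "nat \<lceil>(K' + p * d + p * C) / (\<epsilon> / 2)\<rceil>"
  show ?thesis
  proof (intro exI allI impI)
    fix Q assume "Q \<ge> ?Q0"
    then have "(K' + p * d + p * C) / (\<epsilon> / 2) \<le> Q" by linarith
    then have Q: "K' + p * d + p * C \<le> \<epsilon> / 2 * Q"
      by (subst (asm) pos_divide_le_eq) (use assms in \<open>simp_all add: mult.commute\<close>)
    have "(real Q + 1) ^ p \<le> (2 powr (d * (Q + 1) + C)) ^ p"
      using C(2)[of "Q + 1"] by (intro power_mono) (auto simp: algebra_simps)
    also have "\<dots> = 2 powr (p * (d * (Q + 1) + C))" by (simp add: powr_power)
    finally have "K * (real Q + 1) ^ p \<le> 2 powr K' * 2 powr (p * (d * (Q + 1) + C))"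
      using K' by (intro mult_mono) auto
    also have "\<dots> = 2 powr (K' + p * d + p * C + (p * d) * Q)" by (simp add: powr_add[symmetric] algebra_simps)
    also have "\<dots> \<le> 2 powr (\<epsilon> * Q)"
    proof -
      have "p * d \<le> \<epsilon> / 2" using assms by (simp add: d_def field_simps)
      then have "(p * d) * Q \<le> \<epsilon> / 2 * Q" by (intro mult_right_mono) auto
      then have "K' + p * d + p * C + (p * d) * Q \<le> \<epsilon> / 2 * Q + \<epsilon> / 2 * Q" using Q by linarith
      then show ?thesis by simp
    qed
    finally show "K * (real Q + 1) ^ p \<le> 2 powr (\<epsilon> * Q)" .
  qed
qed

text \<open>Below \<open>n = L / \<epsilon>\<close> the constant dominates the linear term, above it
  the quadratic term does. This absorbs the factors exponential in \<open>n\<close> that accumulate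
  in iterated removals.\<close>

lemma linear_le_quadratic:
  assumes "(\<epsilon>::real) > 0" "L \<ge> 0" "n \<ge> 0"
  shows "L * n \<le> \<epsilon> * n^2 + L^2 / \<epsilon>"
proof (cases "n \<le> L / \<epsilon>")
  case True
  then have "L * n \<le> L * (L / \<epsilon>)" using assms by (intro mult_left_mono)
  moreover have "0 \<le> \<epsilon> * n^2" using assms by simp
  moreover have "L * (L / \<epsilon>) = L^2 / \<epsilon>" by (simp add: power2_eq_square)
  ultimately show ?thesis by linarith
next
  case False
  then have "L \<le> \<epsilon> * n" using assms by (simp add: field_simps)
  then have "L * n \<le> \<epsilon> * n * n" using assms by (intro mult_right_mono)
  moreover have "0 \<le> L^2 / \<epsilon>" using assms by simp
  moreover have "\<epsilon> * n * n = \<epsilon> * n^2" by (simp add: power2_eq_square)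
  ultimately show ?thesis by linarith
qed

text \<open>The set of vertices with an exceptional pattern can be chosen in at most
  \<open>2 ^ card D\<close> ways. Given this set, an ordinary vertex has at most \<open>g\<close>
  patterns and an exceptional one at most \<open>2 powr r\<close> times as many.\<close>

lemma card_exceptional_patterns:
  fixes g r w :: real
  assumes "finite D" "finite S" "G \<subseteq> Pow S" "card G \<le> g" "g \<ge> 1" "2 ^ card S \<le> g * 2 powr r" "r \<ge> 0"
  shows "card {f \<in> PiE D (\<lambda>_. Pow S). card {v \<in> D. f v \<notin> G} \<le> w} \<le> 2 ^ card D * (g ^ card D * 2 powr (r * w))"
proof -
  let ?I = "{Z. Z \<subseteq> D \<and> card Z \<le> w}"
  let ?Z = "\<lambda>Z. PiE D (\<lambda>v. if v \<in> Z then Pow S else G)"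
  have fG: "finite G" using assms finite_subset by blast
  have fI: "finite ?I" using assms by simp
  have "card ?I \<le> card (Pow D)" by (rule card_mono) (use assms in auto)
  then have cI: "real (card ?I) \<le> 2 ^ card D" using assms by (simp add: card_Pow)
  have "card {f \<in> PiE D (\<lambda>_. Pow S). card {v \<in> D. f v \<notin> G} \<le> w} \<le> card ?I * (g ^ card D * 2 powr (r * w))"
  proof (rule card_UN_bound[where Z = ?Z, OF fI])
    show "{f \<in> PiE D (\<lambda>_. Pow S). card {v \<in> D. f v \<notin> G} \<le> w} \<subseteq> (\<Union>Z\<in>?I. ?Z Z)"
    proof
      fix f assume f: "f \<in> {f \<in> PiE D (\<lambda>_. Pow S). card {v \<in> D. f v \<notin> G} \<le> w}"
      then have 1: "f \<in> ?Z {v \<in> D. f v \<notin> G}" by (auto simp: PiE_iff)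
      have 2: "{v \<in> D. f v \<notin> G} \<in> ?I" using f by auto
      show "f \<in> (\<Union>Z\<in>?I. ?Z Z)" by (rule UN_I[where a = "{v \<in> D. f v \<notin> G}" and B = ?Z, OF 2 1])
    qed
    fix Z assume Z: "Z \<in> ?I"
    show "finite (?Z Z)" by (rule finite_PiE) (use assms fG in auto)
    have "real (card (?Z Z)) = (\<Prod>v\<in>D. real (card (if v \<in> Z then Pow S else G)))"
      unfolding card_PiE[OF assms(1)] by (rule of_nat_prod)
    also have "\<dots> \<le> (\<Prod>v\<in>D. g * (if v \<in> Z then 2 powr r else 1))"
      by (rule prod_mono) (use assms in \<open>auto simp: card_Pow\<close>)
    also have "\<dots> = g ^ card D * (\<Prod>v\<in>D. if v \<in> Z then 2 powr r else 1)"
      by (simp add: prod.distrib)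
    also have "(\<Prod>v\<in>D. if v \<in> Z then 2 powr r else 1) = (2 powr r) ^ card (D \<inter> Z)"
      using assms(1) by (simp add: prod.inter_restrict[symmetric])
    also have "D \<inter> Z = Z" using Z by auto
    also have "(2 powr r) ^ card Z = 2 powr (r * card Z)" by (simp add: powr_power mult.commute)
    also have "g ^ card D * 2 powr (r * card Z) \<le> g ^ card D * 2 powr (r * w)"
      using Z assms by (intro mult_left_mono) (auto intro!: mult_left_mono)
    finally show "real (card (?Z Z)) \<le> g ^ card D * 2 powr (r * w)" .
  qed
  also have "\<dots> \<le> 2 ^ card D * (g ^ card D * 2 powr (r * w))"
    using cI assms by (intro mult_right_mono) auto
  finally show ?thesis .
qed

lemma card_pattern_removal:
  fixes g r w :: real
  assumes "finite A" "S \<subseteq> A" "X \<subseteq> gr A" "finite Y" "\<And>E. E \<in> X \<Longrightarrow> res (A - S) E \<in> Y"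
    and "G \<subseteq> Pow S" "card G \<le> g" "g \<ge> 1" "2 ^ card S \<le> g * 2 powr r" "r \<ge> 0"
    and ex: "\<And>E. E \<in> X \<Longrightarrow> card {v \<in> A - S. nb E v \<inter> S \<notin> G} \<le> w"
  shows "card X \<le> card Y * (2 ^ (card S)^2 * (2 ^ card A * (g ^ card A * 2 powr (r * w))))"
proof (rule card_removal[OF assms(1-5), where g = "\<lambda>E. \<lambda>v\<in>A - S. nb E v \<inter> S"
      and \<Phi> = "\<lambda>_. {f \<in> PiE (A - S) (\<lambda>_. Pow S). card {v \<in> A - S. f v \<notin> G} \<le> w}"])
  have fS: "finite S" using assms finite_subset by blast
  { fix E E' assume a: "E \<in> X" "E' \<in> X" "res (A - S) E = res (A - S) E'" "res S E = res S E'"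
      and e: "(\<lambda>v\<in>A - S. nb E v \<inter> S) = (\<lambda>v\<in>A - S. nb E' v \<inter> S)"
    show "E = E'"
    proof (rule determined_by_traces[OF _ _ assms(2) a(3,4)])
      show "E \<in> gr A" "E' \<in> gr A" using a assms by auto
      show "nb E v \<inter> S = nb E' v \<inter> S" if "v \<in> A - S" for v
        using fun_cong[OF e, of v] that by simp
    qed }
  show "finite {f \<in> PiE (A - S) (\<lambda>_. Pow S). card {v \<in> A - S. f v \<notin> G} \<le> w}"
    by (rule finite_subset[OF _ finite_PiE[of "A - S" "\<lambda>_. Pow S"]]) (use assms fS in auto)
  have "card {f \<in> PiE (A - S) (\<lambda>_. Pow S). card {v \<in> A - S. f v \<notin> G} \<le> w}
    \<le> 2 ^ card (A - S) * (g ^ card (A - S) * 2 powr (r * w))"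
    by (rule card_exceptional_patterns) (use assms fS in auto)
  also have "\<dots> \<le> 2 ^ card A * (g ^ card A * 2 powr (r * w))"
  proof -
    have "card (A - S) \<le> card A" by (rule card_mono) (use assms in auto)
    then show ?thesis using assms(8) by (intro mult_mono power_increasing) auto
  qed
  finally show "card {f \<in> PiE (A - S) (\<lambda>_. Pow S). card {v \<in> A - S. f v \<notin> G} \<le> w} \<le> \<dots>" .
  fix E assume E: "E \<in> X"
  have "{v \<in> A - S. (\<lambda>v\<in>A - S. nb E v \<inter> S) v \<notin> G} = {v \<in> A - S. nb E v \<inter> S \<notin> G}" by auto
  then show "(\<lambda>v\<in>A - S. nb E v \<inter> S) \<in> {f \<in> PiE (A - S) (\<lambda>_. Pow S). card {v \<in> A - S. f v \<notin> G} \<le> w}"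
    using ex[OF E] by auto
qed

lemma sum_binomial_le: "(\<Sum>j<q. Q choose j) \<le> (Q + 1) ^ q"
proof (induction q)
  case (Suc q)
  have "(Q choose q) \<le> Q * (Q + 1) ^ q" if "q > 0"
  proof (cases "q \<le> Q")
    case True
    then have "(Q choose q) \<le> Q ^ q" by (rule binomial_le_pow)
    also have "\<dots> \<le> Q * (Q + 1) ^ q"
    proof -
      have "Q ^ q = Q * Q ^ (q - 1)" using that by (metis power_eq_if not_gr0)
      also have "Q ^ (q - 1) \<le> (Q + 1) ^ (q - 1)" by (rule power_mono) auto
      also have "(Q + 1) ^ (q - 1) \<le> (Q + 1) ^ q" by (rule power_increasing) auto
      finally show ?thesis by simp
    qed
    finally show ?thesis .
  qed (auto simp: binomial_eq_0)
  then show ?case using Suc by (cases "q = 0") (auto simp: algebra_simps)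
qed auto

text \<open>The possible traces of an outside vertex on a blow-up, except for boundedly many vertices
  if the graph has no blow-up of the next larger clique.\<close>
definition light :: "(nat \<Rightarrow> 'a set) \<Rightarrow> nat \<Rightarrow> nat \<Rightarrow> 'a set set" where
  "light P k q = {T \<in> Pow (PU P k). \<exists>i<k. card (T \<inter> P i) < q}"

lemma card_small_subsets:
  assumes "finite B"
  shows "card {T. T \<subseteq> B \<and> card T < q} \<le> (card B + 1) ^ q"
proof -
  have "{T. T \<subseteq> B \<and> card T < q} = (\<Union>j<q. {T. T \<subseteq> B \<and> card T = j})" by auto
  then have "card {T. T \<subseteq> B \<and> card T < q} \<le> (\<Sum>j<q. card {T. T \<subseteq> B \<and> card T = j})"
    by (simp only:) (rule card_UN_le, simp)
  also have "\<dots> = (\<Sum>j<q. card B choose j)" using assms by (simp add: n_subsets)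
  finally show ?thesis using sum_binomial_le[of "card B" q] by linarith
qed

text \<open>A part met in fewer than \<open>q\<close> vertices contributes only polynomially many
  choices in \<open>Q\<close>, and the trace is free on the other \<open>(k - 1) * Q\<close>
  vertices. Thus a light trace carries a fraction of about \<open>dens k\<close> of the
  \<open>k * Q\<close> possible bits.\<close>

lemma card_light:
  assumes "blow E A k Q P" "E \<in> gr B"
  shows "card (light P k q) \<le> k * ((Q + 1) ^ q * 2 ^ ((k - 1) * Q))"
proof -
  let ?S = "PU P k"
  have fS: "finite ?S" using PU_finite assms by blast
  have "light P k q = (\<Union>i<k. {T \<in> Pow ?S. card (T \<inter> P i) < q})" unfolding light_def by auto
  then have "card (light P k q) \<le> (\<Sum>i<k. card {T \<in> Pow ?S. card (T \<inter> P i) < q})"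
    by (simp only:) (rule card_UN_le, simp)
  also have "\<dots> \<le> (\<Sum>i<k. (Q + 1) ^ q * 2 ^ ((k - 1) * Q))"
  proof (rule sum_mono)
    fix i assume "i \<in> {..<k}" then have i: "i < k" by simp
    have Pi: "finite (P i)" "card (P i) = Q" "P i \<subseteq> ?S" using i assms(1) by (auto simp: blow_def PU_def)
    have "card {T \<in> Pow ?S. card (T \<inter> P i) < q} \<le> card ({T. T \<subseteq> P i \<and> card T < q} \<times> Pow (?S - P i))"
    proof (rule card_inj_on_le[where f = "\<lambda>T. (T \<inter> P i, T - P i)"])
      show "inj_on (\<lambda>T. (T \<inter> P i, T - P i)) {T \<in> Pow ?S. card (T \<inter> P i) < q}"
        by (rule inj_onI) blast
      show "finite ({T. T \<subseteq> P i \<and> card T < q} \<times> Pow (?S - P i))"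
        using Pi fS by (intro finite_cartesian_product) auto
    qed auto
    also have "\<dots> = card {T. T \<subseteq> P i \<and> card T < q} * 2 ^ card (?S - P i)"
      using fS by (simp add: card_cartesian_product card_Pow)
    also have "card (?S - P i) = (k - 1) * Q"
      using Pi fS PU_card[OF assms] by (simp add: card_Diff_subset diff_mult_distrib)
    finally show "card {T \<in> Pow ?S. card (T \<inter> P i) < q} \<le> (Q + 1) ^ q * 2 ^ ((k - 1) * Q)"
      using card_small_subsets[OF Pi(1), of q] Pi(2) by (smt (verit) mult_le_mono1 order_trans)
  qed
  finally show ?thesis by simp
qed

text \<open>Vertices sharing one heavy trace can serve as a new part: \<open>q\<close> of them, with
  \<open>q\<close> vertices of the trace in each old part, form a blow-up of the next larger clique.
  So each of the at most \<open>2 ^ (k * Q)\<close> heavy traces occurs boundedly often.\<close>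

lemma few_heavy:
  assumes "finite A" "E \<in> gr A" "blow E A k Q P" "\<not> (\<exists>P. blow E A (Suc k) q P)"
  shows "card {v \<in> A - PU P k. nb E v \<inter> PU P k \<notin> light P k q} \<le> q * 2 ^ (k * Q)"
proof -
  let ?S = "PU P k"
  have fS: "finite ?S" using PU_finite assms by blast
  let ?I = "Pow ?S - light P k q"
  have "{v \<in> A - ?S. nb E v \<inter> ?S \<notin> light P k q} \<subseteq> (\<Union>T\<in>?I. {v \<in> A - ?S. nb E v \<inter> ?S = T})" by auto
  then have "card {v \<in> A - ?S. nb E v \<inter> ?S \<notin> light P k q} \<le> card (\<Union>T\<in>?I. {v \<in> A - ?S. nb E v \<inter> ?S = T})"
    by (rule card_mono[rotated]) (use fS assms in auto)
  also have "\<dots> \<le> (\<Sum>T\<in>?I. card {v \<in> A - ?S. nb E v \<inter> ?S = T})"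
    by (rule card_UN_le) (use fS in auto)
  also have "\<dots> \<le> (\<Sum>T\<in>?I. q)"
  proof (rule sum_mono)
    fix T assume T: "T \<in> ?I"
    show "card {v \<in> A - ?S. nb E v \<inter> ?S = T} \<le> q"
    proof (rule ccontr)
      assume "\<not> ?thesis"
      then obtain V where V: "V \<subseteq> {v \<in> A - ?S. nb E v \<inter> ?S = T}" "card V = q"
        by (meson nat_le_linear obtain_subset_with_card_n)
      have "\<exists>B. B \<subseteq> T \<inter> P i \<and> card B = q" if "i < k" for i
      proof -
        have "q \<le> card (T \<inter> P i)" using T that unfolding light_def by force
        from obtain_subset_with_card_n[OF this] show ?thesis by metis
      qed
      then obtain B where B: "\<And>i. i < k \<Longrightarrow> B i \<subseteq> T \<inter> P i" "\<And>i. i < k \<Longrightarrow> card (B i) = q" by metis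
      have "blow E A k q B" by (rule blow_shrink[OF assms(3)]) (use B in auto)
      moreover have "E u v" if "u \<in> V" "v \<in> B i" "i < k" for u v i
        using V(1) B(1)[OF that(3)] that by (auto simp: nb_def)
      moreover have "V \<subseteq> A" using V(1) by blast
      moreover have "finite V" using \<open>V \<subseteq> A\<close> assms(1) finite_subset by blast
      ultimately have "blow E A (Suc k) q (B(k := V))"
        using V(2) gr_sym[OF assms(2)] unfolding blow_def by (simp add: less_Suc_eq)
      then show False using assms(4) by blast
    qed
  qed
  also have "\<dots> \<le> card (Pow ?S) * q"
    using fS by (auto intro!: mult_right_mono card_mono)
  also have "\<dots> = q * 2 ^ (k * Q)" using fS PU_card[OF assms(3,2)] by (simp add: card_Pow)
  finally show ?thesis .
qed

section \<open>Rough counting by peeling off blow-ups\<close>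

text \<open>The Turan density \<open>1 - 1 / k\<close>; division by zero makes \<open>dens 0 = 0\<close>.\<close>
definition dens :: "nat \<Rightarrow> real" where
  "dens k = (real k - 1) / real k"

lemma dens_eq: "k \<ge> 1 \<Longrightarrow> dens k = 1 - 1 / real k"
  by (simp add: dens_def field_simps)

lemma dens_mono: "dens k \<le> dens (Suc k)"
  by (cases "k = 0") (auto simp: dens_def field_simps)

text \<open>Removing \<open>s = k * Q\<close> vertices lowers \<open>d * n^2 / 2\<close> by
  \<open>(k - 1) * Q * n\<close> to first order, which is precisely the exponent of the light
  traces. The two errors linear in \<open>n\<close>, from the choice of the blow-up and from the
  polynomial factor in \<open>card_light\<close>, are paid by the decrease
  \<open>2 * \<epsilon> * s * n\<close> of \<open>\<epsilon> * n^2\<close>.\<close>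

lemma recursion_exponents:
  fixes s n \<epsilon> C k Q :: real
  assumes "s = k * Q" "k \<ge> 1" "Q \<ge> 0" "n \<ge> 0" "\<epsilon> > 0" "d * k = k - 1"
  shows "(\<epsilon> * s * n + s * C) + (s^2 + (\<epsilon> * Q * n + (k - 1) * Q * n + e)) + (d * (n - s)^2 / 2 + \<epsilon> * (n - s)^2)
    \<le> (d * s^2 / 2 + \<epsilon> * s^2 + s * C + s^2 + e) + (d * n^2 / 2 + \<epsilon> * n^2)"
proof -
  have "d * (n - s)^2 / 2 = d * n^2 / 2 - (d * k) * Q * n + d * s^2 / 2"
    unfolding assms(1) by (simp add: power2_eq_square field_simps)
  moreover have "(d * k) * Q * n = (k - 1) * Q * n" using assms(6) by simp
  moreover have "\<epsilon> * (n - s)^2 = \<epsilon> * n^2 - 2 * (\<epsilon> * s * n) + \<epsilon> * s^2"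
    by (simp add: power2_eq_square field_simps)
  moreover have "\<epsilon> * Q * n \<le> \<epsilon> * s * n"
    unfolding assms(1) using assms(2-5) mult_right_mono[of 1 k Q] by (intro mult_right_mono mult_left_mono) auto
  ultimately show ?thesis by argo
qed

text \<open>A large blow-up \<open>S\<close> of \<open>K\<^sub>k\<close> can be removed at a cost of at most \<open>2\<close> to the \<open>(dens k + \<epsilon>) \<bar>S\<bar> n\<close>, since nearly
  all traces on it are light. Iterating, the bound for graphs without such a blow-up carries over to all of \<open>X\<close>,
  up to a factor \<open>2\<close> to the \<open>\<epsilon> n\<^sup>2\<close>; \<open>\<tau>\<close> is an offset independent of \<open>n\<close>.\<close>
lemma blowup_recursion:
  fixes \<epsilon> :: real
  assumes k: "k \<ge> 1" and q: "q \<ge> 1" and eps: "\<epsilon> > 0"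
  shows "\<exists>Q0. \<forall>Q\<ge>Q0. \<forall>D'. \<exists>D. \<forall>\<tau> (X :: 'a set \<Rightarrow> ('a \<Rightarrow> 'a \<Rightarrow> bool) set).
    (\<forall>A. finite A \<longrightarrow> X A \<subseteq> {E \<in> gr A. \<not> (\<exists>P. blow E A (Suc k) q P)}) \<longrightarrow>
    (\<forall>A E P. finite A \<longrightarrow> E \<in> X A \<longrightarrow> blow E A k Q P \<longrightarrow> res (A - PU P k) E \<in> X (A - PU P k)) \<longrightarrow>
    (\<forall>A. finite A \<longrightarrow> card {E \<in> X A. \<not> (\<exists>P. blow E A k Q P)}
        \<le> 2 powr (dens k * (card A)^2 / 2 + \<epsilon> * (card A)^2 + D' + \<tau>)) \<longrightarrow>
    (\<forall>A. finite A \<longrightarrow> card (X A) \<le> 2 powr (dens k * (card A)^2 / 2 + 2 * \<epsilon> * (card A)^2 + D + \<tau>))"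
proof -
  obtain Q1 where Q1: "\<And>Q. Q \<ge> Q1 \<Longrightarrow> 2 * real k * (real Q + 1) ^ q \<le> 2 powr (\<epsilon> * Q)"
    using poly_le_powr[OF eps, of "2 * real k" q] by blast
  obtain C where C: "C \<ge> 0" "\<And>n::nat. real n \<le> 2 powr (\<epsilon> * n + C)" using nat_le_powr[OF eps] by blast
  show ?thesis
  proof (rule exI[where x = "max Q1 1"], intro allI impI)
    fix Q D' assume "Q \<ge> max Q1 1"
    then have Q: "Q \<ge> Q1" "Q \<ge> 1" by auto
    let ?d = "dens k"
    define s where "s = k * Q"
    have s1: "s \<ge> 1" using k Q by (simp add: s_def)
    define g where "g = real k * ((real Q + 1) ^ q * 2 ^ ((k - 1) * Q))"
    have g1: "g \<ge> 1"
    proof -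
      have "1 * (1 * 1) \<le> g" unfolding g_def using k by (intro mult_mono one_le_power) auto
      then show ?thesis by simp
    qed
    \<comment> \<open>At most \<open>q * 2 ^ s\<close> vertices have a heavy trace, and each costs a
      factor of at most \<open>2 powr s\<close>.\<close>
    define e where "e = real s * real (q * 2 ^ s)"
    \<comment> \<open>\<open>L\<close> collects everything in one removal step that does not depend
      on the number of vertices.\<close>
    define L where "L = 2 powr (?d * s^2 / 2 + \<epsilon> * s^2 + s * C + s^2 + e)"
    have L0: "L > 0" by (simp add: L_def)
    \<comment> \<open>The second summand is the constant left over when \<open>(1 + L) ^ n\<close>
      is absorbed into a second \<open>\<epsilon> * n^2\<close>.\<close>
    define D where "D = D' + (log 2 (1 + L))^2 / \<epsilon>"
    show "\<exists>D. \<forall>\<tau> (X :: 'a set \<Rightarrow> ('a \<Rightarrow> 'a \<Rightarrow> bool) set).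
    (\<forall>A. finite A \<longrightarrow> X A \<subseteq> {E \<in> gr A. \<not> (\<exists>P. blow E A (Suc k) q P)}) \<longrightarrow>
    (\<forall>A E P. finite A \<longrightarrow> E \<in> X A \<longrightarrow> blow E A k Q P \<longrightarrow> res (A - PU P k) E \<in> X (A - PU P k)) \<longrightarrow>
    (\<forall>A. finite A \<longrightarrow> card {E \<in> X A. \<not> (\<exists>P. blow E A k Q P)}
        \<le> 2 powr (dens k * (card A)^2 / 2 + \<epsilon> * (card A)^2 + D' + \<tau>)) \<longrightarrow>
    (\<forall>A. finite A \<longrightarrow> card (X A) \<le> 2 powr (dens k * (card A)^2 / 2 + 2 * \<epsilon> * (card A)^2 + D + \<tau>))"
    proof (rule exI[where x = D], intro allI impI)
      fix \<tau> :: real and X :: "'a set \<Rightarrow> ('a \<Rightarrow> 'a \<Rightarrow> bool) set" and A0 :: "'a set"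
      assume X1: "\<forall>A. finite A \<longrightarrow> X A \<subseteq> {E \<in> gr A. \<not> (\<exists>P. blow E A (Suc k) q P)}"
        and X2: "\<forall>A E P. finite A \<longrightarrow> E \<in> X A \<longrightarrow> blow E A k Q P \<longrightarrow> res (A - PU P k) E \<in> X (A - PU P k)"
        and X3: "\<forall>A. finite A \<longrightarrow> card {E \<in> X A. \<not> (\<exists>P. blow E A k Q P)}
          \<le> 2 powr (?d * (card A)^2 / 2 + \<epsilon> * (card A)^2 + D' + \<tau>)"
        and A0: "finite A0"
      have finX: "finite (X A)" if "finite A" for A
        by (rule finite_subset[OF _ gr_finite[OF that]]) (use X1 that in blast)
      define B where "B n = 2 powr (?d * n^2 / 2 + \<epsilon> * n^2 + D' + \<tau>)" for n :: nat
      \<comment> \<open>In the factor \<open>1 + L\<close> per vertex, the \<open>1\<close> stands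
        for the graphs from which nothing can be peeled and \<open>L\<close> for those with a
        removable blow-up.\<close>
      have main: "finite A \<Longrightarrow> card (X A) \<le> (1 + L) ^ card A * B (card A)" for A
      proof (induction "card A" arbitrary: A rule: less_induct)
        case less
        let ?n = "card A"
        let ?X0 = "{E \<in> X A. \<not> (\<exists>P. blow E A k Q P)}"
        let ?Z = "\<lambda>P. {E \<in> X A. blow E A k Q P}"
        let ?c = "(1 + L) ^ (?n - s) * B (?n - s) * (2 ^ s^2 * (2 ^ ?n * (g ^ ?n * 2 powr e)))"
        have bound: "card (?Z P) \<le> ?c" "?Z P \<noteq> {} \<Longrightarrow> s \<le> ?n" if "P \<in> BP A k Q" for P
        proof -
          let ?S = "PU P k"
          have "card (?Z P) \<le> ?c \<and> (?Z P \<noteq> {} \<longrightarrow> s \<le> ?n)"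
          proof (cases "?Z P = {}")
            case True
            have "0 \<le> ?c" using L0 g1 by (simp add: B_def)
            then show ?thesis unfolding True by simp
          next
            case False
            then obtain E0 where E0: "E0 \<in> X A" "blow E0 A k Q P" by blast
            have gE0: "E0 \<in> gr A" using E0 X1 less.prems by blast
            have S: "?S \<subseteq> A" "card ?S = s" "finite ?S"
              using PU_subset[OF E0(2)] PU_card[OF E0(2) gE0] PU_finite[OF E0(2)] by (auto simp: s_def)
            have cn: "card (A - ?S) = ?n - s" "s \<le> ?n"
              using S less.prems by (auto simp: card_Diff_subset intro: card_mono)
            have IH: "card (X (A - ?S)) \<le> (1 + L) ^ (?n - s) * B (?n - s)"
              using less.hyps[of "A - ?S"] less.prems cn s1 by simp
            have "card (?Z P) \<le> card (X (A - ?S)) *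
               (2 ^ (card ?S)^2 * (2 ^ card A * (g ^ card A * 2 powr (real s * real (q * 2 ^ s)))))"
            proof (rule card_pattern_removal[where G = "light P k q"])
              show "?Z P \<subseteq> gr A" using X1 less.prems by blast
              show "finite (X (A - ?S))" using finX less.prems by blast
              show "light P k q \<subseteq> Pow ?S" by (auto simp: light_def)
              show "real (card (light P k q)) \<le> g"
                using of_nat_mono[OF card_light[OF E0(2) gE0, of q], where 'a = real] by (simp add: g_def algebra_simps)
              show "2 ^ card ?S \<le> g * 2 powr real s"
                using mult_right_mono[OF g1, of "2 ^ s"] S by (simp add: powr_realpow)
              fix E assume E: "E \<in> ?Z P"
              then show "res (A - ?S) E \<in> X (A - ?S)" using X2 less.prems by blast
              show "real (card {v \<in> A - ?S. nb E v \<inter> ?S \<notin> light P k q}) \<le> real (q * 2 ^ s)"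
                unfolding s_def by (rule of_nat_mono, rule few_heavy) (use E X1 less.prems in auto)
            qed (use S less.prems g1 in auto)
            also have "\<dots> \<le> ?c" unfolding S e_def using IH g1 by (intro mult_right_mono) auto
            finally show ?thesis using cn by blast
          qed
          then show "card (?Z P) \<le> ?c" "?Z P \<noteq> {} \<Longrightarrow> s \<le> ?n" by blast+
        qed
        have X0: "card ?X0 \<le> B ?n" using X3 less.prems unfolding B_def by blast
        have XU: "X A = ?X0 \<union> (\<Union>P\<in>BP A k Q. ?Z P)" using BP_blow_ex by blast
        have "card (X A) \<le> card ?X0 + card (\<Union>P\<in>BP A k Q. ?Z P)"
          by (subst XU) (rule card_Un_le)
        moreover have "real (card (\<Union>P\<in>BP A k Q. ?Z P)) \<le> L * ((1 + L) ^ (?n - 1) * B ?n)"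
        proof (cases "\<exists>P\<in>BP A k Q. ?Z P \<noteq> {}")
          case False
          then have e: "(\<Union>P\<in>BP A k Q. ?Z P) = {}" by auto
          show ?thesis unfolding e using L0 by (simp add: B_def)
        next
          case True
          then have sn: "s \<le> ?n" using bound(2) by blast
          have "real (card (\<Union>P\<in>BP A k Q. ?Z P)) \<le> card (BP A k Q) * ?c"
            by (rule card_UN_bound[OF BP_finite[OF less.prems] order_refl]) (use finX less.prems bound(1) in auto)
          also have "\<dots> \<le> real (?n ^ s) * ?c"
            using of_nat_mono[OF BP_card[OF less.prems, of k Q], where 'a = real] L0 g1
            by (intro mult_right_mono) (auto simp: s_def B_def)
          also have "\<dots> \<le> 2 powr (\<epsilon> * s * ?n + s * C) * ?c"
          proof (rule mult_right_mono)
            have "real (?n ^ s) \<le> (2 powr (\<epsilon> * ?n + C)) ^ s"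
              unfolding of_nat_power by (rule power_mono[OF C(2)]) simp
            also have "\<dots> = 2 powr (\<epsilon> * s * ?n + s * C)" by (simp add: powr_power algebra_simps)
            finally show "real (?n ^ s) \<le> 2 powr (\<epsilon> * s * ?n + s * C)" .
          qed (use L0 g1 in \<open>auto simp: B_def\<close>)
          also have "\<dots> \<le> 2 powr (\<epsilon> * s * ?n + s * C) *
              ((1 + L) ^ (?n - 1) * B (?n - s) * 2 powr (s^2 + (\<epsilon> * Q * ?n + (k - 1) * Q * ?n + e)))"
          proof (intro mult_left_mono mult_mono)
            show "(1 + L) ^ (?n - s) \<le> (1 + L) ^ (?n - 1)" using L0 s1 by (intro power_increasing) auto
            have "2 ^ ?n * g ^ ?n = (2 * real k * (real Q + 1) ^ q) ^ ?n * (2 ^ ((k - 1) * Q)) ^ ?n"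
              by (simp add: g_def power_mult_distrib)
            also have "\<dots> \<le> (2 powr (\<epsilon> * Q)) ^ ?n * (2 ^ ((k - 1) * Q)) ^ ?n"
              using Q1[OF Q(1)] by (intro mult_right_mono power_mono) auto
            also have "\<dots> = 2 powr (\<epsilon> * Q * ?n + (k - 1) * Q * ?n)"
            proof -
              have "(2 powr (\<epsilon> * Q)) ^ ?n = 2 powr (\<epsilon> * Q * ?n)" by (simp add: powr_power mult_ac)
              moreover have "(2 ^ ((k - 1) * Q)) ^ ?n = 2 powr real ((k - 1) * Q * ?n)"
                by (subst powr_realpow) (simp_all add: power_mult)
              ultimately show ?thesis by (simp add: powr_add)
            qed
            finally have "2 ^ ?n * (g ^ ?n * 2 powr e) \<le> 2 powr (\<epsilon> * Q * ?n + (k - 1) * Q * ?n) * 2 powr e"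
              using mult_right_mono[of _ _ "2 powr e"] by (simp add: mult.assoc)
            then have "2 ^ s^2 * (2 ^ ?n * (g ^ ?n * 2 powr e)) \<le> 2 powr real (s^2) * (2 powr (\<epsilon> * Q * ?n + (k - 1) * Q * ?n) * 2 powr e)"
              by (simp add: powr_realpow[symmetric])
            then show "2 ^ s^2 * (2 ^ ?n * (g ^ ?n * 2 powr e)) \<le> 2 powr (s^2 + (\<epsilon> * Q * ?n + (k - 1) * Q * ?n + e))"
              by (simp add: powr_add mult_ac)
          qed (use L0 g1 in \<open>auto simp: B_def\<close>)
          also have "\<dots> = (1 + L) ^ (?n - 1) * (2 powr (\<epsilon> * s * ?n + s * C) *
              2 powr (s^2 + (\<epsilon> * Q * ?n + (k - 1) * Q * ?n + e)) * B (?n - s))"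
            by (simp add: mult_ac)
          also have "\<dots> \<le> (1 + L) ^ (?n - 1) * (L * B ?n)"
          proof (rule mult_left_mono)
            have "(\<epsilon> * real s * real ?n + real s * C) + ((real s)^2 + (\<epsilon> * real Q * real ?n + (real k - 1) * real Q * real ?n + e))
                + (?d * (real ?n - real s)^2 / 2 + \<epsilon> * (real ?n - real s)^2)
              \<le> (?d * (real s)^2 / 2 + \<epsilon> * (real s)^2 + real s * C + (real s)^2 + e) + (?d * (real ?n)^2 / 2 + \<epsilon> * (real ?n)^2)"
              by (rule recursion_exponents[where k = "real k" and Q = "real Q"])
                 (use k eps in \<open>auto simp: s_def dens_def\<close>)
            then show "2 powr (\<epsilon> * s * ?n + s * C) *
              2 powr (s^2 + (\<epsilon> * Q * ?n + (k - 1) * Q * ?n + e)) * B (?n - s) \<le> L * B ?n"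
              unfolding B_def L_def using sn k by (simp flip: powr_add add: of_nat_diff algebra_simps)
          qed (use L0 in auto)
          finally show ?thesis by (simp add: mult_ac)
        qed
        ultimately have le: "real (card (X A)) \<le> B ?n + L * ((1 + L) ^ (?n - 1) * B ?n)"
          using X0 by linarith
        show ?case
        proof (cases "?n = 0")
          \<comment> \<open>On the empty set truncated subtraction would spoil
            \<open>?n - 1\<close>; there no blow-up can be removed since
            \<open>s \<ge> 1\<close>.\<close>
          case True
          then have "\<not> s \<le> ?n" using s1 by simp
          then have "X A = ?X0" using XU bound(2) by blast
          then show ?thesis using X0 True by simp
        next
          case False
          then have "(1 + L) ^ ?n = (1 + L) * (1 + L) ^ (?n - 1)" by (simp add: power_eq_if)
          moreover have "B ?n * 1 \<le> B ?n * (1 + L) ^ (?n - 1)"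
            using L0 by (intro mult_left_mono one_le_power) (auto simp: B_def)
          ultimately show ?thesis using le by (simp add: algebra_simps)
        qed
      qed
      have "(1 + L) ^ card A0 = 2 powr (log 2 (1 + L) * card A0)"
        using L0 by (simp add: powr_powr[symmetric] powr_realpow)
      also have "\<dots> \<le> 2 powr (\<epsilon> * (card A0)^2 + (log 2 (1 + L))^2 / \<epsilon>)"
        using linear_le_quadratic[OF eps, of "log 2 (1 + L)" "real (card A0)"] L0 by simp
      finally have "(1 + L) ^ card A0 * B (card A0) \<le> 2 powr (\<epsilon> * (card A0)^2 + (log 2 (1 + L))^2 / \<epsilon>) * B (card A0)"
        by (intro mult_right_mono) (auto simp: B_def)
      also have "\<dots> = 2 powr (?d * (card A0)^2 / 2 + 2 * \<epsilon> * (card A0)^2 + D + \<tau>)"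
        by (simp add: B_def D_def powr_add[symmetric] algebra_simps)
      finally show "real (card (X A0)) \<le> 2 powr (?d * (card A0)^2 / 2 + 2 * \<epsilon> * (card A0)^2 + D + \<tau>)"
        using main[OF A0] by linarith
    qed
  qed
qed

text \<open>By induction on \<open>k\<close> for all part sizes at once: the induction hypothesis,
  with a part size \<open>Q\<close> depending on \<open>q\<close> and \<open>\<epsilon>\<close>,
  bounds the graphs in which no blow-up is left to peel off, and \<open>blowup_recursion\<close>
  does the rest. For \<open>k = 0\<close> any \<open>q\<close> vertices form a blow-up, so that the
  vertex set itself is bounded.\<close>

lemma rough_count:
  fixes \<epsilon> :: real
  assumes "q \<ge> 1" "\<epsilon> > 0"
  shows "\<exists>D. \<forall>A :: 'a set. finite A \<longrightarrow> card {E \<in> gr A. \<not> (\<exists>P. blow E A (Suc k) q P)}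
    \<le> 2 powr (dens k * (card A)^2 / 2 + \<epsilon> * (card A)^2 + D)"
  using assms
proof (induction k arbitrary: q \<epsilon>)
  case 0
  show ?case
  proof (intro exI[where x = "real (q^2)"] allI impI)
    fix A :: "'a set" assume A: "finite A"
    let ?X = "{E \<in> gr A. \<not> (\<exists>P. blow E A (Suc 0) q P)}"
    show "card ?X \<le> 2 powr (dens 0 * (card A)^2 / 2 + \<epsilon> * (card A)^2 + real (q^2))"
    proof (cases "card A < q")
      case False
      then obtain B where "B \<subseteq> A" "card B = q" by (meson not_less obtain_subset_with_card_n)
      then have "blow E A (Suc 0) q (\<lambda>_. B)" for E
        using A finite_subset by (auto simp: blow_def)
      then have e: "?X = {}" by blast
      show ?thesis unfolding e by simp
    next
      case True
      have "card ?X \<le> card (gr A)" by (rule card_mono) (use A gr_finite in auto)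
      also have "\<dots> \<le> 2 ^ (card A)^2" by (rule gr_card[OF A])
      also have "\<dots> \<le> 2 ^ q^2" using True by (intro power_increasing power_mono) auto
      finally have "real (card ?X) \<le> 2 ^ q^2" by (simp flip: of_nat_le_iff)
      also have "\<dots> = 2 powr real (q^2)" by (subst powr_realpow) auto
      also have "\<dots> \<le> 2 powr (dens 0 * (card A)^2 / 2 + \<epsilon> * (card A)^2 + real (q^2))"
        using 0 by (simp add: dens_def)
      finally show ?thesis .
    qed
  qed
next
  case (Suc k)
  have e2: "\<epsilon> / 2 > 0" using Suc.prems by simp
  from blowup_recursion[where 'a = 'a, OF _ Suc.prems(1) e2, of "Suc k"]
  obtain Q0 where Q0: "\<forall>Q\<ge>Q0. \<forall>D'. \<exists>D. \<forall>\<tau> (X :: 'a set \<Rightarrow> ('a \<Rightarrow> 'a \<Rightarrow> bool) set).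
    (\<forall>A. finite A \<longrightarrow> X A \<subseteq> {E \<in> gr A. \<not> (\<exists>P. blow E A (Suc (Suc k)) q P)}) \<longrightarrow>
    (\<forall>A E P. finite A \<longrightarrow> E \<in> X A \<longrightarrow> blow E A (Suc k) Q P \<longrightarrow> res (A - PU P (Suc k)) E \<in> X (A - PU P (Suc k))) \<longrightarrow>
    (\<forall>A. finite A \<longrightarrow> card {E \<in> X A. \<not> (\<exists>P. blow E A (Suc k) Q P)}
        \<le> 2 powr (dens (Suc k) * (card A)^2 / 2 + (\<epsilon>/2) * (card A)^2 + D' + \<tau>)) \<longrightarrow>
    (\<forall>A. finite A \<longrightarrow> card (X A) \<le> 2 powr (dens (Suc k) * (card A)^2 / 2 + 2 * (\<epsilon>/2) * (card A)^2 + D + \<tau>))"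
    by auto
  define Q where "Q = max Q0 1"
  have Q: "Q \<ge> Q0" "Q \<ge> 1" by (auto simp: Q_def)
  from Suc.IH[OF Q(2) e2] obtain D' where D': "\<forall>A :: 'a set. finite A \<longrightarrow> card {E \<in> gr A. \<not> (\<exists>P. blow E A (Suc k) Q P)}
    \<le> 2 powr (dens k * (card A)^2 / 2 + (\<epsilon>/2) * (card A)^2 + D')" by blast
  let ?X = "\<lambda>A :: 'a set. {E \<in> gr A. \<not> (\<exists>P. blow E A (Suc (Suc k)) q P)}"
  from Q0[rule_format, OF Q(1), of D'] obtain D where D: "\<forall>\<tau> (X :: 'a set \<Rightarrow> ('a \<Rightarrow> 'a \<Rightarrow> bool) set).
    (\<forall>A. finite A \<longrightarrow> X A \<subseteq> {E \<in> gr A. \<not> (\<exists>P. blow E A (Suc (Suc k)) q P)}) \<longrightarrow>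
    (\<forall>A E P. finite A \<longrightarrow> E \<in> X A \<longrightarrow> blow E A (Suc k) Q P \<longrightarrow> res (A - PU P (Suc k)) E \<in> X (A - PU P (Suc k))) \<longrightarrow>
    (\<forall>A. finite A \<longrightarrow> card {E \<in> X A. \<not> (\<exists>P. blow E A (Suc k) Q P)}
        \<le> 2 powr (dens (Suc k) * (card A)^2 / 2 + (\<epsilon>/2) * (card A)^2 + D' + \<tau>)) \<longrightarrow>
    (\<forall>A. finite A \<longrightarrow> card (X A) \<le> 2 powr (dens (Suc k) * (card A)^2 / 2 + 2 * (\<epsilon>/2) * (card A)^2 + D + \<tau>))"
    by blast
  have "card (?X A) \<le> 2 powr (dens (Suc k) * (card A)^2 / 2 + 2 * (\<epsilon>/2) * (card A)^2 + D + 0)" if fA: "finite A" for A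
  proof (rule D[rule_format, of ?X 0], goal_cases)
    case (2 A E P)
    then show ?case using res_gr[of E A "A - PU P (Suc k)"] blow_res[of "A - PU P (Suc k)" "A - PU P (Suc k)" E]
      blow_mono[of E "A - PU P (Suc k)" "Suc (Suc k)" q _ A] by auto
  next
    case (3 A)
    have "real (card {E \<in> ?X A. \<not> (\<exists>P. blow E A (Suc k) Q P)}) \<le> card {E \<in> gr A. \<not> (\<exists>P. blow E A (Suc k) Q P)}"
    proof (rule of_nat_mono, rule card_mono)
      show "finite {E \<in> gr A. \<not> (\<exists>P. blow E A (Suc k) Q P)}"
        by (rule finite_subset[OF _ gr_finite[OF 3]]) (rule Collect_restrict)
    qed blast
    also have "\<dots> \<le> 2 powr (dens k * (card A)^2 / 2 + (\<epsilon>/2) * (card A)^2 + D')" using D' 3 by blast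
    also have "\<dots> \<le> 2 powr (dens (Suc k) * (card A)^2 / 2 + (\<epsilon>/2) * (card A)^2 + D' + 0)"
      using dens_mono[of k] by (simp add: mult_right_mono)
    finally show ?case .
  qed (use fA in auto)
  then show ?case by (intro exI[where x = D]) simp
qed

section \<open>Tilings by blow-ups\<close>

text \<open>All but at most \<open>b\<close> vertices are covered by disjoint blow-ups; the inductive form lets every count go tile by tile.\<close>
inductive tiled :: "('a \<Rightarrow> 'a \<Rightarrow> bool) \<Rightarrow> nat \<Rightarrow> nat \<Rightarrow> real \<Rightarrow> 'a set \<Rightarrow> bool" for E l q b where
  tiled_small: "real (card A) \<le> b \<Longrightarrow> tiled E l q b A"
| tiled_blow: "blow E A l q P \<Longrightarrow> tiled E l q b (A - PU P l) \<Longrightarrow> tiled E l q b A"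

lemma tiled_transfer:
  "tiled E l q b D \<Longrightarrow> D \<subseteq> B \<Longrightarrow> (\<And>D P. D \<subseteq> B \<Longrightarrow> blow E D l q P \<Longrightarrow> blow E' D l q P) \<Longrightarrow> tiled E' l q b D"
proof (induction rule: tiled.induct)
  case (tiled_blow A P)
  have "tiled E' l q b (A - PU P l)" using tiled_blow.prems by (intro tiled_blow.IH) auto
  then show ?case using tiled.tiled_blow tiled_blow.hyps(1) tiled_blow.prems by blast
qed (rule tiled.tiled_small)

lemma tiled_res_iff: "D \<subseteq> B \<Longrightarrow> tiled (res B E) l q b D \<longleftrightarrow> tiled E l q b D"
  using tiled_transfer[of "res B E" l q b D B E] tiled_transfer[of E l q b D B "res B E"]
  by (auto simp: blow_res)

lemma tiled_add:
  "tiled E l q b D \<Longrightarrow> finite D \<Longrightarrow> finite C \<Longrightarrow> card C \<le> c \<Longrightarrow> tiled E l q (b + c) (D \<union> C)"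
proof (induction arbitrary: C rule: tiled.induct)
  case (tiled_small A)
  have "card (A \<union> C) \<le> card A + card C" by (rule card_Un_le)
  then show ?case using tiled_small by (intro tiled.tiled_small) linarith
next
  case (tiled_blow A P)
  have "card (C - PU P l) \<le> card C" by (rule card_mono) (use tiled_blow in auto)
  then have "tiled E l q (b + c) ((A - PU P l) \<union> (C - PU P l))"
    using tiled_blow by (intro tiled_blow.IH) auto
  moreover have "(A - PU P l) \<union> (C - PU P l) = (A \<union> C) - PU P l" by auto
  moreover have "blow E (A \<union> C) l q P" using blow_mono tiled_blow.hyps by blast
  ultimately show ?case using tiled.tiled_blow by metis
qed

text \<open>Each removed vertex destroys at most one tile, whose remaining vertices, fewer than
  \<open>l * q\<close> of them, become uncovered.\<close>

lemma tiled_remove: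
  assumes "E \<in> gr B"
  shows "tiled E l q b A \<Longrightarrow> finite A \<Longrightarrow> finite S \<Longrightarrow> card S \<le> c \<Longrightarrow> tiled E l q (b + c * (l * q)) (A - S)"
proof (induction arbitrary: S c rule: tiled.induct)
  case (tiled_small A)
  have "card (A - S) \<le> card A" by (rule card_mono) (use tiled_small in auto)
  moreover have "0 \<le> real (c * (l * q))" by simp
  ultimately have "real (card (A - S)) \<le> b + c * (l * q)" using tiled_small.hyps by linarith
  then show ?case by (rule tiled.tiled_small)
next
  case (tiled_blow A P)
  let ?T = "PU P l"
  show ?case
  proof (cases "?T \<inter> S = {}")
    case True
    have "blow E (A - S) l q P"
      using tiled_blow.hyps(1) True unfolding blow_def PU_def by blast
    moreover have "tiled E l q (b + c * (l * q)) ((A - ?T) - S)" using tiled_blow by (intro tiled_blow.IH) auto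
    moreover have "(A - ?T) - S = (A - S) - ?T" by auto
    ultimately show ?thesis using tiled.tiled_blow by metis
  next
    case False
    have "card (S - ?T) < card S" using False tiled_blow.prems by (intro psubset_card_mono) auto
    then have c: "card (S - ?T) \<le> c - 1" "c \<ge> 1" using tiled_blow.prems by auto
    have "tiled E l q (b + real ((c - 1) * (l * q))) ((A - ?T) - (S - ?T))"
      using tiled_blow c by (intro tiled_blow.IH) auto
    then have "tiled E l q (b + real ((c - 1) * (l * q)) + real (l * q)) (((A - ?T) - (S - ?T)) \<union> (?T - S))"
    proof (rule tiled_add)
      have f: "finite ?T" using PU_finite tiled_blow.hyps(1) by blast
      then show "finite (?T - S)" by simp
      show "card (?T - S) \<le> l * q"
        using card_mono[OF f, of "?T - S"] PU_card[OF tiled_blow.hyps(1) assms] by auto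
    qed (use tiled_blow in auto)
    moreover have "((A - ?T) - (S - ?T)) \<union> (?T - S) = A - S"
      using PU_subset[OF tiled_blow.hyps(1)] by auto
    moreover have "b + real ((c - 1) * (l * q)) + real (l * q) = b + c * (l * q)"
      using c by (simp add: of_nat_diff algebra_simps)
    ultimately show ?thesis by metis
  qed
qed

text \<open>Taking one vertex from each part repeatedly splits a tile into \<open>q\<close> disjoint
  cliques on \<open>l\<close> vertices, the tiles used in
  \<open>card_tiled_free_pairs\<close>.\<close>

lemma tiled_split_blow:
  assumes "E \<in> gr B"
  shows "blow E A l q P \<Longrightarrow> tiled E l 1 b (A - PU P l) \<Longrightarrow> tiled E l 1 b A"
proof (induction q arbitrary: A P)
  case 0
  then have "PU P l = {}" by (auto simp: PU_def blow_def)
  then show ?case using 0 by simp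
next
  case (Suc q)
  have "\<exists>x. x \<in> P i" if "i < l" for i
    using Suc.prems(1) that unfolding blow_def by (metis card.empty nat.distinct(1) ex_in_conv)
  then obtain f where f: "\<And>i. i < l \<Longrightarrow> f i \<in> P i" by metis
  let ?P1 = "\<lambda>i. {f i}" and ?P2 = "\<lambda>i. P i - {f i}"
  have disj: "f i \<notin> P j" if "i < l" "j < l" "i \<noteq> j" for i j
    using Suc.prems(1) f that gr_irrefl[OF assms] unfolding blow_def by blast
  have b1: "blow E A l 1 ?P1" by (rule blow_shrink[OF Suc.prems(1)]) (use f in auto)
  have b2: "blow E A l q ?P2"
    by (rule blow_shrink[OF Suc.prems(1)]) (use f Suc.prems(1) in \<open>auto simp: blow_def\<close>)
  have "blow E (A - PU ?P1 l) l q ?P2"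
    using b2 disj unfolding blow_def PU_def by blast
  moreover have "(A - PU ?P1 l) - PU ?P2 l = A - PU P l"
    using f disj unfolding PU_def by auto
  ultimately have "tiled E l 1 b (A - PU ?P1 l)" using Suc.IH Suc.prems(2) by metis
  then show ?case using tiled_blow[OF b1] by blast
qed

lemma tiled_split:
  assumes "E \<in> gr B"
  shows "tiled E l q b A \<Longrightarrow> tiled E l 1 b A"
  by (induction rule: tiled.induct) (blast intro: tiled_small tiled_split_blow[OF assms])+

text \<open>A graph that cannot be tiled is eventually peeled down to a large set without a blow-up of \<open>K\<^sub>l\<close>,
  where only density \<open>dens (l - 1)\<close> is available.\<close>
lemma few_untiled:
  fixes \<epsilon> :: real
  assumes l: "l \<ge> 2" and eps: "\<epsilon> > 0"
  shows "\<exists>Q0. \<forall>Q\<ge>Q0. \<exists>D. \<forall>(A :: 'a set) b. finite A \<longrightarrow> b \<ge> 0 \<longrightarrow> card {E \<in> Kf l A. \<not> tiled E l Q b A}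
    \<le> 2 powr (dens l * (card A)^2 / 2 + \<epsilon> * (card A)^2 + D - (dens l - dens (l - 1)) / 2 * b^2)"
proof -
  have e2: "\<epsilon> / 2 > 0" using eps by simp
  have l1: "l \<ge> 1" "Suc (l - 1) = l" using l by auto
  let ?c = "(dens l - dens (l - 1)) / 2"
  have c0: "?c \<ge> 0" using dens_mono[of "l - 1"] l1 by simp
  from blowup_recursion[where 'a = 'a, OF l1(1) le_refl e2]
  obtain Q1 where Q1: "\<forall>Q\<ge>Q1. \<forall>D'. \<exists>D. \<forall>\<tau> (X :: 'a set \<Rightarrow> ('a \<Rightarrow> 'a \<Rightarrow> bool) set).
    (\<forall>A. finite A \<longrightarrow> X A \<subseteq> {E \<in> gr A. \<not> (\<exists>P. blow E A (Suc l) 1 P)}) \<longrightarrow>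
    (\<forall>A E P. finite A \<longrightarrow> E \<in> X A \<longrightarrow> blow E A l Q P \<longrightarrow> res (A - PU P l) E \<in> X (A - PU P l)) \<longrightarrow>
    (\<forall>A. finite A \<longrightarrow> card {E \<in> X A. \<not> (\<exists>P. blow E A l Q P)}
        \<le> 2 powr (dens l * (card A)^2 / 2 + (\<epsilon>/2) * (card A)^2 + D' + \<tau>)) \<longrightarrow>
    (\<forall>A. finite A \<longrightarrow> card (X A) \<le> 2 powr (dens l * (card A)^2 / 2 + 2 * (\<epsilon>/2) * (card A)^2 + D + \<tau>))"
    by blast
  show ?thesis
  proof (rule exI[where x = "max Q1 1"], intro allI impI)
    fix Q assume "Q \<ge> max Q1 1"
    then have Q: "Q \<ge> Q1" "Q \<ge> 1" by auto
    from rough_count[OF Q(2) e2, of "l - 1"] obtain D' where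
      D': "\<forall>A :: 'a set. finite A \<longrightarrow> card {E \<in> gr A. \<not> (\<exists>P. blow E A l Q P)}
        \<le> 2 powr (dens (l - 1) * (card A)^2 / 2 + (\<epsilon>/2) * (card A)^2 + D')" unfolding l1(2) by blast
    from Q1[rule_format, OF Q(1), of D'] obtain D where D: "\<forall>\<tau> (X :: 'a set \<Rightarrow> ('a \<Rightarrow> 'a \<Rightarrow> bool) set).
    (\<forall>A. finite A \<longrightarrow> X A \<subseteq> {E \<in> gr A. \<not> (\<exists>P. blow E A (Suc l) 1 P)}) \<longrightarrow>
    (\<forall>A E P. finite A \<longrightarrow> E \<in> X A \<longrightarrow> blow E A l Q P \<longrightarrow> res (A - PU P l) E \<in> X (A - PU P l)) \<longrightarrow>
    (\<forall>A. finite A \<longrightarrow> card {E \<in> X A. \<not> (\<exists>P. blow E A l Q P)}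
        \<le> 2 powr (dens l * (card A)^2 / 2 + (\<epsilon>/2) * (card A)^2 + D' + \<tau>)) \<longrightarrow>
    (\<forall>A. finite A \<longrightarrow> card (X A) \<le> 2 powr (dens l * (card A)^2 / 2 + 2 * (\<epsilon>/2) * (card A)^2 + D + \<tau>))"
      by blast
    show "\<exists>D. \<forall>(A :: 'a set) b. finite A \<longrightarrow> b \<ge> 0 \<longrightarrow> card {E \<in> Kf l A. \<not> tiled E l Q b A}
      \<le> 2 powr (dens l * (card A)^2 / 2 + \<epsilon> * (card A)^2 + D - ?c * b^2)"
    proof (rule exI[where x = D], intro allI impI)
      fix A0 :: "'a set" and b :: real assume A0: "finite A0" and b: "b \<ge> 0"
      let ?X = "\<lambda>A :: 'a set. {E \<in> Kf l A. \<not> tiled E l Q b A}"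
      \<comment> \<open>The offset \<open>\<tau>\<close> is the saving. A graph in the family has
        more than \<open>b\<close> vertices, hence so does whatever remains when no blow-up is left,
        and there the density \<open>dens (l - 1)\<close> instead of \<open>dens l\<close> gains at
        least \<open>?c * b^2\<close>.\<close>
      have "card (?X A) \<le> 2 powr (dens l * (card A)^2 / 2 + 2 * (\<epsilon>/2) * (card A)^2 + D + - (?c * b^2))" if fA: "finite A" for A
      proof (rule D[rule_format, of ?X "- (?c * b^2)"], goal_cases)
        case (1 A)
        have "\<not> blow E A (Suc l) 1 P" if "E \<in> Kf l A" for E P
        proof
          assume P: "blow E A (Suc l) 1 P"
          then have "\<forall>i<Suc l. \<exists>x. x \<in> P i" unfolding blow_def by (metis card.empty ex_in_conv zero_neq_one)
          then obtain f where "\<forall>i<Suc l. f i \<in> P i" by metis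
          then have "tup E A (Suc l) f" using blow_tup[OF P] by blast
          then show False using that by (auto simp: Kf_def)
        qed
        then show ?case using Kf_gr by blast
      next
        case (2 A E P)
        let ?B = "A - PU P l"
        have "tiled (res ?B E) l Q b ?B = tiled E l Q b ?B" by (rule tiled_res_iff) simp
        then show ?case using 2 tiled_blow[OF 2(3), of b] Kf_res[of E l A ?B] by auto
      next
        case (3 A)
        let ?X0 = "{E \<in> ?X A. \<not> (\<exists>P. blow E A l Q P)}"
        show ?case
        proof (cases "card A \<le> b")
          case True
          then have e: "?X0 = {}" using tiled_small[of A b] by blast
          show ?thesis unfolding e by simp
        next
          case False
          then have "b^2 \<le> (card A)^2" using b unfolding of_nat_power by (intro power_mono) auto
          then have "?c * b^2 \<le> ?c * (card A)^2" using c0 by (intro mult_left_mono)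
          also have "\<dots> = dens l * (card A)^2 / 2 - dens (l - 1) * (card A)^2 / 2"
            by (simp add: field_simps)
          finally have le: "dens (l - 1) * (card A)^2 / 2 + ?c * b^2 \<le> dens l * (card A)^2 / 2" by linarith
          have "real (card ?X0) \<le> card {E \<in> gr A. \<not> (\<exists>P. blow E A l Q P)}"
          proof (rule of_nat_mono, rule card_mono)
            show "finite {E \<in> gr A. \<not> (\<exists>P. blow E A l Q P)}"
              by (rule finite_subset[OF _ gr_finite[OF 3]]) (rule Collect_restrict)
          qed (use Kf_gr in blast)
          also have "\<dots> \<le> 2 powr (dens (l - 1) * (card A)^2 / 2 + (\<epsilon>/2) * (card A)^2 + D')" using D' 3 by blast
          also have "\<dots> \<le> 2 powr (dens l * (card A)^2 / 2 + (\<epsilon>/2) * (card A)^2 + D' + - (?c * b^2))"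
            using le by simp
          finally show ?thesis by simp
        qed
      qed (use fA in auto)
      then show "card {E \<in> Kf l A0. \<not> tiled E l Q b A0} \<le> 2 powr (dens l * (card A0)^2 / 2 + \<epsilon> * (card A0)^2 + D - ?c * b^2)"
        using A0 by simp
    qed
  qed
qed

section \<open>Restricted neighbourhoods in tiled graphs\<close>

definition skip :: "nat \<Rightarrow> nat \<Rightarrow> nat" where
  "skip i0 i = (if i < i0 then i else Suc i)"

lemma skip_props: "i < l - 1 \<Longrightarrow> skip i0 i < l" "skip i0 i \<noteq> i0" "skip i0 i = skip i0 j \<Longrightarrow> i = j"
  by (auto simp: skip_def split: if_splits)

lemma blow_skip:
  assumes "blow E A l Q P" "\<And>i. i < l \<Longrightarrow> i \<noteq> i0 \<Longrightarrow> B i \<subseteq> P i \<and> B i \<subseteq> T \<and> card (B i) = q"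
  shows "blow E T (l - 1) q (\<lambda>i. B (skip i0 i))"
proof -
  have fin: "finite (B i)" if "i < l" "i \<noteq> i0" for i
  proof (rule finite_subset)
    show "B i \<subseteq> P i" using assms(2) that by blast
    show "finite (P i)" using assms(1) that by (simp add: blow_def)
  qed
  have "E u v" if "u \<in> B (skip i0 i)" "v \<in> B (skip i0 j)" "i < l - 1" "j < l - 1" "i \<noteq> j" for u v i j
  proof -
    have s: "skip i0 i < l" "skip i0 j < l" "skip i0 i \<noteq> i0" "skip i0 j \<noteq> i0"
      using that skip_props(1,2) by auto
    have "skip i0 i \<noteq> skip i0 j" using that(5) skip_props(3) by blast
    moreover have "u \<in> P (skip i0 i)" "v \<in> P (skip i0 j)" using assms(2) s that(1,2) by auto
    ultimately show ?thesis using assms(1) s(1,2) unfolding blow_def by simp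
  qed
  then show ?thesis unfolding blow_def
    using assms(2) fin skip_props(1,2) by (metis (no_types, lifting))
qed

text \<open>If at most one part met \<open>T\<close> in fewer than \<open>q\<close> vertices, the
  others would contain a blow-up inside \<open>T\<close>. So two parts are nearly missed, and only
  \<open>(l - 2) * Q\<close> vertices of the tile remain free.\<close>

lemma card_no_blow_tile:
  assumes "blow E A l Q P" "E \<in> gr B"
  shows "card {T. T \<subseteq> PU P l \<and> \<not> (\<exists>P'. blow E T (l - 1) q P')} \<le> (l * l) * ((Q + 1) ^ (2 * q) * 2 ^ ((l - 2) * Q))"
proof -
  let ?S = "PU P l"
  let ?M = "{T. T \<subseteq> ?S \<and> \<not> (\<exists>P'. blow E T (l - 1) q P')}"
  let ?I = "{(i, j). i < l \<and> j < l \<and> i \<noteq> j}"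
  let ?Z = "\<lambda>(i, j). {T. T \<subseteq> ?S \<and> card (T \<inter> P i) < q \<and> card (T \<inter> P j) < q}"
  have fS: "finite ?S" using PU_finite assms by blast
  have sub: "?I \<subseteq> {..<l} \<times> {..<l}" by auto
  have fI: "finite ?I" by (rule finite_subset[OF sub]) simp
  have cI: "card ?I \<le> l * l" using card_mono[OF _ sub] by simp
  have "?M \<subseteq> (\<Union>p\<in>?I. ?Z p)"
  proof
    fix T assume T: "T \<in> ?M"
    show "T \<in> (\<Union>p\<in>?I. ?Z p)"
    proof (rule ccontr)
      assume n: "\<not> ?thesis"
      have nij: "\<not> (card (T \<inter> P i) < q \<and> card (T \<inter> P j) < q)" if "i < l" "j < l" "i \<noteq> j" for i j
        using n T that by blast
      obtain i0 where i0: "\<And>i. i < l \<Longrightarrow> i \<noteq> i0 \<Longrightarrow> q \<le> card (T \<inter> P i)"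
        using nij by (metis not_le)
      have "\<exists>B. B \<subseteq> T \<inter> P i \<and> card B = q" if "i < l" "i \<noteq> i0" for i
        using obtain_subset_with_card_n[OF i0[OF that]] by metis
      then obtain B where "\<And>i. i < l \<Longrightarrow> i \<noteq> i0 \<Longrightarrow> B i \<subseteq> T \<inter> P i \<and> card (B i) = q" by metis
      then have "blow E T (l - 1) q (\<lambda>i. B (skip i0 i))"
        by (intro blow_skip[OF assms(1)]) auto
      then show False using T by blast
    qed
  qed
  then have "card ?M \<le> card (\<Union>p\<in>?I. ?Z p)" by (rule card_mono[rotated]) (use fI fS in auto)
  also have "\<dots> \<le> (\<Sum>p\<in>?I. card (?Z p))" by (rule card_UN_le[OF fI])
  also have "\<dots> \<le> (\<Sum>p\<in>?I. (Q + 1) ^ (2 * q) * 2 ^ ((l - 2) * Q))"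
  proof (rule sum_mono)
    fix p assume "p \<in> ?I"
    then obtain i j where p: "p = (i, j)" and ij: "i < l" "j < l" "i \<noteq> j" by auto
    have Pi: "finite (P i)" "card (P i) = Q" "finite (P j)" "card (P j) = Q" "P i \<subseteq> ?S" "P j \<subseteq> ?S"
      using ij assms(1) by (auto simp: blow_def PU_def)
    have dis: "P i \<inter> P j = {}" using assms ij gr_irrefl[OF assms(2)] unfolding blow_def by blast
    let ?N = "\<lambda>i. {T. T \<subseteq> P i \<and> card T < q}"
    have "card (?Z p) \<le> card (?N i \<times> ?N j \<times> Pow (?S - P i - P j))" unfolding p prod.case
    proof (rule card_inj_on_le[where f = "\<lambda>T. (T \<inter> P i, T \<inter> P j, T - P i - P j)"])
      show "inj_on (\<lambda>T. (T \<inter> P i, T \<inter> P j, T - P i - P j)) {T. T \<subseteq> ?S \<and> card (T \<inter> P i) < q \<and> card (T \<inter> P j) < q}"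
        by (rule inj_onI) blast
      show "finite (?N i \<times> ?N j \<times> Pow (?S - P i - P j))"
        using Pi fS by (intro finite_cartesian_product) auto
    qed auto
    also have "\<dots> = card (?N i) * (card (?N j) * 2 ^ card (?S - P i - P j))"
      using fS by (simp add: card_cartesian_product card_Pow)
    also have "card (?S - P i - P j) = (l - 2) * Q"
    proof -
      have "?S - P i - P j = ?S - (P i \<union> P j)" by auto
      moreover have "card (P i \<union> P j) = 2 * Q" using Pi dis by (simp add: card_Un_disjoint)
      ultimately show ?thesis
        using Pi fS PU_card[OF assms] by (simp add: card_Diff_subset diff_mult_distrib)
    qed
    also have "card (?N i) * (card (?N j) * 2 ^ ((l - 2) * Q)) \<le> (Q + 1) ^ q * ((Q + 1) ^ q * 2 ^ ((l - 2) * Q))"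
      using card_small_subsets[OF Pi(1), of q] card_small_subsets[OF Pi(3), of q] Pi(2,4)
      by (intro mult_le_mono) auto
    finally show "card (?Z p) \<le> (Q + 1) ^ (2 * q) * 2 ^ ((l - 2) * Q)"
      by (simp add: mult_2 power_add mult.assoc)
  qed
  also have "\<dots> = card ?I * ((Q + 1) ^ (2 * q) * 2 ^ ((l - 2) * Q))" by simp
  also have "\<dots> \<le> (l * l) * ((Q + 1) ^ (2 * q) * 2 ^ ((l - 2) * Q))"
    using cI by (intro mult_le_mono1)
  finally show ?thesis .
qed

text \<open>The property passes to the intersection with every tile, so the bounds for single tiles
  multiply. For large \<open>Q\<close> the hypothesis holds with \<open>\<gamma>\<close> slightly
  above \<open>(l - 2) / l\<close> and thus below \<open>dens l\<close>.\<close>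

lemma card_tiled_no_blow:
  fixes \<gamma> :: real
  assumes "E \<in> gr B" "(l * l) * ((real Q + 1) ^ (2 * q) * 2 ^ ((l - 2) * Q)) \<le> 2 powr (\<gamma> * (l * Q))" "\<gamma> \<ge> 0"
  shows "tiled E l Q b D \<Longrightarrow> finite D \<Longrightarrow>
    card {N. N \<subseteq> D \<and> \<not> (\<exists>P. blow E N (l - 1) q P)} \<le> 2 powr (b + \<gamma> * card D)"
proof (induction rule: tiled.induct)
  case (tiled_small A)
  have "card {N. N \<subseteq> A \<and> \<not> (\<exists>P. blow E N (l - 1) q P)} \<le> card (Pow A)"
    by (rule card_mono) (use tiled_small in auto)
  then have "real (card {N. N \<subseteq> A \<and> \<not> (\<exists>P. blow E N (l - 1) q P)}) \<le> 2 powr (card A)"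
    using two_powr_card_Pow[OF tiled_small(2)] by linarith
  also have "\<dots> \<le> 2 powr (b + \<gamma> * card A)" 
    using tiled_small mult_nonneg_nonneg[OF assms(3), of "real (card A)"] by simp
  finally show ?case .
next
  case (tiled_blow A P)
  let ?S = "PU P l"
  let ?N = "\<lambda>A. {N. N \<subseteq> A \<and> \<not> (\<exists>P. blow E N (l - 1) q P)}"
  have S: "finite ?S" "?S \<subseteq> A" "card ?S = l * Q"
    using PU_finite PU_subset PU_card tiled_blow.hyps(1) assms(1) by blast+
  have "card (?N A) \<le> card (?N ?S \<times> ?N (A - ?S))"
  proof (rule card_inj_on_le[where f = "\<lambda>N. (N \<inter> ?S, N - ?S)"])
    show "inj_on (\<lambda>N. (N \<inter> ?S, N - ?S)) (?N A)" by (rule inj_onI) blast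
    have "\<not> blow E (N \<inter> ?S) (l - 1) q P'" "\<not> blow E (N - ?S) (l - 1) q P'" if "N \<in> ?N A" for N P'
      using that blow_mono by blast+
    then show "(\<lambda>N. (N \<inter> ?S, N - ?S)) ` ?N A \<subseteq> ?N ?S \<times> ?N (A - ?S)" by auto
    show "finite (?N ?S \<times> ?N (A - ?S))" using S(1) tiled_blow.prems by auto
  qed
  then have "real (card (?N A)) \<le> real (card (?N ?S)) * real (card (?N (A - ?S)))"
    by (simp add: card_cartesian_product flip: of_nat_mult)
  also have "\<dots> \<le> 2 powr (\<gamma> * (l * Q)) * 2 powr (b + \<gamma> * card (A - ?S))"
  proof (rule mult_mono)
    have "real (card (?N ?S)) \<le> (l * l) * ((real Q + 1) ^ (2 * q) * 2 ^ ((l - 2) * Q))"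
      using of_nat_mono[OF card_no_blow_tile[OF tiled_blow.hyps(1) assms(1), of q], where 'a = real]
      by (simp add: algebra_simps)
    then show "real (card (?N ?S)) \<le> 2 powr (\<gamma> * (l * Q))" using assms(2) by simp
    show "real (card (?N (A - ?S))) \<le> 2 powr (b + \<gamma> * card (A - ?S))"
      using tiled_blow by simp
  qed auto
  also have "\<dots> = 2 powr (b + \<gamma> * (real (card (A - ?S)) + l * Q))"
    by (simp add: powr_add[symmetric] algebra_simps)
  also have "real (card (A - ?S)) + l * Q = card A"
    using S tiled_blow.prems card_mono[OF tiled_blow.prems S(2)]
    by (simp add: card_Diff_subset of_nat_diff del: of_nat_mult)
  finally show ?case .
qed

text \<open>Candidates for the neighbourhoods of two vertices: \<open>W1\<close> and
  \<open>W2\<close> are the links that they have to avoid, and no clique of size \<open>k\<close>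
  lies in both.\<close>

definition free_pairs :: "('a \<Rightarrow> 'a \<Rightarrow> bool) \<Rightarrow> nat \<Rightarrow> 'a set \<Rightarrow> 'a set \<Rightarrow> 'a set \<Rightarrow> ('a set \<times> 'a set) set" where
  "free_pairs E k W1 W2 D = {(M, N). M \<subseteq> D - W1 \<and> N \<subseteq> D - W2 \<and> \<not> (\<exists>f. tup E (M \<inter> N) k f)}"

lemma free_pairs_finite: "finite D \<Longrightarrow> finite (free_pairs E k W1 W2 D)"
  by (rule finite_subset[of _ "Pow D \<times> Pow D"]) (auto simp: free_pairs_def)

lemma card_free_pairs_le:
  assumes "finite D"
  shows "card (free_pairs E k W1 W2 D) \<le> 2 ^ card (D - W1) * 2 ^ card (D - W2)"
proof -
  have "card (free_pairs E k W1 W2 D) \<le> card (Pow (D - W1) \<times> Pow (D - W2))"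
    by (rule card_mono) (use assms in \<open>auto simp: free_pairs_def\<close>)
  then show ?thesis using assms by (simp add: card_cartesian_product card_Pow)
qed

text \<open>The tile is a clique on \<open>l\<close> vertices, of which at least
  \<open>l - 1\<close> lie outside \<open>W1 \<union> W2\<close>; let \<open>R\<close> consist of
  \<open>l - 1\<close> such vertices. Of the \<open>4 ^ (l - 1)\<close> pairs of traces on
  \<open>R\<close> the pair \<open>(R, R)\<close> is excluded, since \<open>R\<close> would be a
  common clique.\<close>

lemma card_free_pairs_tile:
  assumes "blow E A l 1 P" "E \<in> gr B" "card (PU P l \<inter> (W1 \<union> W2)) \<le> 1" "l \<ge> 1"
  shows "card (free_pairs E (l - 1) W1 W2 (PU P l)) \<le>
    (2 ^ card (PU P l - W1) * 2 ^ card (PU P l - W2)) * (1 - (1/4) ^ (l - 1) :: real)"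
proof -
  let ?S = "PU P l" and ?U = "W1 \<union> W2" and ?k = "l - 1"
  have fS: "finite ?S" using PU_finite assms by blast
  have "\<exists>x. P i = {x}" if "i < l" for i using assms(1) that unfolding blow_def by (meson card_1_singletonE)
  then obtain f where f: "\<And>i. i < l \<Longrightarrow> P i = {f i}" by metis
  have dis: "f i \<noteq> f j" if "i < l" "j < l" "i \<noteq> j" for i j
    using assms(1) f gr_irrefl[OF assms(2)] that unfolding blow_def by (metis singletonI)
  have "\<exists>i0<l. \<forall>i<l. i \<noteq> i0 \<longrightarrow> f i \<notin> ?U"
  proof (rule ccontr)
    assume n: "\<not> ?thesis"
    then obtain i where i: "i < l" "f i \<in> ?U" using assms(4) by (metis less_eq_Suc_le One_nat_def)
    then obtain j where j: "j < l" "j \<noteq> i" "f j \<in> ?U" using n by blast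
    have "{f i, f j} \<subseteq> ?S \<inter> ?U" using i j f by (auto simp: PU_def)
    then have "card {f i, f j} \<le> card (?S \<inter> ?U)" by (rule card_mono[rotated]) (use fS in auto)
    then show False using dis[OF i(1) j(1)] j(2) assms(3) by simp
  qed
  then obtain i0 where i0: "i0 < l" "\<And>i. i < l \<Longrightarrow> i \<noteq> i0 \<Longrightarrow> f i \<notin> ?U" by blast
  define g where "g = f \<circ> skip i0"
  define R where "R = g ` {..<?k}"
  have sk: "skip i0 i < l" "skip i0 i \<noteq> i0" if "i < ?k" for i using that skip_props by auto
  have "g i \<in> ?S - ?U" if "i < ?k" for i
  proof -
    have "g i \<in> P (skip i0 i)" using f[OF sk(1)[OF that]] by (simp add: g_def)
    then have "g i \<in> ?S" using sk(1)[OF that] unfolding PU_def by blast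
    then show ?thesis using i0(2)[OF sk[OF that]] by (simp add: g_def)
  qed
  then have RS: "R \<subseteq> ?S - ?U" unfolding R_def by blast
  have "inj_on g {..<?k}"
    unfolding g_def inj_on_def using dis sk skip_props(3) by (metis comp_apply lessThan_iff)
  then have cR: "card R = ?k" unfolding R_def by (simp add: card_image)
  have fR: "finite R" unfolding R_def by simp
  have tR: "tup E R ?k g"
  proof -
    have "E (g i) (g j)" if "i < ?k" "j < ?k" "i \<noteq> j" for i j
    proof -
      have "skip i0 i \<noteq> skip i0 j" using that skip_props(3) by blast
      then show ?thesis using assms(1) f sk[OF that(1)] sk[OF that(2)] unfolding blow_def g_def by simp
    qed
    then show ?thesis by (auto simp: tup_def R_def)
  qed
  let ?T = "(Pow R \<times> Pow R - {(R, R)}) \<times> (Pow (?S - W1 - R) \<times> Pow (?S - W2 - R))"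
  let ?X = "free_pairs E ?k W1 W2 ?S"
  have "card ?X \<le> card ?T"
  proof (rule card_inj_on_le[where f = "\<lambda>(M, N). ((M \<inter> R, N \<inter> R), (M - R, N - R))"])
    show "inj_on (\<lambda>(M, N). ((M \<inter> R, N \<inter> R), (M - R, N - R))) ?X"
      by (rule inj_onI) auto
    have "\<not> (M \<inter> R = R \<and> N \<inter> R = R)" if "(M, N) \<in> ?X" for M N
    proof
      assume "M \<inter> R = R \<and> N \<inter> R = R"
      then have "R \<subseteq> M \<inter> N" by blast
      then show False using that tup_mono[OF tR] unfolding free_pairs_def by blast
    qed
    then show "(\<lambda>(M, N). ((M \<inter> R, N \<inter> R), (M - R, N - R))) ` ?X \<subseteq> ?T"
      by (auto simp: free_pairs_def)
    show "finite ?T" using fR fS by auto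
  qed
  also have "card ?T = (4 ^ ?k - 1) * (2 ^ card (?S - W1 - R) * 2 ^ card (?S - W2 - R))"
    using fR fS cR by (simp add: card_cartesian_product card_Pow card_Diff_subset power_mult_distrib[symmetric])
  finally have le: "card ?X \<le> (4 ^ ?k - 1) * (2 ^ card (?S - W1 - R) * 2 ^ card (?S - W2 - R))" .
  have c: "card (?S - Wi) = card (?S - Wi - R) + ?k" if "Wi \<subseteq> ?U" for Wi
  proof -
    have "R \<subseteq> ?S - Wi" using RS that by blast
    then have "card (?S - Wi - R) = card (?S - Wi) - ?k" "card R \<le> card (?S - Wi)"
      using fR cR card_mono[OF _ \<open>R \<subseteq> ?S - Wi\<close>] finite_Diff[OF fS] by (simp_all add: card_Diff_subset)
    then show ?thesis using cR by simp
  qed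
  have "real (card ?X) \<le> real ((4 ^ ?k - 1) * (2 ^ card (?S - W1 - R) * 2 ^ card (?S - W2 - R)))"
    using le by (simp only: of_nat_le_iff)
  also have "\<dots> = (4 ^ ?k - 1) * (2 ^ card (?S - W1 - R) * 2 ^ card (?S - W2 - R))"
    by (simp add: of_nat_diff)
  also have "\<dots> = (2 ^ card (?S - W1) * 2 ^ card (?S - W2)) * (1 - (1/4) ^ ?k)"
  proof -
    have "(4::real) ^ ?k = 2 ^ ?k * 2 ^ ?k" by (simp add: power_mult_distrib[symmetric])
    then show ?thesis unfolding c[of W1, OF Un_upper1] c[of W2, OF Un_upper2]
      by (simp add: power_add field_simps power_divide)
  qed
  finally show ?thesis .
qed

text \<open>A tile meeting \<open>W1 \<union> W2\<close> in \<open>u \<le> 1\<close> vertices contributes a factor \<open>\<theta>\<close>; the exponent counts such tiles through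
  the linear lower bound \<open>1 - u / 2\<close> for the indicator of \<open>u \<le> 1\<close>.\<close>
lemma card_tiled_free_pairs:
  fixes \<theta> b :: real
  assumes "E \<in> gr B" "l \<ge> 2" and \<theta>: "\<theta> = 1 - (1/4) ^ (l - 1)"
  shows "tiled E l 1 b D \<Longrightarrow> finite D \<Longrightarrow> card (free_pairs E (l - 1) W1 W2 D)
    \<le> (2 ^ card (D - W1) * 2 ^ card (D - W2)) * \<theta> powr ((card D - b) / l - card (D \<inter> (W1 \<union> W2)) / 2)"
proof (induction rule: tiled.induct)
  case (tiled_small A)
  have th: "0 < \<theta>" "\<theta> < 1" unfolding \<theta> using assms(2) by (auto simp: power_strict_decreasing power_less_one_iff)
  have "(card A - b) / l \<le> 0" using tiled_small by (simp add: divide_le_0_iff)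
  moreover have "0 \<le> real (card (A \<inter> (W1 \<union> W2))) / 2" by simp
  ultimately have "(card A - b) / l - card (A \<inter> (W1 \<union> W2)) / 2 \<le> 0" by linarith
  then have 1: "1 \<le> \<theta> powr ((card A - b) / l - card (A \<inter> (W1 \<union> W2)) / 2)"
    using powr_mono'[of _ 0 \<theta>] th by simp
  have "real (card (free_pairs E (l - 1) W1 W2 A)) \<le> real (2 ^ card (A - W1) * 2 ^ card (A - W2)) * 1"
    using card_free_pairs_le[OF tiled_small(2), of E "l - 1" W1 W2] by (simp only: of_nat_le_iff mult_1_right)
  also have "\<dots> \<le> real (2 ^ card (A - W1) * 2 ^ card (A - W2)) * \<theta> powr ((card A - b) / l - card (A \<inter> (W1 \<union> W2)) / 2)"
    by (rule mult_left_mono[OF 1]) simp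
  finally show ?case by simp
next
  case (tiled_blow A P)
  let ?S = "PU P l" and ?k = "l - 1" and ?U = "W1 \<union> W2"
  have th: "0 < \<theta>" "\<theta> < 1" unfolding \<theta> using assms(2) by (auto simp: power_strict_decreasing power_less_one_iff)
  have S: "finite ?S" "?S \<subseteq> A" "card ?S = l"
    using PU_finite[OF tiled_blow.hyps(1)] PU_subset[OF tiled_blow.hyps(1)] PU_card[OF tiled_blow.hyps(1) assms(1)] by simp_all
  have split: "card (A - W) = card (?S - W) + card (A - ?S - W)" for W
  proof -
    have "A - W = (?S - W) \<union> (A - ?S - W)" using S(2) by blast
    then have "card (A - W) = card ((?S - W) \<union> (A - ?S - W))" by simp
    also have "\<dots> = card (?S - W) + card (A - ?S - W)"
      by (rule card_Un_disjoint) (use S tiled_blow.prems in auto)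
    finally show ?thesis .
  qed
  have splitU: "card (A \<inter> ?U) = card (?S \<inter> ?U) + card ((A - ?S) \<inter> ?U)"
  proof -
    have "A \<inter> ?U = (?S \<inter> ?U) \<union> ((A - ?S) \<inter> ?U)" using S(2) by blast
    then have "card (A \<inter> ?U) = card ((?S \<inter> ?U) \<union> ((A - ?S) \<inter> ?U))" by simp
    also have "\<dots> = card (?S \<inter> ?U) + card ((A - ?S) \<inter> ?U)"
      by (rule card_Un_disjoint) (use S tiled_blow.prems in auto)
    finally show ?thesis .
  qed
  have IH: "real (card (free_pairs E ?k W1 W2 (A - ?S))) \<le> (2 ^ card (A - ?S - W1) * 2 ^ card (A - ?S - W2)) *
    \<theta> powr ((card (A - ?S) - b) / l - card ((A - ?S) \<inter> ?U) / 2)"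
    using tiled_blow by simp
  have tile: "real (card (free_pairs E ?k W1 W2 ?S)) \<le> (2 ^ card (?S - W1) * 2 ^ card (?S - W2)) *
    \<theta> powr (1 - card (?S \<inter> ?U) / 2)"
  proof (cases "card (?S \<inter> ?U) \<le> 1")
    case True
    have "\<theta> powr 1 \<le> \<theta> powr (1 - card (?S \<inter> ?U) / 2)" using th by (intro powr_mono') auto
    then have b: "(2 ^ card (?S - W1) * 2 ^ card (?S - W2)) * \<theta> \<le> (2 ^ card (?S - W1) * 2 ^ card (?S - W2)) * \<theta> powr (1 - card (?S \<inter> ?U) / 2)"
      using th by (intro mult_left_mono) auto
    have "real (card (free_pairs E ?k W1 W2 ?S)) \<le> (2 ^ card (?S - W1) * 2 ^ card (?S - W2)) * \<theta>"
      unfolding \<theta> by (rule card_free_pairs_tile[OF tiled_blow.hyps(1) assms(1) True]) (use assms(2) in simp)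
    then show ?thesis using b by (rule order.trans)
  next
    case False
    have 1: "1 \<le> \<theta> powr (1 - card (?S \<inter> ?U) / 2)"
      using powr_mono'[of "1 - card (?S \<inter> ?U) / 2" 0 \<theta>] th False by simp
    have "real (card (free_pairs E ?k W1 W2 ?S)) \<le> real (2 ^ card (?S - W1) * 2 ^ card (?S - W2)) * 1"
      using card_free_pairs_le[OF S(1), of E ?k W1 W2] by (simp only: of_nat_le_iff mult_1_right)
    also have "\<dots> \<le> real (2 ^ card (?S - W1) * 2 ^ card (?S - W2)) * \<theta> powr (1 - card (?S \<inter> ?U) / 2)"
      by (rule mult_left_mono[OF 1]) simp
    finally show ?thesis by simp
  qed
  have "card (free_pairs E ?k W1 W2 A) \<le> card (free_pairs E ?k W1 W2 ?S \<times> free_pairs E ?k W1 W2 (A - ?S))"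
  proof (rule card_inj_on_le[where f = "\<lambda>(M, N). ((M \<inter> ?S, N \<inter> ?S), (M - ?S, N - ?S))"])
    show "inj_on (\<lambda>(M, N). ((M \<inter> ?S, N \<inter> ?S), (M - ?S, N - ?S))) (free_pairs E ?k W1 W2 A)"
      by (rule inj_onI) auto
    have "\<not> tup E ((M \<inter> ?S) \<inter> (N \<inter> ?S)) ?k f" "\<not> tup E ((M - ?S) \<inter> (N - ?S)) ?k f"
      if "(M, N) \<in> free_pairs E ?k W1 W2 A" for M N f
    proof -
      have n: "\<not> tup E (M \<inter> N) ?k f" using that by (auto simp: free_pairs_def)
      show "\<not> tup E ((M \<inter> ?S) \<inter> (N \<inter> ?S)) ?k f" "\<not> tup E ((M - ?S) \<inter> (N - ?S)) ?k f"
        using n tup_mono[of E _ ?k f "M \<inter> N"] by blast+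
    qed
    then show "(\<lambda>(M, N). ((M \<inter> ?S, N \<inter> ?S), (M - ?S, N - ?S))) ` free_pairs E ?k W1 W2 A
      \<subseteq> free_pairs E ?k W1 W2 ?S \<times> free_pairs E ?k W1 W2 (A - ?S)"
      by (auto simp: free_pairs_def)
    show "finite (free_pairs E ?k W1 W2 ?S \<times> free_pairs E ?k W1 W2 (A - ?S))"
      using S(1) tiled_blow.prems by (auto intro: free_pairs_finite)
  qed
  then have "real (card (free_pairs E ?k W1 W2 A))
    \<le> real (card (free_pairs E ?k W1 W2 ?S)) * real (card (free_pairs E ?k W1 W2 (A - ?S)))"
    by (simp add: card_cartesian_product flip: of_nat_mult)
  also have "\<dots> \<le> ((2 ^ card (?S - W1) * 2 ^ card (?S - W2)) * \<theta> powr (1 - card (?S \<inter> ?U) / 2)) *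
     ((2 ^ card (A - ?S - W1) * 2 ^ card (A - ?S - W2)) * \<theta> powr ((card (A - ?S) - b) / l - card ((A - ?S) \<inter> ?U) / 2))"
    by (rule mult_mono[OF tile IH]) auto
  also have "\<dots> = (2 ^ card (A - W1) * 2 ^ card (A - W2)) *
     \<theta> powr ((1 - card (?S \<inter> ?U) / 2) + ((card (A - ?S) - b) / l - card ((A - ?S) \<inter> ?U) / 2))"
    unfolding split[of W1] split[of W2] powr_add power_add by (simp add: mult_ac)
  also have "(1 - card (?S \<inter> ?U) / 2) + ((card (A - ?S) - b) / l - card ((A - ?S) \<inter> ?U) / 2)
     = (card A - b) / l - card (A \<inter> ?U) / 2"
  proof -
    have "real (card A) = card (A - ?S) + l" using S card_mono[OF tiled_blow.prems S(2)]
      by (simp add: card_Diff_subset)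
    then show ?thesis unfolding splitU using assms(2) by (simp add: field_simps)
  qed
  finally show ?case .
qed

section \<open>Negligible families\<close>

text \<open>\<open>C\<close> is the constant of an induction hypothesis \<open>\<bar>Kf l B\<bar> \<le> C \<bar>Col l B\<bar>\<close> on proper subsets.\<close>
definition negligible :: "nat \<Rightarrow> ('a set \<Rightarrow> ('a \<Rightarrow> 'a \<Rightarrow> bool) set) \<Rightarrow> bool" where
  "negligible l X \<longleftrightarrow> (\<exists>\<delta>>0. \<exists>D. \<forall>C\<ge>1. \<forall>A. finite A \<longrightarrow>
     (\<forall>B. B \<subset> A \<longrightarrow> real (card (Kf l B)) \<le> C * real (card (Col l B))) \<longrightarrow>
     real (card (X A)) \<le> C * 2 powr (D - \<delta> * real (card A)) * real (card (Col l A)))"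

lemma Col_remove_exponent:
  fixes a n s :: real
  assumes "a \<le> 1"
  shows "- (a * (n^2 - (n - s)^2) / 2 - s) \<le> s^2 + s - a * s * n"
proof -
  have "a * (n^2 - (n - s)^2) / 2 = a * s * n - a * s^2 / 2"
    by (simp add: power2_eq_square field_simps)
  moreover have "a * s^2 \<le> 1 * s^2" using assms by (intro mult_right_mono) auto
  moreover have "0 \<le> s^2" by simp
  ultimately show ?thesis by argo
qed

lemma Col_remove:
  assumes "finite A" "S \<subseteq> A" "l \<ge> 1"
  shows "card (Col l (A - S)) \<le> card (Col l A) * 2 powr (real ((card S)^2) + card S - dens l * card S * card A)"
proof -
  let ?n = "real (card A)" and ?s = "real (card S)"
  have fS: "finite S" using assms finite_subset by blast
  have c: "real (card (A - S)) = ?n - ?s"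
    using assms fS by (simp add: card_Diff_subset card_mono of_nat_diff)
  let ?e = "(1 - 1/l) * (?n^2 - (?n - ?s)^2) / 2 - ?s"
  have g: "card (Col l (A - S)) * 2 powr ?e \<le> card (Col l A)"
    using Col_growth[OF assms(1) _ assms(3), of "A - S"] unfolding c by simp
  have le: "- ?e \<le> real ((card S)^2) + ?s - dens l * ?s * ?n"
    unfolding dens_eq[OF assms(3)] of_nat_power by (rule Col_remove_exponent) simp
  have "real (card (Col l (A - S))) = card (Col l (A - S)) * 2 powr ?e * 2 powr (- ?e)"
    by (simp add: mult.assoc flip: powr_add)
  also have "\<dots> \<le> card (Col l A) * 2 powr (- ?e)" using g by (intro mult_right_mono) auto
  also have "\<dots> \<le> card (Col l A) * 2 powr (real ((card S)^2) + ?s - dens l * ?s * ?n)"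
    using le by (intro mult_left_mono) auto
  finally show ?thesis .
qed

lemma Col_lower:
  assumes "finite A" "l \<ge> 1"
  shows "2 powr (dens l * (real (card A))^2 / 2 - card A) \<le> card (Col l A)"
proof -
  have "Col l ({} :: 'a set) = {\<lambda>_ _. False}"
    unfolding Col_def gr_def graph_def proper_def by (auto simp: fun_eq_iff)
  then show ?thesis using Col_growth[OF assms(1), of "{}" l] assms(2) by (simp add: dens_eq)
qed

text \<open>A family is negligible if a bounded set \<open>S\<close> can be removed whose traces allow exponentially fewer patterns than the
  \<open>2\<close> to the \<open>dens l \<bar>S\<bar> n\<close> which the removal of \<open>S\<close> costs among \<open>l\<close>-colourable graphs.\<close>
lemma negligibleI:
  fixes \<delta> D :: real and I :: "'a set \<Rightarrow> 'i set" and Z :: "'a set \<Rightarrow> 'i \<Rightarrow> ('a \<Rightarrow> 'a \<Rightarrow> bool) set"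
  assumes "l \<ge> 1" "\<delta> > 0" "s \<ge> 1"
    and I: "\<And>A. finite A \<Longrightarrow> finite (I A)" "\<And>A. finite A \<Longrightarrow> card (I A) \<le> card A ^ p"
    and X: "\<And>A. finite A \<Longrightarrow> X A \<subseteq> (\<Union>i\<in>I A. Z A i)"
    and Z: "\<And>A i. finite A \<Longrightarrow> i \<in> I A \<Longrightarrow> finite (Z A i)"
      "\<And>A i. finite A \<Longrightarrow> i \<in> I A \<Longrightarrow> Z A i \<noteq> {} \<Longrightarrow> \<exists>S\<subseteq>A. card S = s \<and>
         real (card (Z A i)) \<le> card (Kf l (A - S)) * 2 powr (dens l * s * card A - \<delta> * card A + D)"
  shows "negligible l X"
proof -
  \<comment> \<open>The rate is chosen so that the \<open>card A ^ p\<close> terms of the union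
    bound use up at most half of \<open>\<delta>\<close>.\<close>
  obtain C0 where C0: "C0 \<ge> 0" "\<And>n::nat. real n \<le> 2 powr (\<delta> / (2 * (p + 1)) * n + C0)"
    using nat_le_powr[of "\<delta> / (2 * (p + 1))"] assms(2) by auto
  show ?thesis unfolding negligible_def
  proof (intro exI conjI allI impI)
    show "\<delta> / 2 > 0" using assms by simp
    fix C :: real and A :: "'a set"
    assume C: "C \<ge> 1" and A: "finite A" and IH: "\<forall>B. B \<subset> A \<longrightarrow> real (card (Kf l B)) \<le> C * real (card (Col l B))"
    let ?n = "real (card A)"
    let ?c = "C * card (Col l A) * 2 powr (real (s^2) + s + D - \<delta> * ?n)"
    have b: "real (card (Z A i)) \<le> ?c" if i: "i \<in> I A" for i
    proof (cases "Z A i = {}")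
      case False
      from Z(2)[OF A i False] obtain S where S: "S \<subseteq> A" "card S = s"
        "real (card (Z A i)) \<le> card (Kf l (A - S)) * 2 powr (dens l * s * card A - \<delta> * card A + D)" by blast
      \<comment> \<open>Here \<open>s \<ge> 1\<close> matters: the comparison of \<open>Kf l\<close>
        with \<open>Col l\<close> is available on proper subsets only.\<close>
      have "A - S \<subset> A" using S assms(3) by (metis Diff_disjoint Diff_eq_empty_iff Int_absorb1 card.empty not_one_le_zero psubsetI Diff_subset inf.absorb_iff1 inf_commute)
      then have "real (card (Kf l (A - S))) \<le> C * card (Col l (A - S))" using IH by blast
      also have "\<dots> \<le> C * (card (Col l A) * 2 powr (real (s^2) + s - dens l * s * ?n))"
        using Col_remove[OF A S(1) assms(1)] S(2) C by (intro mult_left_mono) auto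
      finally have "card (Kf l (A - S)) * 2 powr (dens l * s * card A - \<delta> * card A + D)
        \<le> C * (card (Col l A) * 2 powr (real (s^2) + s - dens l * s * ?n)) * 2 powr (dens l * s * card A - \<delta> * card A + D)"
        by (intro mult_right_mono) auto
      also have "\<dots> = ?c" by (simp add: mult.assoc flip: powr_add) (simp add: algebra_simps)
      finally show ?thesis using S(3) by linarith
    qed (use C in simp)
    have "real (card (X A)) \<le> card (I A) * ?c"
      by (rule card_UN_bound[OF I(1)[OF A] X[OF A] Z(1)[OF A] b])
    also have "\<dots> \<le> 2 powr (\<delta> / 2 * ?n + p * C0) * ?c"
    proof (rule mult_right_mono)
      have "real (card (I A)) \<le> real (card A ^ p)" using I(2)[OF A] by (rule of_nat_mono)
      also have "\<dots> \<le> (2 powr (\<delta> / (2 * (p + 1)) * ?n + C0)) ^ p" unfolding of_nat_power by (rule power_mono[OF C0(2)]) simp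
      also have "\<dots> = 2 powr (p * (\<delta> / (2 * (p + 1))) * ?n + p * C0)" by (simp add: powr_power algebra_simps)
      also have "\<dots> \<le> 2 powr (\<delta> / 2 * ?n + p * C0)"
      proof -
        have "p * (\<delta> / (2 * (p + 1))) \<le> \<delta> / 2" using assms(2) by (simp add: field_simps)
        then have "p * (\<delta> / (2 * (p + 1))) * ?n \<le> \<delta> / 2 * ?n" by (rule mult_right_mono) simp
        then show ?thesis by simp
      qed
      finally show "real (card (I A)) \<le> 2 powr (\<delta> / 2 * ?n + p * C0)" .
    qed (use C in simp)
    also have "\<dots> = C * 2 powr ((real (s^2) + s + D + p * C0) - \<delta> / 2 * ?n) * card (Col l A)"
      by (simp add: mult_ac flip: powr_add) (simp add: algebra_simps)
    finally show "real (card (X A)) \<le> C * 2 powr ((real (s^2) + s + D + p * C0) - \<delta> / 2 * ?n) * card (Col l A)" .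
  qed
qed

section \<open>Links of blow-ups and the families of atypical graphs\<close>

definition link :: "('a \<Rightarrow> 'a \<Rightarrow> bool) \<Rightarrow> 'a set \<Rightarrow> nat \<Rightarrow> (nat \<Rightarrow> 'a set) \<Rightarrow> 'a set" where
  "link E A k P = {v \<in> A. \<forall>i<k. nb E v \<inter> P i \<noteq> {}}"

lemma link_subset: "link E A k P \<subseteq> A" by (auto simp: link_def)

lemma blow_part: "blow E A k q P \<Longrightarrow> i < k \<Longrightarrow> P i \<subseteq> A"
  by (simp add: blow_def)

lemma link_cong: "(\<And>i. i < k \<Longrightarrow> P i = P' i) \<Longrightarrow> link E A k P = link E A k P'"
  by (auto simp: link_def)

lemma link_res:
  assumes "\<And>i. i < k \<Longrightarrow> P i \<subseteq> A - S"
  shows "link (res (A - S) E) (A - S) k P = link E A k P - S"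
proof -
  have "nb (res (A - S) E) v \<inter> P i = nb E v \<inter> P i" if "v \<in> A - S" "i < k" for v i
    using assms[OF that(2)] that(1) by (auto simp: nb_def res_def)
  then show ?thesis by (auto simp: link_def)
qed

text \<open>A neighbour \<open>v\<close> of \<open>x\<close> in the link would form, together with
  \<open>x\<close> and one neighbour of \<open>v\<close> in each part, a clique on
  \<open>l + 1\<close> vertices.\<close>

lemma nb_link_disjoint:
  assumes E: "E \<in> Kf l A" and "l \<ge> 1" and P: "blow E (nb E x) (l - 1) q P"
  shows "nb E x \<inter> link E A (l - 1) P = {}"
proof (rule ccontr)
  assume "\<not> ?thesis"
  then obtain v where v: "E x v" "v \<in> A" "\<forall>i<l - 1. nb E v \<inter> P i \<noteq> {}"
    by (auto simp: link_def nb_def)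
  then have "\<forall>i. \<exists>y. i < l - 1 \<longrightarrow> y \<in> nb E v \<inter> P i" by blast
  then obtain f where "\<forall>i<l - 1. f i \<in> nb E v \<inter> P i" by metis
  then obtain f where f: "\<And>i. i < l - 1 \<Longrightarrow> E v (f i)" "\<And>i. i < l - 1 \<Longrightarrow> f i \<in> P i" by (auto simp: nb_def)
  have g: "E \<in> gr A" using E by (rule Kf_gr)
  have nA: "nb E x \<subseteq> A" using nb_subset[OF g] by blast
  have fx: "E x (f i)" if "i < l - 1" for i
    using P f(2)[OF that] that by (auto simp: blow_def nb_def)
  have "tup E A (l - 1) f" using blow_tup[OF P f(2)] tup_mono nA by blast
  then have "tup E A (Suc (l - 1)) (f(l - 1 := v))" by (rule tup_Suc[OF _ v(2) g f(1)])
  moreover have "x \<in> A" using gr_dom[OF g v(1)] by blast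
  ultimately have "tup E A (Suc (Suc (l - 1))) ((f(l - 1 := v))(Suc (l - 1) := x))"
    by (rule tup_Suc[OF _ _ g]) (use v fx in \<open>auto simp: less_Suc_eq\<close>)
  then show False using E assms(2) by (auto simp: Kf_def)
qed

lemma two_pow_powr: "(2::real) ^ n = 2 powr real n"
  by (simp add: powr_realpow)

text \<open>A vertex outside the link misses some part, so its trace is light with parameter 1, and
  there are about \<open>2 ^ ((l - 2) * q)\<close> such traces. With fewer than
  \<open>(1/l - d) * n\<close> vertices in the link the exponent is about
  \<open>(l - 2) * q * n + q * (1/l - d) * n\<close>, whereas removing the blow-up is priced at
  \<open>dens l * ((l - 1) * q) * n\<close>, which is larger by \<open>d * q * n\<close>. Half of
  the difference pays, through \<open>big\<close>, for the factor
  \<open>2 * ((l - 1) * (q + 1))\<close> per vertex.\<close>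

lemma negligible_small_link:
  fixes d :: real
  assumes l: "l \<ge> 2" and q: "q \<ge> 1" and d: "d > 0" and big: "2 * (real (l - 1) * (real q + 1)) \<le> 2 powr (d / 2 * q)"
  shows "negligible l (\<lambda>A :: 'a set. {E \<in> Kf l A. \<exists>P. blow E A (l - 1) q P \<and>
    real (card (link E A (l - 1) P)) < (1/l - d) * card A})"
proof (rule negligibleI[where I = "\<lambda>A. BP A (l - 1) q" and s = "(l - 1) * q" and p = "(l - 1) * q"
      and \<delta> = "d / 2 * q" and D = "real (((l - 1) * q)^2)"
      and Z = "\<lambda>A P. {E \<in> Kf l A. blow E A (l - 1) q P \<and> real (card (link E A (l - 1) P)) < (1/l - d) * card A}"])
  let ?k = "l - 1"
  fix A :: "'a set" assume A: "finite A"
  let ?n = "real (card A)"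
  let ?Z = "\<lambda>P. {E \<in> Kf l A. blow E A ?k q P \<and> real (card (link E A ?k P)) < (1/l - d) * card A}"
  show "finite (BP A ?k q)" by (rule BP_finite[OF A])
  show "card (BP A ?k q) \<le> card A ^ (?k * q)" by (rule BP_card[OF A])
  show "{E \<in> Kf l A. \<exists>P. blow E A ?k q P \<and> real (card (link E A ?k P)) < (1/l - d) * card A} \<subseteq> (\<Union>P\<in>BP A ?k q. ?Z P)"
  proof clarify
    fix E P assume a: "E \<in> Kf l A" "blow E A ?k q P" "real (card (link E A ?k P)) < (1/l - d) * card A"
    have "link E A ?k (restrict P {..<?k}) = link E A ?k P" by (rule link_cong) simp
    then have "E \<in> ?Z (restrict P {..<?k})" using a blow_BP[OF a(2)] by simp
    then show "E \<in> (\<Union>P\<in>BP A ?k q. ?Z P)" using blow_BP[OF a(2)] by blast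
  qed
  fix P assume "P \<in> BP A ?k q"
  show "finite (?Z P)" using Kf_finite[OF A] by simp
  assume "?Z P \<noteq> {}"
  then obtain E0 where E0: "E0 \<in> Kf l A" "blow E0 A ?k q P" by blast
  have g0: "E0 \<in> gr A" using E0 Kf_gr by blast
  let ?S = "PU P ?k"
  have S: "?S \<subseteq> A" "card ?S = ?k * q" "finite ?S"
    using PU_subset[OF E0(2)] PU_card[OF E0(2) g0] PU_finite[OF E0(2)] by auto
  define g where "g = real ?k * ((real q + 1) * 2 ^ ((?k - 1) * q))"
  have g1: "g \<ge> 1"
  proof -
    have "1 * (1 * 1) \<le> g" unfolding g_def using l by (intro mult_mono one_le_power) auto
    then show ?thesis by simp
  qed
  have "card (?Z P) \<le> card (Kf l (A - ?S)) * (2 ^ (card ?S)^2 * (2 ^ card A * (g ^ card A * 2 powr (real q * ((1/l - d) * card A)))))"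
  proof (rule card_pattern_removal[OF A S(1), where G = "light P ?k 1"])
    show "?Z P \<subseteq> gr A" using Kf_gr by blast
    show "finite (Kf l (A - ?S))" using Kf_finite A by blast
    show "light P ?k 1 \<subseteq> Pow ?S" by (auto simp: light_def)
    show "real (card (light P ?k 1)) \<le> g"
      using of_nat_mono[OF card_light[OF E0(2) g0, of 1], where 'a = real] 
      by (simp only: of_nat_mult of_nat_power of_nat_add of_nat_1 of_nat_numeral power_one_right g_def)
    show "2 ^ card ?S \<le> g * 2 powr real q"
    proof -
      have "?k * q = (?k - 1) * q + q" using l by (cases ?k) auto
      then have eq: "(2::real) ^ card ?S = 2 ^ ((?k - 1) * q) * 2 powr q"
        unfolding S(2) by (simp add: power_add two_pow_powr powr_add)
      have "2 ^ ((?k - 1) * q) \<le> g"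
      proof -
        have "1 * (1 * 2 ^ ((?k - 1) * q)) \<le> g" unfolding g_def using l by (intro mult_mono) auto
        then show ?thesis by simp
      qed
      then show ?thesis unfolding eq by (rule mult_right_mono) simp
    qed
    fix E assume E: "E \<in> ?Z P"
    then show "res (A - ?S) E \<in> Kf l (A - ?S)" using Kf_res by blast
    have "{v \<in> A - ?S. nb E v \<inter> ?S \<notin> light P ?k 1} \<subseteq> link E A ?k P"
    proof
      fix v assume v: "v \<in> {v \<in> A - ?S. nb E v \<inter> ?S \<notin> light P ?k 1}"
      have "nb E v \<inter> P i \<noteq> {}" if "i < ?k" for i
      proof -
        have "\<not> card (nb E v \<inter> ?S \<inter> P i) < 1" using v that unfolding light_def by blast
        then have "nb E v \<inter> ?S \<inter> P i \<noteq> {}" by force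
        then show ?thesis by blast
      qed
      then show "v \<in> link E A ?k P" using v by (simp add: link_def)
    qed
    then have "card {v \<in> A - ?S. nb E v \<inter> ?S \<notin> light P ?k 1} \<le> card (link E A ?k P)"
      by (rule card_mono[OF finite_subset[OF link_subset A]])
    then show "real (card {v \<in> A - ?S. nb E v \<inter> ?S \<notin> light P ?k 1}) \<le> (1/l - d) * card A"
      using E by auto
  qed (use g1 in auto)
  also have "\<dots> \<le> card (Kf l (A - ?S)) * 2 powr (dens l * (?k * q) * ?n - d / 2 * q * ?n + real ((?k * q)^2))"
  proof (rule mult_left_mono)
    have "2 * g = (2 * (real (l - 1) * (real q + 1))) * 2 ^ ((?k - 1) * q)" by (simp add: g_def)
    also have "\<dots> \<le> 2 powr (d / 2 * q) * 2 ^ ((?k - 1) * q)" using big by (rule mult_right_mono) simp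
    also have "\<dots> = 2 powr (d / 2 * q + real ((?k - 1) * q))" by (simp only: powr_add two_pow_powr)
    finally have "(2 * g) ^ card A \<le> (2 powr (d / 2 * q + real ((?k - 1) * q))) ^ card A"
      using g1 by (intro power_mono) auto
    then have "2 ^ card A * g ^ card A \<le> 2 powr (?n * (d / 2 * q + real ((?k - 1) * q)))"
      by (simp add: power_mult_distrib powr_power)
    then have "2 ^ (card ?S)^2 * ((2 ^ card A * g ^ card A) * 2 powr (real q * ((1/l - d) * card A)))
       \<le> 2 ^ (card ?S)^2 * (2 powr (?n * (d / 2 * q + real ((?k - 1) * q))) * 2 powr (real q * ((1/l - d) * card A)))"
      by (intro mult_left_mono mult_right_mono) auto
    also have "\<dots> = 2 powr (real ((?k * q)^2) + (?n * (d / 2 * q + real ((?k - 1) * q)) + real q * ((1/l - d) * ?n)))"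
      unfolding S(2) powr_add by (simp only: two_pow_powr)
    also have "real ((?k * q)^2) + (?n * (d / 2 * q + real ((?k - 1) * q)) + real q * ((1/l - d) * ?n))
       = dens l * (?k * q) * ?n - d / 2 * q * ?n + real ((?k * q)^2)"
      unfolding dens_def using l by (simp add: of_nat_diff field_simps power2_eq_square)
    finally show "2 ^ (card ?S)^2 * (2 ^ card A * (g ^ card A * 2 powr (real q * ((1/l - d) * card A))))
      \<le> 2 powr (dens l * (?k * q) * ?n - d / 2 * q * ?n + real ((?k * q)^2))" by (simp add: mult.assoc)
  qed simp
  finally show "\<exists>S\<subseteq>A. card S = ?k * q \<and> real (card (?Z P)) \<le> card (Kf l (A - S)) *
     2 powr (dens l * (?k * q) * ?n - d / 2 * q * ?n + real ((?k * q)^2))"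
    using S by blast
qed (use l q d in auto)

text \<open>By \<open>nb_link_disjoint\<close> the neighbourhood of \<open>x\<close> lies outside
  both links, within a set of at most \<open>(dens l - d) * n\<close> vertices determined by the
  graph on \<open>A - {x}\<close>. Two blow-ups are treated at once because a bound on the union,
  together with the lower bound on single links, makes the link nearly independent of the blow-up
  chosen in \<open>nb E x\<close>.\<close>

lemma negligible_large_link:
  fixes d :: real
  assumes l: "l \<ge> 2" and d: "d > 0"
  shows "negligible l (\<lambda>A :: 'a set. {E \<in> Kf l A. \<exists>x\<in>A. \<exists>P P'. blow E (nb E x) (l - 1) q P \<and> blow E (nb E x) (l - 1) q P' \<and>
    (1/l + d) * card A < real (card (link E A (l - 1) P \<union> link E A (l - 1) P'))})"
proof (rule negligibleI[where I = "\<lambda>A. A \<times> BP A (l - 1) q \<times> BP A (l - 1) q" and s = 1 and p = "1 + ((l - 1) * q + (l - 1) * q)"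
      and \<delta> = d and D = 1
      and Z = "\<lambda>A (x, P, P'). {E \<in> Kf l A. blow E (nb E x) (l - 1) q P \<and> blow E (nb E x) (l - 1) q P' \<and>
         (1/l + d) * card A < real (card (link E A (l - 1) P \<union> link E A (l - 1) P'))}"])
  let ?k = "l - 1"
  fix A :: "'a set" assume A: "finite A"
  let ?n = "real (card A)"
  let ?Z = "\<lambda>(x, P, P'). {E \<in> Kf l A. blow E (nb E x) ?k q P \<and> blow E (nb E x) ?k q P' \<and>
         (1/l + d) * card A < real (card (link E A ?k P \<union> link E A ?k P'))}"
  show "finite (A \<times> BP A ?k q \<times> BP A ?k q)" using BP_finite[OF A] A by simp
  show "card (A \<times> BP A ?k q \<times> BP A ?k q) \<le> card A ^ (1 + (?k * q + ?k * q))"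
    unfolding card_cartesian_product power_add using BP_card[OF A] by (intro mult_le_mono) auto
  show "{E \<in> Kf l A. \<exists>x\<in>A. \<exists>P P'. blow E (nb E x) ?k q P \<and> blow E (nb E x) ?k q P' \<and>
    (1/l + d) * card A < real (card (link E A ?k P \<union> link E A ?k P'))} \<subseteq> (\<Union>i\<in>A \<times> BP A ?k q \<times> BP A ?k q. ?Z i)"
  proof clarify
    fix E x P P' assume a: "E \<in> Kf l A" "x \<in> A" "blow E (nb E x) ?k q P" "blow E (nb E x) ?k q P'"
      "(1/l + d) * card A < real (card (link E A ?k P \<union> link E A ?k P'))"
    have "nb E x \<subseteq> A" using nb_subset[OF Kf_gr[OF a(1)]] by blast
    then have b: "blow E A ?k q P" "blow E A ?k q P'" using a blow_mono by blast+
    have "link E A ?k (restrict P {..<?k}) = link E A ?k P" "link E A ?k (restrict P' {..<?k}) = link E A ?k P'"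
      by (rule link_cong, simp)+
    then have "E \<in> ?Z (x, restrict P {..<?k}, restrict P' {..<?k})"
      using a blow_BP[OF a(3)] blow_BP[OF a(4)] by simp
    moreover have "(x, restrict P {..<?k}, restrict P' {..<?k}) \<in> A \<times> BP A ?k q \<times> BP A ?k q"
      using a(2) blow_BP[OF b(1)] blow_BP[OF b(2)] by simp
    ultimately show "E \<in> (\<Union>i\<in>A \<times> BP A ?k q \<times> BP A ?k q. ?Z i)" by (rule UN_I[rotated])
  qed
  fix i assume "i \<in> A \<times> BP A ?k q \<times> BP A ?k q"
  then obtain x P P' where i: "i = (x, P, P')" and x: "x \<in> A" by auto
  show "finite (?Z i)" unfolding i using Kf_finite[OF A] by simp
  define U where "U H = link H (A - {x}) ?k P \<union> link H (A - {x}) ?k P'" for H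
  \<comment> \<open>The links are computed in \<open>A - {x}\<close>, where at most the vertex
    \<open>x\<close> is lost; hence the \<open>- 1\<close>.\<close>
  define \<Phi> where "\<Phi> H = (if (1/l + d) * ?n - 1 < card (U H) then Pow (A - {x} - U H) else {})" for H
  have UA: "U H \<subseteq> A - {x}" for H unfolding U_def by (intro Un_least link_subset)
  have "real (card (?Z i)) \<le> card (Kf l (A - {x})) * (2 ^ (card {x})^2 * 2 powr (dens l * ?n - d * ?n))"
    unfolding i prod.case
  proof (rule card_removal[OF A _ _ Kf_finite, where g = "\<lambda>E. nb E x" and \<Phi> = \<Phi>])
    show "{E \<in> Kf l A. blow E (nb E x) ?k q P \<and> blow E (nb E x) ?k q P' \<and>
         (1/l + d) * card A < real (card (link E A ?k P \<union> link E A ?k P'))} \<subseteq> gr A" using Kf_gr by blast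
    show "finite (\<Phi> H)" for H using A by (simp add: \<Phi>_def)
    fix H
    show "real (card (\<Phi> H)) \<le> 2 powr (dens l * ?n - d * ?n)"
    proof (cases "(1/l + d) * ?n - 1 < card (U H)")
      case True
      have "card (A - {x} - U H) = card A - 1 - card (U H)"
        using A x UA[of H] by (simp add: card_Diff_subset finite_subset)
      moreover have "card (U H) \<le> card A - 1" using card_mono[OF _ UA[of H]] A x by simp
      moreover have "card A \<ge> 1" using A x by (metis One_nat_def Suc_leI card_gt_0_iff empty_iff)
      ultimately have "real (card (A - {x} - U H)) \<le> ?n - (1/l + d) * ?n" using True by (simp add: of_nat_diff)
      also have "\<dots> = dens l * ?n - d * ?n" using l by (simp add: dens_eq algebra_simps)
      finally have "2 powr real (card (A - {x} - U H)) \<le> 2 powr (dens l * ?n - d * ?n)" by simp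
      then show ?thesis using True A by (simp add: \<Phi>_def two_powr_card_Pow)
    qed (simp add: \<Phi>_def)
  next
    fix E assume "E \<in> {E \<in> Kf l A. blow E (nb E x) ?k q P \<and> blow E (nb E x) ?k q P' \<and>
         (1/l + d) * card A < real (card (link E A ?k P \<union> link E A ?k P'))}"
    then have E: "E \<in> Kf l A" and b: "blow E (nb E x) ?k q P" "blow E (nb E x) ?k q P'"
      and c: "(1/l + d) * card A < real (card (link E A ?k P \<union> link E A ?k P'))" by auto
    show "res (A - {x}) E \<in> Kf l (A - {x})" using E Kf_res by blast
    have nx: "nb E x \<subseteq> A - {x}" using nb_subset[OF Kf_gr[OF E]] .
    have "P i \<subseteq> A - {x}" "P' i \<subseteq> A - {x}" if "i < ?k" for i
      using blow_part[OF b(1) that] blow_part[OF b(2) that] nx by auto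
    then have U: "U (res (A - {x}) E) = (link E A ?k P \<union> link E A ?k P') - {x}"
      unfolding U_def by (simp add: link_res Un_Diff)
    have "card (link E A ?k P \<union> link E A ?k P') \<le> card (U (res (A - {x}) E)) + 1"
      unfolding U card_Diff_singleton_if by (simp, intro conjI impI; linarith)
    then have "(1/l + d) * ?n - 1 < card (U (res (A - {x}) E))" using c by linarith
    moreover have "nb E x \<inter> (link E A ?k P \<union> link E A ?k P') = {}"
      using nb_link_disjoint[OF E _ b(1)] nb_link_disjoint[OF E _ b(2)] l by auto
    ultimately show "nb E x \<in> \<Phi> (res (A - {x}) E)" using nx U by (auto simp: \<Phi>_def)
  next
    fix E E' assume a: "E \<in> {E \<in> Kf l A. blow E (nb E x) ?k q P \<and> blow E (nb E x) ?k q P' \<and>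
         (1/l + d) * card A < real (card (link E A ?k P \<union> link E A ?k P'))}"
      "E' \<in> {E \<in> Kf l A. blow E (nb E x) ?k q P \<and> blow E (nb E x) ?k q P' \<and>
         (1/l + d) * card A < real (card (link E A ?k P \<union> link E A ?k P'))}"
      "res (A - {x}) E = res (A - {x}) E'" "res {x} E = res {x} E'" "nb E x = nb E' x"
    have "E \<in> gr A" "E' \<in> gr A" using a(1,2) Kf_gr by blast+
    then show "E = E'" by (rule determined_by_nbhds[where S = "{x}"]) (use a(3-5) x in simp_all)
  qed (use A x Kf_gr in auto)
  also have "\<dots> = card (Kf l (A - {x})) * 2 powr (dens l * real 1 * ?n - d * ?n + 1)"
    by (simp add: powr_add)
  finally show "\<exists>S\<subseteq>A. card S = 1 \<and> real (card (?Z i)) \<le> card (Kf l (A - S)) * 2 powr (dens l * real 1 * ?n - d * ?n + 1)"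
    using x by (intro exI[where x = "{x}"]) auto
qed (use l d in auto)

text \<open>Without \<open>x\<close> the graph is still tiled up to about \<open>\<rho> * n\<close>
  vertices, so \<open>card_tiled_no_blow\<close> leaves about
  \<open>2 powr ((\<rho> + \<gamma>) * n)\<close> choices for the neighbourhood of \<open>x\<close>,
  against \<open>2 powr (dens l * n)\<close> for colourable graphs.\<close>

lemma negligible_poor_nbhd:
  fixes \<rho> \<gamma> :: real
  assumes l: "l \<ge> 1" and \<gamma>: "\<gamma> \<ge> 0" "\<rho> + \<gamma> < dens l"
    and big: "(l * l) * ((real Q + 1) ^ (2 * q) * 2 ^ ((l - 2) * Q)) \<le> 2 powr (\<gamma> * (l * Q))"
  shows "negligible l (\<lambda>A :: 'a set. {E \<in> Kf l A. tiled E l Q (\<rho> * card A) A \<and> (\<exists>x\<in>A. \<not> (\<exists>P. blow E (nb E x) (l - 1) q P))})"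
proof (rule negligibleI[where I = "\<lambda>A. A" and s = 1 and p = 1 and \<delta> = "dens l - \<rho> - \<gamma>" and D = "1 + real (1 * (l * Q))"
      and Z = "\<lambda>A x. {E \<in> Kf l A. tiled E l Q (\<rho> * card A) A \<and> \<not> (\<exists>P. blow E (nb E x) (l - 1) q P)}"])
  let ?k = "l - 1"
  fix A :: "'a set" assume A: "finite A"
  let ?n = "real (card A)"
  let ?Z = "\<lambda>x. {E \<in> Kf l A. tiled E l Q (\<rho> * card A) A \<and> \<not> (\<exists>P. blow E (nb E x) ?k q P)}"
  show "{E \<in> Kf l A. tiled E l Q (\<rho> * card A) A \<and> (\<exists>x\<in>A. \<not> (\<exists>P. blow E (nb E x) ?k q P))} \<subseteq> (\<Union>x\<in>A. ?Z x)" by blast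
  show "finite A" by (rule A)
  show "card A \<le> card A ^ 1" by simp
  fix x assume x: "x \<in> A"
  show "finite (?Z x)" using Kf_finite[OF A] by simp
  \<comment> \<open>Removing \<open>x\<close> uncovers at most the \<open>l * Q\<close> vertices of
    one tile.\<close>
  let ?b = "\<rho> * ?n + real (1 * (l * Q))"
  define \<Phi> where "\<Phi> H = (if tiled H l Q ?b (A - {x}) then {N. N \<subseteq> A - {x} \<and> \<not> (\<exists>P. blow H N ?k q P)} else {})" for H
  have "real (card (?Z x)) \<le> card (Kf l (A - {x})) * (2 ^ (card {x})^2 * 2 powr (?b + \<gamma> * ?n))"
  proof (rule card_removal[OF A _ _ Kf_finite, where g = "\<lambda>E. nb E x" and \<Phi> = \<Phi>])
    show "?Z x \<subseteq> gr A" using Kf_gr by auto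
    show "finite (\<Phi> H)" for H using A by (simp add: \<Phi>_def)
    fix H assume H: "H \<in> Kf l (A - {x})"
    show "real (card (\<Phi> H)) \<le> 2 powr (?b + \<gamma> * ?n)"
    proof (cases "tiled H l Q ?b (A - {x})")
      case True
      have "real (card {N. N \<subseteq> A - {x} \<and> \<not> (\<exists>P. blow H N ?k q P)}) \<le> 2 powr (?b + \<gamma> * card (A - {x}))"
        by (rule card_tiled_no_blow[OF Kf_gr[OF H] big \<gamma>(1) True]) (use A in simp)
      also have "\<dots> \<le> 2 powr (?b + \<gamma> * ?n)"
        using \<gamma>(1) card_mono[OF A, of "A - {x}"] by (auto intro!: mult_left_mono)
      finally show ?thesis using True by (simp add: \<Phi>_def)
    qed (simp add: \<Phi>_def)
  next
    fix E assume "E \<in> ?Z x"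
    then have E: "E \<in> Kf l A" and t: "tiled E l Q (\<rho> * card A) A" and b: "\<not> (\<exists>P. blow E (nb E x) ?k q P)" by auto
    show "res (A - {x}) E \<in> Kf l (A - {x})" using E Kf_res by blast
    have nx: "nb E x \<subseteq> A - {x}" using nb_subset[OF Kf_gr[OF E]] .
    have "tiled E l Q ?b (A - {x})" by (rule tiled_remove[OF Kf_gr[OF E] t A]) auto
    then have "tiled (res (A - {x}) E) l Q ?b (A - {x})" by (simp add: tiled_res_iff)
    then show "nb E x \<in> \<Phi> (res (A - {x}) E)" using nx b by (simp add: \<Phi>_def blow_res)
  next
    fix E E' assume a: "E \<in> ?Z x" "E' \<in> ?Z x"
      "res (A - {x}) E = res (A - {x}) E'" "res {x} E = res {x} E'" "nb E x = nb E' x"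
    have "E \<in> gr A" "E' \<in> gr A" using a(1,2) Kf_gr by blast+
    then show "E = E'" by (rule determined_by_nbhds[where S = "{x}"]) (use a(3-5) x in simp_all)
  qed (use A x Kf_gr in auto)
  also have "\<dots> = card (Kf l (A - {x})) * 2 powr (dens l * real 1 * ?n - (dens l - \<rho> - \<gamma>) * ?n + (1 + real (1 * (l * Q))))"
    by (simp add: powr_add algebra_simps powr_diff)
  finally show "\<exists>S\<subseteq>A. card S = 1 \<and> real (card (?Z x)) \<le> card (Kf l (A - S)) * 2 powr (dens l * real 1 * ?n - (dens l - \<rho> - \<gamma>) * ?n + (1 + real (1 * (l * Q))))"
    using x by (intro exI[where x = "{x}"]) auto
qed (use l \<gamma> in auto)

text \<open>With \<open>b = \<rho> * n\<close> the saving in \<open>few_untiled\<close> is quadratic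
  in \<open>n\<close> and beats the linear loss in \<open>Col_lower\<close>, without recourse to the
  hypothesis on proper subsets.\<close>

lemma negligible_untiled:
  fixes \<rho> :: real
  assumes l: "l \<ge> 2" and \<rho>: "\<rho> > 0"
  shows "\<exists>Q0. \<forall>Q\<ge>Q0. negligible l (\<lambda>A :: 'a set. {E \<in> Kf l A. \<not> tiled E l Q (\<rho> * card A) A})"
proof -
  define c where "c = (dens l - dens (l - 1)) / 2"
  have c: "c > 0"
  proof -
    have "dens l = 1 - 1 / real l" "dens (l - 1) = 1 - 1 / (real l - 1)"
      using l by (auto simp: dens_eq of_nat_diff)
    then show ?thesis unfolding c_def using l by (simp add: frac_less2)
  qed
  \<comment> \<open>Half of the saving \<open>c * \<rho>^2\<close> is given to the error term of
    \<open>few_untiled\<close>, so that half remains.\<close>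
  have e: "c * \<rho>^2 / 2 > 0" using c \<rho> by simp
  from few_untiled[OF l e, where 'a = 'a] obtain Q0 where Q0: "\<forall>Q\<ge>Q0. \<exists>D. \<forall>(A :: 'a set) b. finite A \<longrightarrow> b \<ge> 0 \<longrightarrow>
    card {E \<in> Kf l A. \<not> tiled E l Q b A} \<le> 2 powr (dens l * (card A)^2 / 2 + c * \<rho>^2 / 2 * (card A)^2 + D - c * b^2)"
    unfolding c_def by blast
  show ?thesis
  proof (intro exI[where x = Q0] allI impI)
    fix Q assume "Q \<ge> Q0"
    then obtain D where D: "\<And>(A :: 'a set) b. finite A \<Longrightarrow> b \<ge> 0 \<Longrightarrow>
      card {E \<in> Kf l A. \<not> tiled E l Q b A} \<le> 2 powr (dens l * (card A)^2 / 2 + c * \<rho>^2 / 2 * (card A)^2 + D - c * b^2)"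
      using Q0 by blast
    let ?e = "c * \<rho>^2 / 2"
    show "negligible l (\<lambda>A :: 'a set. {E \<in> Kf l A. \<not> tiled E l Q (\<rho> * card A) A})"
      unfolding negligible_def
    proof (rule exI[where x = 1], rule conjI, simp, rule exI[where x = "D + 2^2 / ?e"], intro allI impI)
      fix C :: real and A :: "'a set" assume C: "C \<ge> 1" and A: "finite A"
      let ?n = "real (card A)"
      have le: "2 powr ((1 - 1/l) * (?n^2) / 2 - ?n) \<le> card (Col l A)"
        using Col_lower[OF A, of l] l by (simp add: dens_eq)
      then have col: "1 \<le> card (Col l A) * 2 powr (?n - dens l * ?n^2 / 2)"
      proof -
        have "1 = 2 powr ((1 - 1/l) * (?n^2) / 2 - ?n) * 2 powr (?n - dens l * ?n^2 / 2)"
          using l by (simp add: dens_eq flip: powr_add)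
        then show ?thesis using mult_right_mono[OF le, of "2 powr (?n - dens l * ?n^2 / 2)"] by simp
      qed
      have "card {E \<in> Kf l A. \<not> tiled E l Q (\<rho> * card A) A} \<le>
        2 powr (dens l * (card A)^2 / 2 + ?e * (card A)^2 + D - c * (\<rho> * card A)^2)"
        using D[OF A, of "\<rho> * card A"] \<rho> by simp
      also have "\<dots> = 2 powr (dens l * ?n^2 / 2 - ?e * ?n^2 + D) * 1"
        by (simp add: power_mult_distrib algebra_simps)
      also have "\<dots> \<le> 2 powr (dens l * ?n^2 / 2 - ?e * ?n^2 + D) * (card (Col l A) * 2 powr (?n - dens l * ?n^2 / 2))"
        by (rule mult_left_mono[OF col]) simp
      also have "\<dots> = 1 * 2 powr (D - ?e * ?n^2 + ?n) * card (Col l A)"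
        by (simp add: mult_ac flip: powr_add) (simp add: add.commute)
      \<comment> \<open>The coefficient 2 covers one \<open>n\<close> lost in
        \<open>Col_lower\<close> and another for the rate 1.\<close>
      also have "\<dots> \<le> C * 2 powr (D + 2^2 / ?e - 1 * ?n) * card (Col l A)"
        using linear_le_quadratic[OF e, of 2 ?n] C by (intro mult_right_mono mult_mono) auto
      finally show "real (card {E \<in> Kf l A. \<not> tiled E l Q (\<rho> * ?n) A}) \<le> C * 2 powr (D + 2^2 / ?e - 1 * ?n) * card (Col l A)" .
    qed
  qed
qed

text \<open>About \<open>n / l\<close> tiles and at most \<open>(2/l - d') * n\<close> vertices in
  the two links leave \<open>d' / 2 * n\<close> in the exponent of
  \<open>card_tiled_free_pairs\<close>. Half of it is kept, the other half covers the
  \<open>\<rho> * n\<close> vertices that are not tiled.\<close>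

lemma overlap_exponent:
  fixes l n b \<rho> d' K w :: real
  assumes "l \<ge> 1" "n \<ge> 0" "\<rho> \<le> d' / 4" "\<rho> \<ge> 0" "b = \<rho> * n + K" "K \<ge> 0" "w \<le> (2/l - d') * n"
  shows "d' / 4 * n - (2 + K) \<le> (n - 2 - b) / l - w / 2"
proof -
  have "(2 + K) / l \<le> 2 + K" using assms by (simp add: divide_le_eq mult_left_mono[of 1 l "2 + K", simplified])
  moreover have "\<rho> * n / l \<le> \<rho> * n" using assms by (simp add: divide_le_eq mult_left_mono[of 1 l "\<rho> * n", simplified])
  moreover have "\<rho> * n \<le> d' / 4 * n" using assms by (intro mult_right_mono) auto
  moreover have "(n - 2 - b) / l = n / l - (2 + K) / l - \<rho> * n / l" unfolding assms(5) by (simp add: diff_divide_distrib add_divide_distrib)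
  moreover have "w / 2 \<le> ((2/l - d') * n) / 2" using assms(7) by (rule divide_right_mono) simp
  moreover have "((2/l - d') * n) / 2 = n / l - d' / 2 * n" by (simp add: left_diff_distrib diff_divide_distrib)
  ultimately show ?thesis by argo
qed

text \<open>Since each neighbourhood avoids a link of about \<open>(1/l - d) * n\<close> vertices,
  there are at most \<open>2 powr (2 * (dens l + d) * n)\<close> pairs of neighbourhoods, an excess
  of \<open>2 * d * n\<close> in the exponent over colourable graphs. If the links overlap, about
  \<open>d' / 4 * n\<close> factors \<open>1 - (1/4) ^ (l - 1)\<close> are gained from the missing
  common clique; by \<open>small\<close> half of this gain outweighs the excess. The blow-ups avoid
  \<open>x\<close> and \<open>z\<close> because both vertices are removed.\<close>

lemma negligible_overlapping_links:
  fixes \<rho> d d' :: real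
  assumes l: "l \<ge> 2" and \<rho>: "0 \<le> \<rho>" "\<rho> \<le> d' / 4" and d: "d > 0" "d' > 0"
    and small: "2 * d \<le> - log 2 (1 - (1/4) ^ (l - 1)) * d' / 8"
  shows "negligible l (\<lambda>A :: 'a set. {E \<in> Kf l A. tiled E l Q (\<rho> * card A) A \<and>
    (\<exists>x\<in>A. \<exists>z\<in>A. x \<noteq> z \<and> (\<exists>P P'. blow E (nb E x - {z}) (l - 1) q P \<and> blow E (nb E z - {x}) (l - 1) q P' \<and>
      (1/l - d) * card A \<le> card (link E A (l - 1) P) \<and> (1/l - d) * card A \<le> card (link E A (l - 1) P') \<and>
      card (link E A (l - 1) P \<union> link E A (l - 1) P') < (2/l - d') * card A \<and>
      \<not> (\<exists>f. tup E (nb E x \<inter> nb E z) (l - 1) f)))})"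
proof -
  let ?k = "l - 1"
  define \<theta> :: real where "\<theta> = 1 - (1/4) ^ (l - 1)"
  have th: "0 < \<theta>" "\<theta> < 1" unfolding \<theta>_def using l by (auto simp: power_less_one_iff)
  define \<eta> where "\<eta> = - log 2 \<theta>"
  have eta: "\<eta> > 0" unfolding \<eta>_def using th by simp
  \<comment> \<open>Removing \<open>x\<close> and \<open>z\<close> uncovers at most two tiles of
    \<open>l * Q\<close> vertices.\<close>
  define K where "K = 2 * (l * Q)"
  define good where "good A E x z P P' \<longleftrightarrow> E \<in> Kf l A \<and> tiled E l Q (\<rho> * card A) A \<and>
      blow E (nb E x - {z}) ?k q P \<and> blow E (nb E z - {x}) ?k q P' \<and>
      (1/l - d) * card A \<le> card (link E A ?k P) \<and> (1/l - d) * card A \<le> card (link E A ?k P') \<and>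
      card (link E A ?k P \<union> link E A ?k P') < (2/l - d') * card A \<and>
      \<not> (\<exists>f. tup E (nb E x \<inter> nb E z) ?k f)" for A :: "'a set" and E x z P P'
  let ?I = "\<lambda>A :: 'a set. {(x, z). x \<in> A \<and> z \<in> A \<and> x \<noteq> z} \<times> BP A ?k q \<times> BP A ?k q"
  have "negligible l (\<lambda>A :: 'a set. {E. \<exists>x\<in>A. \<exists>z\<in>A. x \<noteq> z \<and> (\<exists>P P'. good A E x z P P')})"
  proof (rule negligibleI[where I = ?I and s = 2 and p = "2 + (?k * q + ?k * q)"
      and \<delta> = "\<eta> * d' / 8" and D = "4 + \<eta> * (2 + real K)"
      and Z = "\<lambda>A ((x, z), P, P'). {E. good A E x z P P'}"])
    fix A :: "'a set" assume A: "finite A"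
    let ?n = "real (card A)"
    let ?Z = "\<lambda>((x, z), P, P'). {E. good A E x z P P'}"
    have sub: "{(x, z). x \<in> A \<and> z \<in> A \<and> x \<noteq> z} \<subseteq> A \<times> A" by auto
    have fin2: "finite {(x, z). x \<in> A \<and> z \<in> A \<and> x \<noteq> z}" by (rule finite_subset[OF sub]) (use A in simp)
    show "finite (?I A)" using BP_finite[OF A] fin2 by simp
    have "card {(x, z). x \<in> A \<and> z \<in> A \<and> x \<noteq> z} \<le> card A ^ 2"
      using card_mono[OF _ sub] A by (simp add: card_cartesian_product power2_eq_square)
    then show "card (?I A) \<le> card A ^ (2 + (?k * q + ?k * q))"
      unfolding card_cartesian_product power_add using BP_card[OF A] by (intro mult_le_mono)
    show "{E. \<exists>x\<in>A. \<exists>z\<in>A. x \<noteq> z \<and> (\<exists>P P'. good A E x z P P')} \<subseteq> (\<Union>i\<in>?I A. ?Z i)"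
    proof clarify
      fix E x z P P' assume xz: "x \<in> A" "z \<in> A" "x \<noteq> z" and a: "good A E x z P P'"
      have g: "E \<in> gr A" using a Kf_gr by (auto simp: good_def)
      have P: "blow E (nb E x - {z}) ?k q P" "blow E (nb E z - {x}) ?k q P'" using a by (auto simp: good_def)
      have "nb E x - {z} \<subseteq> A" "nb E z - {x} \<subseteq> A" using nb_subset[OF g] by blast+
      then have b: "blow E A ?k q P" "blow E A ?k q P'" using P blow_mono by blast+
      have lk: "link E A ?k (restrict P {..<?k}) = link E A ?k P" "link E A ?k (restrict P' {..<?k}) = link E A ?k P'"
        by (rule link_cong, simp)+
      have "good A E x z (restrict P {..<?k}) (restrict P' {..<?k})"
        using a blow_BP[OF P(1)] blow_BP[OF P(2)] unfolding good_def lk by blast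
      then have "E \<in> ?Z ((x, z), restrict P {..<?k}, restrict P' {..<?k})" by simp
      moreover have "((x, z), restrict P {..<?k}, restrict P' {..<?k}) \<in> ?I A"
        using xz blow_BP[OF b(1)] blow_BP[OF b(2)] by simp
      ultimately show "E \<in> (\<Union>i\<in>?I A. ?Z i)" by (rule UN_I[rotated])
    qed
    fix i assume "i \<in> ?I A"
    then obtain x z P P' where i: "i = ((x, z), P, P')" and xz: "x \<in> A" "z \<in> A" "x \<noteq> z" by auto
    have Zg: "{E. good A E x z P P'} \<subseteq> Kf l A" by (auto simp: good_def)
    show "finite (?Z i)" unfolding i using finite_subset[OF Zg Kf_finite[OF A]] by simp
    let ?S = "{x, z}"
    have S: "?S \<subseteq> A" "card ?S = 2" using xz by auto
    let ?b = "\<rho> * ?n + real K"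
    define W where "W H = link H (A - ?S) ?k P" for H
    define W' where "W' H = link H (A - ?S) ?k P'" for H
    define \<Phi> where "\<Phi> H = (if tiled H l 1 ?b (A - ?S) \<and> (1/l - d) * ?n - 2 \<le> card (W H) \<and> (1/l - d) * ?n - 2 \<le> card (W' H)
       \<and> card (W H \<union> W' H) \<le> (2/l - d') * ?n then free_pairs H ?k (W H) (W' H) (A - ?S) else {})" for H
    have WA: "W H \<subseteq> A - ?S" "W' H \<subseteq> A - ?S" for H unfolding W_def W'_def by (rule link_subset)+
    have cA: "real (card (A - ?S)) = ?n - 2"
      using S A card_mono[OF A S(1)] by (simp add: card_Diff_subset of_nat_diff)
    have "real (card {E. good A E x z P P'}) \<le> card (Kf l (A - ?S)) * (2 ^ (card ?S)^2 *
        2 powr (2 * ((dens l + d) * ?n) - \<eta> * (d' / 4 * ?n - (2 + K))))"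
    proof (rule card_removal[OF A S(1) _ Kf_finite, where g = "\<lambda>E. (nb E x - ?S, nb E z - ?S)" and \<Phi> = \<Phi>])
      show "{E. good A E x z P P'} \<subseteq> gr A" using Zg Kf_gr by blast
      show "finite (\<Phi> H)" for H using A by (simp add: \<Phi>_def free_pairs_finite)
      fix H assume H: "H \<in> Kf l (A - ?S)"
      show "real (card (\<Phi> H)) \<le> 2 powr (2 * ((dens l + d) * ?n) - \<eta> * (d' / 4 * ?n - (2 + K)))"
      proof (cases "tiled H l 1 ?b (A - ?S) \<and> (1/l - d) * ?n - 2 \<le> card (W H) \<and> (1/l - d) * ?n - 2 \<le> card (W' H)
         \<and> card (W H \<union> W' H) \<le> (2/l - d') * ?n")
        case True
        have c: "2 ^ card (A - ?S - V) \<le> 2 powr ((dens l + d) * ?n)"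
          if "V \<subseteq> A - ?S" "(1/l - d) * ?n - 2 \<le> card V" for V
        proof -
          have "real (card (A - ?S - V)) = ?n - 2 - card V"
            using card_Diff_subset[OF finite_subset[OF that(1)] that(1)] card_mono[OF _ that(1)] A cA
            by (simp add: of_nat_diff)
          also have "\<dots> \<le> ?n - (1/l - d) * ?n" using that(2) by linarith
          also have "\<dots> = (dens l + d) * ?n" using l by (simp add: dens_eq algebra_simps)
          finally show ?thesis unfolding two_pow_powr by simp
        qed
        have "real (card (free_pairs H ?k (W H) (W' H) (A - ?S)))
          \<le> (2 ^ card (A - ?S - W H) * 2 ^ card (A - ?S - W' H)) * \<theta> powr ((card (A - ?S) - ?b) / l - card ((A - ?S) \<inter> (W H \<union> W' H)) / 2)"
          by (rule card_tiled_free_pairs[OF Kf_gr[OF H] l \<theta>_def]) (use True A in auto)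
        also have "\<dots> \<le> (2 powr ((dens l + d) * ?n) * 2 powr ((dens l + d) * ?n)) * \<theta> powr (d' / 4 * ?n - (2 + K))"
        proof (intro mult_mono c WA powr_mono')
          have "(A - ?S) \<inter> (W H \<union> W' H) = W H \<union> W' H" using WA[of H] by blast
          then have u: "real (card ((A - ?S) \<inter> (W H \<union> W' H))) \<le> (2/l - d') * ?n" using True by simp
          show "d' / 4 * ?n - (2 + K) \<le> (card (A - ?S) - ?b) / l - card ((A - ?S) \<inter> (W H \<union> W' H)) / 2"
            unfolding cA of_nat_add of_nat_numeral by (rule overlap_exponent[where \<rho> = \<rho>]) (use l \<rho> u in auto)
        qed (use True th in auto)
        also have "\<theta> powr (d' / 4 * ?n - (2 + K)) = 2 powr (- \<eta> * (d' / 4 * ?n - (2 + K)))"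
          unfolding \<eta>_def using th by (simp add: powr_powr[symmetric])
        finally show ?thesis using True unfolding \<Phi>_def by (simp add: algebra_simps flip: powr_add)
      next
        case False then have "\<Phi> H = {}" unfolding \<Phi>_def by presburger
        then show ?thesis by simp
      qed
    next
      fix E assume "E \<in> {E. good A E x z P P'}"
      then have a: "good A E x z P P'" by simp
      have E: "E \<in> Kf l A" and t: "tiled E l Q (\<rho> * card A) A" and b: "blow E (nb E x - {z}) ?k q P" "blow E (nb E z - {x}) ?k q P'"
        and w: "(1/l - d) * ?n \<le> card (link E A ?k P)" "(1/l - d) * ?n \<le> card (link E A ?k P')"
        and u: "card (link E A ?k P \<union> link E A ?k P') < (2/l - d') * ?n"
        and no: "\<not> (\<exists>f. tup E (nb E x \<inter> nb E z) ?k f)" using a by (auto simp: good_def)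
      let ?H = "res (A - ?S) E"
      show "?H \<in> Kf l (A - ?S)" using E Kf_res by blast
      have nx: "nb E x \<subseteq> A - {x}" "nb E z \<subseteq> A - {z}" using nb_subset[OF Kf_gr[OF E]] by blast+
      have "P i \<subseteq> A - ?S" "P' i \<subseteq> A - ?S" if "i < ?k" for i
        using blow_part[OF b(1) that] blow_part[OF b(2) that] nx by auto
      then have W: "W ?H = link E A ?k P - ?S" "W' ?H = link E A ?k P' - ?S"
        unfolding W_def W'_def by (simp_all add: link_res)
      have cm: "real (card V) - 2 \<le> card (V - ?S)" for V :: "'a set"
        using diff_card_le_card_Diff[of ?S V] S(2) by simp
      have fl: "finite (link E A ?k P \<union> link E A ?k P')" using finite_subset[OF link_subset A] by blast
      have "card (W ?H \<union> W' ?H) \<le> card (link E A ?k P \<union> link E A ?k P')"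
        unfolding W by (rule card_mono[OF fl]) blast
      then have u': "real (card (W ?H \<union> W' ?H)) \<le> (2/l - d') * ?n" using u by linarith
      have w': "(1/l - d) * ?n - 2 \<le> card (W ?H)" "(1/l - d) * ?n - 2 \<le> card (W' ?H)"
        using cm[of "link E A ?k P"] cm[of "link E A ?k P'"] w unfolding W by linarith+
      have "tiled E l Q (\<rho> * card A + real (2 * (l * Q))) (A - ?S)"
        by (rule tiled_remove[OF Kf_gr[OF E] t A]) (use S in auto)
      then have "tiled E l 1 ?b (A - ?S)" using tiled_split[OF Kf_gr[OF E]] unfolding K_def by blast
      then have t': "tiled ?H l 1 ?b (A - ?S)" by (simp add: tiled_res_iff)
      have "nb E x - ?S \<subseteq> A - ?S - W ?H" "nb E z - ?S \<subseteq> A - ?S - W' ?H"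
      proof -
        have "blow E (nb E x) ?k q P" "blow E (nb E z) ?k q P'" using b blow_mono by blast+
        then have "nb E x \<inter> link E A ?k P = {}" "nb E z \<inter> link E A ?k P' = {}"
          using nb_link_disjoint[OF E] l by auto
        then show "nb E x - ?S \<subseteq> A - ?S - W ?H" "nb E z - ?S \<subseteq> A - ?S - W' ?H"
          unfolding W using nx by blast+
      qed
      moreover have "\<not> tup ?H ((nb E x - ?S) \<inter> (nb E z - ?S)) ?k f" for f
      proof
        assume "tup ?H ((nb E x - ?S) \<inter> (nb E z - ?S)) ?k f"
        then have "tup E ((nb E x - ?S) \<inter> (nb E z - ?S)) ?k f"
          by (subst (asm) tup_res) (use nx in auto)
        then show False using no tup_mono[of E _ ?k f "nb E x \<inter> nb E z"] by blast
      qed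
      ultimately have "(nb E x - ?S, nb E z - ?S) \<in> free_pairs ?H ?k (W ?H) (W' ?H) (A - ?S)"
        unfolding free_pairs_def by blast
      then show "(nb E x - ?S, nb E z - ?S) \<in> \<Phi> ?H" using t' w' u' unfolding \<Phi>_def by presburger
    next
      fix E E' assume a: "E \<in> {E. good A E x z P P'}" "E' \<in> {E. good A E x z P P'}"
        "res (A - ?S) E = res (A - ?S) E'" "res ?S E = res ?S E'" "(nb E x - ?S, nb E z - ?S) = (nb E' x - ?S, nb E' z - ?S)"
      have "E \<in> gr A" "E' \<in> gr A" using a(1,2) Zg Kf_gr by blast+
      then show "E = E'" by (rule determined_by_nbhds[where S = ?S]) (use a(3-5) xz in auto)
    qed (use A in auto)
    also have "\<dots> \<le> card (Kf l (A - ?S)) * 2 powr (dens l * real 2 * ?n - \<eta> * d' / 8 * ?n + (4 + \<eta> * (2 + real K)))"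
    proof (rule mult_left_mono)
      have "2 * d \<le> \<eta> * d' / 8" using small unfolding \<eta>_def \<theta>_def by simp
      then have "2 * d * ?n \<le> \<eta> * d' / 8 * ?n" by (rule mult_right_mono) simp
      then have le: "2 * ((dens l + d) * ?n) - \<eta> * (d' / 4 * ?n - (2 + K)) \<le> dens l * real 2 * ?n - \<eta> * d' / 8 * ?n + \<eta> * (2 + real K)"
        by (simp add: algebra_simps)
      have "2 ^ (card ?S)^2 * 2 powr (2 * ((dens l + d) * ?n) - \<eta> * (d' / 4 * ?n - (2 + K)))
        = 2 powr (4 + (2 * ((dens l + d) * ?n) - \<eta> * (d' / 4 * ?n - (2 + K))))"
        unfolding S(2) powr_add by simp
      also have "\<dots> \<le> 2 powr (dens l * real 2 * ?n - \<eta> * d' / 8 * ?n + (4 + \<eta> * (2 + real K)))"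
        using le by simp
      finally show "2 ^ (card ?S)^2 * 2 powr (2 * ((dens l + d) * ?n) - \<eta> * (d' / 4 * ?n - (2 + K))) \<le> \<dots>" .
    qed simp
    finally show "\<exists>S\<subseteq>A. card S = 2 \<and> real (card (?Z i)) \<le> card (Kf l (A - S)) *
       2 powr (dens l * real 2 * ?n - \<eta> * d' / 8 * ?n + (4 + \<eta> * (2 + real K)))"
      unfolding i using S by (intro exI[where x = ?S]) simp
  qed (use l eta d in auto)
  moreover have "{E. \<exists>x\<in>A. \<exists>z\<in>A. x \<noteq> z \<and> (\<exists>P P'. good A E x z P P')} = {E \<in> Kf l A. tiled E l Q (\<rho> * card A) A \<and>
    (\<exists>x\<in>A. \<exists>z\<in>A. x \<noteq> z \<and> (\<exists>P P'. blow E (nb E x - {z}) (l - 1) q P \<and> blow E (nb E z - {x}) (l - 1) q P' \<and>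
      (1/l - d) * card A \<le> card (link E A (l - 1) P) \<and> (1/l - d) * card A \<le> card (link E A (l - 1) P') \<and>
      card (link E A (l - 1) P \<union> link E A (l - 1) P') < (2/l - d') * card A \<and>
      \<not> (\<exists>f. tup E (nb E x \<inter> nb E z) (l - 1) f)))}" for A :: "'a set"
    unfolding good_def by blast
  ultimately show ?thesis by simp
qed

section \<open>Typical graphs are colourable\<close>

text \<open>A crude Bonferroni inequality, with \<open>m^2\<close> in place of the number of
  pairs.\<close>

lemma card_Union_almost_disjoint:
  fixes a b :: real and m :: nat
  assumes "\<And>i. i < m \<Longrightarrow> finite (V i) \<and> a \<le> card (V i)" "\<And>i j. i < m \<Longrightarrow> j < m \<Longrightarrow> i \<noteq> j \<Longrightarrow> card (V i \<inter> V j) \<le> b" "b \<ge> 0"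
  shows "real m * a - (real m)^2 * b \<le> card (\<Union>i<m. V i)"
  using assms(1,2)
proof (induction m)
  case (Suc m)
  let ?U = "\<Union>i<m. V i"
  have fU: "finite ?U" using Suc.prems(1) by auto
  have fV: "finite (V m)" using Suc.prems(1) by auto
  have "real m * a - (real m)^2 * b \<le> card ?U" using Suc.prems by (intro Suc.IH) auto
  moreover have "card (?U \<union> V m) + card (?U \<inter> V m) = card ?U + card (V m)"
    using card_Un_Int[OF fU fV] by simp
  moreover have "real (card (?U \<inter> V m)) \<le> m * b"
  proof -
    have "?U \<inter> V m = (\<Union>i<m. V i \<inter> V m)" by auto
    then have "real (card (?U \<inter> V m)) \<le> card {..<m} * b"
      by (simp only:) (rule card_UN_bound[where Z = "\<lambda>i. V i \<inter> V m"], use Suc.prems in auto)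
    then show ?thesis by simp
  qed
  moreover have "(\<Union>i<Suc m. V i) = ?U \<union> V m" by (auto simp: lessThan_Suc)
  moreover have "a \<le> card (V m)" using Suc.prems(1) by auto
  ultimately have "real m * a - (real m)^2 * b + a - m * b \<le> card (\<Union>i<Suc m. V i)" by (simp add: algebra_simps)
  moreover have "real (Suc m) * a - (real (Suc m))^2 * b \<le> m * a - (real m)^2 * b + a - m * b"
    using assms(3) by (simp add: power2_eq_square algebra_simps)
  ultimately show ?case by linarith
qed simp

text \<open>The properties that survive outside the negligible families. The parts in
  \<open>rich\<close> have size \<open>Suc q\<close>, so that any one vertex can be deleted and
  parts of size \<open>q\<close> remain. The bound \<open>small\<close> is what makes
  \<open>sim\<close> transitive with at most \<open>l\<close> classes.\<close>

locale typical =
  fixes l :: nat and A :: "'a set" and E :: "'a \<Rightarrow> 'a \<Rightarrow> bool" and q :: nat and d d' :: real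
  assumes l: "l \<ge> 2" and A: "finite A" and E: "E \<in> Kf l A" and d: "d > 0" "d' > 0"
    and small: "4 * l * d + 4 * l^2 * (6 * d + d') < 1 / l"
    and rich: "\<And>x. x \<in> A \<Longrightarrow> \<exists>P. blow E (nb E x) (l - 1) (Suc q) P"
    and link_lower: "\<And>P. blow E A (l - 1) q P \<Longrightarrow> (1/l - d) * card A \<le> card (link E A (l - 1) P)"
    and link_upper: "\<And>x P P'. x \<in> A \<Longrightarrow> blow E (nb E x) (l - 1) q P \<Longrightarrow> blow E (nb E x) (l - 1) q P' \<Longrightarrow>
      card (link E A (l - 1) P \<union> link E A (l - 1) P') \<le> (1/l + d) * card A"
    and common: "\<And>x z P P'. x \<in> A \<Longrightarrow> z \<in> A \<Longrightarrow> x \<noteq> z \<Longrightarrow> blow E (nb E x - {z}) (l - 1) q P \<Longrightarrow>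
      blow E (nb E z - {x}) (l - 1) q P' \<Longrightarrow> card (link E A (l - 1) P \<union> link E A (l - 1) P') < (2/l - d') * card A \<Longrightarrow>
      \<exists>f. tup E (nb E x \<inter> nb E z) (l - 1) f"
begin

abbreviation "n \<equiv> real (card A)"
abbreviation "lk \<equiv> link E A (l - 1)"

lemma g: "E \<in> gr A" using E by (rule Kf_gr)

lemma nbA: "nb E x \<subseteq> A" using nb_subset[OF g] by blast

lemma lk_finite: "finite (lk P)" using finite_subset[OF link_subset A] .

text \<open>A blow-up in the neighbourhood of \<open>x\<close> that avoids \<open>z\<close>, as
  \<open>common\<close> demands. Taking \<open>z = x\<close> imposes no condition, since
  \<open>x\<close> is not adjacent to itself.\<close>

definition Q :: "'a \<Rightarrow> 'a \<Rightarrow> nat \<Rightarrow> 'a set" where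
  "Q x z = (SOME P. blow E (nb E x - {z}) (l - 1) q P)"

lemma Q: assumes "x \<in> A" shows "blow E (nb E x - {z}) (l - 1) q (Q x z)"
proof -
  obtain P where P: "blow E (nb E x) (l - 1) (Suc q) P" using rich[OF assms] by blast
  have "\<exists>B. B \<subseteq> P i - {z} \<and> card B = q" if "i < l - 1" for i
  proof -
    have "card (P i) = Suc q" using P that by (simp add: blow_def)
    then have "q \<le> card (P i - {z})" by (simp add: card_Diff_singleton_if)
    from obtain_subset_with_card_n[OF this] show ?thesis by metis
  qed
  then obtain B where B: "\<And>i. i < l - 1 \<Longrightarrow> B i \<subseteq> P i - {z}" "\<And>i. i < l - 1 \<Longrightarrow> card (B i) = q" by metis
  have "blow E (nb E x) (l - 1) q B" by (rule blow_shrink[OF P]) (use B in auto)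
  moreover have "B i \<subseteq> nb E x - {z}" if "i < l - 1" for i using B(1)[OF that] blow_part[OF P that] by blast
  ultimately have "blow E (nb E x - {z}) (l - 1) q B" unfolding blow_def by simp
  then show ?thesis unfolding Q_def by (rule someI[where P = "blow E (nb E x - {z}) (l - 1) q"])
qed

lemma Q': assumes "x \<in> A" shows "blow E (nb E x) (l - 1) q (Q x z)" "blow E A (l - 1) q (Q x z)"
proof -
  show "blow E (nb E x) (l - 1) q (Q x z)" using blow_mono[OF Q[OF assms]] by blast
  then show "blow E A (l - 1) q (Q x z)" using blow_mono nbA by blast
qed

definition V :: "'a \<Rightarrow> 'a set" where "V x = lk (Q x x)"

lemma V_finite: "finite (V x)" unfolding V_def by (rule lk_finite)

lemma V_lower: "x \<in> A \<Longrightarrow> (1/l - d) * n \<le> card (V x)"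
  unfolding V_def using link_lower Q' by blast

lemma V_upper: "x \<in> A \<Longrightarrow> card (V x) \<le> (1/l + d) * n"
  unfolding V_def using link_upper[of x "Q x x" "Q x x"] Q' by simp

text \<open>Both links have at least \<open>(1/l - d) * n\<close> elements and their union at most
  \<open>(1/l + d) * n\<close>. Hence the choice of the blow-up hardly affects the link.\<close>

lemma V_diff: assumes "x \<in> A" shows "card (V x - lk (Q x z)) \<le> 2 * d * n"
proof -
  have "V x \<union> lk (Q x z) = lk (Q x z) \<union> (V x - lk (Q x z))" by auto
  then have "card (V x \<union> lk (Q x z)) = card (lk (Q x z)) + card (V x - lk (Q x z))"
    using lk_finite V_finite by (metis Diff_disjoint card_Un_disjoint finite_Diff)
  moreover have "card (V x \<union> lk (Q x z)) \<le> (1/l + d) * n"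
    unfolding V_def using link_upper[OF assms] Q'[OF assms] by blast
  moreover have "(1/l - d) * n \<le> card (lk (Q x z))" using link_lower Q'[OF assms] by blast
  ultimately show ?thesis by (simp add: algebra_simps)
qed

text \<open>Vertices that turn out to lie in the same colour class: \<open>V x\<close> and \<open>V z\<close> are almost equal if \<open>sim x z\<close>
  and almost disjoint otherwise.\<close>
definition sim :: "'a \<Rightarrow> 'a \<Rightarrow> bool" where
  "sim x z \<longleftrightarrow> (\<exists>f. tup E (nb E x \<inter> nb E z) (l - 1) f)"

lemma sim_sym: "sim x z \<Longrightarrow> sim z x" by (simp add: sim_def Int_commute)

abbreviation "\<beta> \<equiv> 6 * d + d'"

text \<open>By \<open>common\<close> the links used for \<open>x\<close> and \<open>z\<close> have a
  union of at least \<open>(2/l - d') * n\<close> vertices, while each has at most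
  \<open>(1/l + d) * n\<close>, so they overlap in at most \<open>(2 * d + d') * n\<close>.
  Replacing them by \<open>V x\<close> and \<open>V z\<close> costs \<open>2 * d * n\<close> each,
  which explains \<open>\<beta>\<close>.\<close>

lemma not_sim:
  assumes "x \<in> A" "z \<in> A" "x \<noteq> z" "\<not> sim x z"
  shows "card (V x \<inter> V z) \<le> \<beta> * n"
proof -
  let ?L = "lk (Q x z)" and ?M = "lk (Q z x)"
  have "\<not> card (?L \<union> ?M) < (2/l - d') * n" using common[OF assms(1-3) Q[OF assms(1)] Q[OF assms(2)]] assms(4) by (auto simp: sim_def)
  moreover have "card (?L \<union> ?M) + card (?L \<inter> ?M) = card ?L + card ?M" using card_Un_Int[OF lk_finite lk_finite] by simp
  moreover have "card ?L \<le> (1/l + d) * n" "card ?M \<le> (1/l + d) * n"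
    using link_upper[OF assms(1) Q'(1)[OF assms(1)] Q'(1)[OF assms(1)], of z z]
      link_upper[OF assms(2) Q'(1)[OF assms(2)] Q'(1)[OF assms(2)], of x x] by auto
  ultimately have 1: "card (?L \<inter> ?M) \<le> 2 * d * n + d' * n" by (simp add: algebra_simps)
  have "V x \<inter> V z \<subseteq> (?L \<inter> ?M) \<union> ((V x - ?L) \<union> (V z - ?M))" by auto
  then have "card (V x \<inter> V z) \<le> card ((?L \<inter> ?M) \<union> ((V x - ?L) \<union> (V z - ?M)))"
    by (rule card_mono[rotated]) (use lk_finite V_finite in auto)
  also have "\<dots> \<le> card (?L \<inter> ?M) + card ((V x - ?L) \<union> (V z - ?M))" by (rule card_Un_le)
  also have "card ((V x - ?L) \<union> (V z - ?M)) \<le> card (V x - ?L) + card (V z - ?M)" by (rule card_Un_le)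
  finally show ?thesis using 1 V_diff[OF assms(1), of z] V_diff[OF assms(2), of x] by (simp add: algebra_simps)
qed

text \<open>A common clique on \<open>l - 1\<close> vertices would extend by both ends of the edge
  to one on \<open>l + 1\<close> vertices.\<close>

lemma adjacent_not_sim: assumes "E x z" shows "\<not> sim x z"
proof
  assume "sim x z"
  then obtain f where f: "tup E (nb E x \<inter> nb E z) (l - 1) f" by (auto simp: sim_def)
  have adj: "E x (f i)" "E z (f i)" if "i < l - 1" for i using f that by (auto simp: tup_def nb_def)
  have xz: "x \<in> A" "z \<in> A" using gr_dom[OF g assms] by auto
  have "tup E A (l - 1) f" using tup_mono[OF f] nbA by blast
  then have "tup E A (Suc (l - 1)) (f(l - 1 := z))" by (rule tup_Suc[OF _ xz(2) g adj(2)])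
  then have "tup E A (Suc (Suc (l - 1))) ((f(l - 1 := z))(Suc (l - 1) := x))"
    by (rule tup_Suc[OF _ xz(1) g]) (use assms adj in \<open>auto simp: less_Suc_eq\<close>)
  then show False using E l by (auto simp: Kf_def)
qed

lemma adjacent_V: assumes "E x z" shows "card (V x \<inter> V z) \<le> \<beta> * n"
  using not_sim adjacent_not_sim[OF assms] gr_dom[OF g assms] gr_irrefl[OF g] assms by metis

lemma beta_nonneg: "0 \<le> \<beta> * n" using d by simp

text \<open>If \<open>R\<close> is a clique witnessing \<open>sim x z\<close>, then both \<open>V x\<close> and \<open>V z\<close> nearly fill the complement of the
  almost disjoint sets \<open>V y\<close> with \<open>y \<in> R\<close>.\<close>
lemma sim_V:
  assumes "x \<in> A" "z \<in> A" "sim x z"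
  shows "(1/l - (l + 1) * d - l^2 * \<beta>) * n \<le> card (V x \<inter> V z)"
proof -
  let ?k = "l - 1"
  obtain f where f: "tup E (nb E x \<inter> nb E z) ?k f" using assms by (auto simp: sim_def)
  have adj: "E x (f i)" "E z (f i)" if "i < ?k" for i using f that by (auto simp: tup_def nb_def)
  have fA: "f i \<in> A" if "i < ?k" for i using gr_dom[OF g adj(1)[OF that]] by blast
  define R where "R = (\<Union>i<?k. V (f i))"
  have fR: "finite R" unfolding R_def using V_finite by auto
  have R: "?k * ((1/l - d) * n) - (real ?k)^2 * (\<beta> * n) \<le> card R" unfolding R_def
  proof (rule card_Union_almost_disjoint[OF _ _ beta_nonneg])
    show "finite (V (f i)) \<and> (1/l - d) * n \<le> card (V (f i))" if "i < ?k" for i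
      using V_finite V_lower[OF fA[OF that]] by blast
    show "card (V (f i) \<inter> V (f j)) \<le> \<beta> * n" if "i < ?k" "j < ?k" "i \<noteq> j" for i j
      by (rule adjacent_V) (use f that in \<open>auto simp: tup_def\<close>)
  qed
  have small_int: "card (V y \<inter> R) \<le> ?k * (\<beta> * n)" if "\<And>i. i < ?k \<Longrightarrow> E y (f i)" for y
  proof -
    have "V y \<inter> R = (\<Union>i<?k. V y \<inter> V (f i))" by (auto simp: R_def)
    then have "real (card (V y \<inter> R)) \<le> card {..<?k} * (\<beta> * n)"
      by (simp only:) (rule card_UN_bound[where Z = "\<lambda>i. V y \<inter> V (f i)"], use V_finite adjacent_V that in auto)
    then show ?thesis by simp
  qed
  have rest: "(1/l - d) * n - ?k * (\<beta> * n) \<le> card (V y - R)" if "y \<in> A" "\<And>i. i < ?k \<Longrightarrow> E y (f i)" for y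
  proof -
    have "card (V y) = card (V y \<inter> R) + card (V y - R)"
      using V_finite by (metis card_Int_Diff)
    then show ?thesis using small_int[OF that(2)] V_lower[OF that(1)] by linarith
  qed
  let ?X = "V x - R" and ?Z = "V z - R"
  have fin: "finite ?X" "finite ?Z" using V_finite by auto
  have "V y \<subseteq> A" for y unfolding V_def by (rule link_subset)
  then have "R \<union> (?X \<union> ?Z) \<subseteq> A" unfolding R_def by blast
  then have "card (R \<union> (?X \<union> ?Z)) \<le> card A" by (rule card_mono[OF A])
  moreover have "card (R \<union> (?X \<union> ?Z)) = card R + card (?X \<union> ?Z)"
    by (rule card_Un_disjoint) (use fR fin in auto)
  moreover have "card (?X \<union> ?Z) + card (?X \<inter> ?Z) = card ?X + card ?Z" using card_Un_Int[OF fin] by simp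
  moreover have "card (?X \<inter> ?Z) \<le> card (V x \<inter> V z)" by (rule card_mono) (use V_finite in auto)
  ultimately have "real (card ?X) + card ?Z + card R - n \<le> card (V x \<inter> V z)" by linarith
  moreover have "2 * ((1/l - d) * n - ?k * (\<beta> * n)) + (?k * ((1/l - d) * n) - (real ?k)^2 * (\<beta> * n)) - n \<le> real (card ?X) + card ?Z + card R - n"
  proof -
    have "(1/l - d) * n - ?k * (\<beta> * n) \<le> card ?X" "(1/l - d) * n - ?k * (\<beta> * n) \<le> card ?Z"
      by (rule rest; use assms adj in blast)+
    moreover have "2 * a + b - n \<le> x + y + r - n" if "a \<le> x" "a \<le> y" "b \<le> r" for a b x y r :: real
      using that by linarith
    ultimately show ?thesis using R by blast
  qed
  \<comment> \<open>The lower bound for a set \<open>V y\<close> is used \<open>l + 1\<close> times,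
    with loss \<open>d\<close> each; the overlaps lose
    \<open>2 * (l - 1) + (l - 1)^2 = l^2 - 1\<close> times \<open>\<beta>\<close>.\<close>
  moreover have "(1/l - (l + 1) * d - l^2 * \<beta>) * n \<le> 2 * ((1/l - d) * n - ?k * (\<beta> * n)) + (?k * ((1/l - d) * n) - (real ?k)^2 * (\<beta> * n)) - n"
  proof -
    have k: "real ?k = real l - 1" using l by (simp add: of_nat_diff)
    have "2 * ((1/l - d) * n - ?k * b) + (?k * ((1/l - d) * n) - (real ?k)^2 * b) - n = 1/l * n - (l + 1) * (d * n) - l^2 * b + b" for b :: real
      unfolding k using l by (simp add: field_simps power2_eq_square)
    from this[of "\<beta> * n"] show ?thesis using beta_nonneg by (simp add: algebra_simps)
  qed
  ultimately show ?thesis by linarith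
qed

lemma sim_refl: "x \<in> A \<Longrightarrow> sim x x"
proof -
  assume x: "x \<in> A"
  obtain P where P: "blow E (nb E x) (l - 1) (Suc q) P" using rich[OF x] by blast
  then have "\<forall>i. \<exists>y. i < l - 1 \<longrightarrow> y \<in> P i" unfolding blow_def by (metis card.empty ex_in_conv nat.distinct(1))
  then obtain f where "\<And>i. i < l - 1 \<Longrightarrow> f i \<in> P i" by metis
  then show "sim x x" using blow_tup[OF P] by (auto simp: sim_def)
qed

lemma small2: "4 * l * d + 4 * l^2 * \<beta> < 1/l" using small by simp

text \<open>Both \<open>V x\<close> and \<open>V z\<close> fill almost all of \<open>V y\<close>, so
  they intersect in about \<open>n / l\<close> vertices, far more than \<open>not_sim\<close> would
  allow.\<close>

lemma sim_trans:
  assumes "x \<in> A" "y \<in> A" "z \<in> A" "sim x y" "sim y z"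
  shows "sim x z"
proof (rule ccontr)
  assume ns: "\<not> sim x z"
  then have xz: "x \<noteq> z" using sim_refl assms by blast
  have n0: "n > 0" using assms(1) A by (auto simp: card_gt_0_iff)
  have "card (V x \<inter> V z) \<le> \<beta> * n" by (rule not_sim[OF assms(1,3) xz ns])
  moreover have "card (V x \<inter> V y) + card (V y \<inter> V z) \<le> card (V y) + card (V x \<inter> V z)"
  proof -
    have "card ((V x \<inter> V y) \<union> (V y \<inter> V z)) + card ((V x \<inter> V y) \<inter> (V y \<inter> V z)) = card (V x \<inter> V y) + card (V y \<inter> V z)"
      by (rule card_Un_Int[symmetric]) (use V_finite in auto)
    moreover have "card ((V x \<inter> V y) \<union> (V y \<inter> V z)) \<le> card (V y)" by (rule card_mono) (use V_finite in auto)
    moreover have "card ((V x \<inter> V y) \<inter> (V y \<inter> V z)) \<le> card (V x \<inter> V z)" by (rule card_mono) (use V_finite in auto)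
    ultimately show ?thesis by linarith
  qed
  ultimately have "2 * ((1/l - (l + 1) * d - l^2 * \<beta>) * n) \<le> (1/l + d) * n + \<beta> * n"
    using sim_V[OF assms(1,2,4)] sim_V[OF assms(2,3,5)] V_upper[OF assms(2)] by linarith
  then have "(2 * (1/l - (l + 1) * d - l^2 * \<beta>)) * n \<le> (1/l + d + \<beta>) * n" by (simp add: algebra_simps)
  then have "2 * (1/l - (l + 1) * d - l^2 * \<beta>) \<le> 1/l + d + \<beta>" by (rule mult_right_le_imp_le[OF _ n0])
  moreover have "d * (2 * l + 3) \<le> d * (4 * l)" using d l by (intro mult_left_mono) auto
  moreover have "\<beta> * (2 * (real l)^2 + 1) \<le> \<beta> * (4 * (real l)^2)"
  proof (rule mult_left_mono)
    have "1 \<le> (real l)^2" using l by simp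
    then show "2 * (real l)^2 + 1 \<le> 4 * (real l)^2" by linarith
  qed (use d in simp)
  ultimately show False using small2 by (simp add: algebra_simps)
qed

text \<open>Otherwise \<open>l + 1\<close> almost disjoint sets of about \<open>n / l\<close>
  vertices each would have to fit into \<open>A\<close>.\<close>

lemma few_classes:
  assumes "T \<subseteq> A" "\<And>x y. x \<in> T \<Longrightarrow> y \<in> T \<Longrightarrow> x \<noteq> y \<Longrightarrow> \<not> sim x y"
  shows "card T \<le> l"
proof (rule ccontr)
  assume "\<not> ?thesis"
  then obtain T' where T': "T' \<subseteq> T" "card T' = Suc l" by (meson not_less_eq_eq obtain_subset_with_card_n)
  have fT: "finite T'" using T' by (metis card.infinite nat.distinct(1))
  from ex_bij_betw_nat_finite[OF fT] obtain h where h: "bij_betw h {..<Suc l} T'" by (auto simp: T' atLeast0LessThan)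
  have hA: "h i \<in> T" if "i < Suc l" for i using h T'(1) that by (auto simp: bij_betw_def)
  have n0: "n > 0" using hA[of 0] assms(1) A by (auto simp: card_gt_0_iff)
  have "(Suc l) * ((1/l - d) * n) - (real (Suc l))^2 * (\<beta> * n) \<le> card (\<Union>i<Suc l. V (h i))"
  proof (rule card_Union_almost_disjoint[OF _ _ beta_nonneg])
    show "finite (V (h i)) \<and> (1/l - d) * n \<le> card (V (h i))" if "i < Suc l" for i
      using V_finite V_lower hA[OF that] assms(1) by blast
    show "card (V (h i) \<inter> V (h j)) \<le> \<beta> * n" if "i < Suc l" "j < Suc l" "i \<noteq> j" for i j
    proof -
      have "h i \<noteq> h j" using h that by (auto simp: bij_betw_def inj_on_def)
      then show ?thesis using not_sim assms hA[OF that(1)] hA[OF that(2)] by blast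
    qed
  qed
  also have "card (\<Union>i<Suc l. V (h i)) \<le> card A"
    by (rule card_mono[OF A]) (simp add: V_def UN_least link_subset)
  finally have "((Suc l) * (1/l - d) - (real (Suc l))^2 * \<beta>) * n \<le> 1 * n" by (simp add: algebra_simps)
  then have "(Suc l) * (1/l - d) - (real (Suc l))^2 * \<beta> \<le> 1" by (rule mult_right_le_imp_le[OF _ n0])
  moreover have "(Suc l) * (1/l - d) = 1 + 1/l - d * (l + 1)" using l by (simp add: field_simps)
  moreover have "d * (l + 1) \<le> d * (4 * l)" using d l by (intro mult_left_mono) auto
  moreover have "\<beta> * (real (Suc l))^2 \<le> \<beta> * (4 * l^2)"
  proof (rule mult_left_mono)
    have "(Suc l)^2 \<le> (2 * l)^2" using l by (intro power_mono) auto
    then have "real ((Suc l)^2) \<le> real ((2 * l)^2)" by (rule of_nat_mono)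
    then show "(real (Suc l))^2 \<le> 4 * l^2" by (simp add: power_mult_distrib)
  qed (use d in simp)
  ultimately show False using small2 by (simp add: algebra_simps)
qed

text \<open>A maximal set of pairwise dissimilar vertices represents the classes of
  \<open>sim\<close>. There are at most \<open>l\<close> of them, and
  \<open>adjacent_not_sim\<close> makes the class of a vertex a proper colour.\<close>

lemma colourable: "E \<in> Col l A"
proof -
  let ?T = "{T. T \<subseteq> A \<and> (\<forall>x\<in>T. \<forall>y\<in>T. x \<noteq> y \<longrightarrow> \<not> sim x y)}"
  have "finite ?T" using A by simp
  moreover have "?T \<noteq> {}" by (auto intro: exI[where x = "{}"])
  ultimately have "\<exists>T\<in>?T. \<forall>T'\<in>?T. T \<subseteq> T' \<longrightarrow> T = T'" by (rule finite_has_maximal)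
  then obtain T where T: "T \<in> ?T" "\<And>T'. T' \<in> ?T \<Longrightarrow> T \<subseteq> T' \<Longrightarrow> T = T'"
    by (elim bexE) simp
  have TA: "T \<subseteq> A" and Tn: "\<And>x y. x \<in> T \<Longrightarrow> y \<in> T \<Longrightarrow> x \<noteq> y \<Longrightarrow> \<not> sim x y" using T(1) by auto
  have cT: "card T \<le> l" by (rule few_classes[OF TA Tn])
  have fT: "finite T" using finite_subset[OF TA A] .
  from ex_bij_betw_finite_nat[OF fT] obtain h where h: "bij_betw h T {0..<card T}" by blast
  have ex: "\<exists>t\<in>T. sim x t" if x: "x \<in> A" for x
  proof (rule ccontr)
    assume n: "\<not> ?thesis"
    then have ns: "\<not> sim x t" "\<not> sim t x" if "t \<in> T" for t using that sim_sym by blast+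
    then have xT: "x \<notin> T" using sim_refl x by blast
    have "\<forall>y\<in>insert x T. \<forall>z\<in>insert x T. y \<noteq> z \<longrightarrow> \<not> sim y z" using ns Tn by simp
    then have "insert x T \<in> ?T" using x TA by blast
    then show False using T(2)[of "insert x T"] xT by blast
  qed
  define r where "r x = (SOME t. t \<in> T \<and> sim x t)" for x
  have r: "r x \<in> T \<and> sim x (r x)" if "x \<in> A" for x
    unfolding r_def using someI_ex[of "\<lambda>t. t \<in> T \<and> sim x t"] ex[OF that] by blast
  have "proper l A E (h \<circ> r)" unfolding proper_def
  proof (intro conjI ballI allI impI)
    fix x assume "x \<in> A"
    then have "h (r x) \<in> {0..<card T}" using r h by (metis bij_betwE)
    then show "(h \<circ> r) x < l" using cT by simp
  next
    fix x y assume xy: "E x y"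
    have A2: "x \<in> A" "y \<in> A" using gr_dom[OF g xy] by auto
    show "(h \<circ> r) x \<noteq> (h \<circ> r) y"
    proof
      assume "(h \<circ> r) x = (h \<circ> r) y"
      then have "r x = r y" using h r A2 by (metis bij_betw_def comp_apply inj_onD)
      then have "sim x y" using sim_trans[of x "r x" y] r[OF A2(1)] r[OF A2(2)] A2 TA sim_sym by (metis subsetD)
      then show False using adjacent_not_sim[OF xy] by blast
    qed
  qed
  then show ?thesis using g by (auto simp: Col_def)
qed

end

lemma negligible_Un:
  assumes "negligible l X" "negligible l Y"
  shows "negligible l (\<lambda>A. X A \<union> Y A)"
proof -
  from assms(1) obtain \<delta>1 D1 where 1: "\<delta>1 > 0" "\<And>C A. C \<ge> 1 \<Longrightarrow> finite A \<Longrightarrow> (\<forall>B. B \<subset> A \<longrightarrow> real (card (Kf l B)) \<le> C * real (card (Col l B))) \<Longrightarrow>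
     real (card (X A)) \<le> C * 2 powr (D1 - \<delta>1 * real (card A)) * real (card (Col l A))" unfolding negligible_def by metis
  from assms(2) obtain \<delta>2 D2 where 2: "\<delta>2 > 0" "\<And>C A. C \<ge> 1 \<Longrightarrow> finite A \<Longrightarrow> (\<forall>B. B \<subset> A \<longrightarrow> real (card (Kf l B)) \<le> C * real (card (Col l B))) \<Longrightarrow>
     real (card (Y A)) \<le> C * 2 powr (D2 - \<delta>2 * real (card A)) * real (card (Col l A))" unfolding negligible_def by metis
  let ?d = "min \<delta>1 \<delta>2" and ?D = "max D1 D2 + 1"
  show ?thesis unfolding negligible_def
  proof (rule exI[where x = ?d], rule conjI, use 1 2 in simp, rule exI[where x = ?D], intro allI impI)
    fix C :: real and A :: "'a set"
    assume C: "C \<ge> 1" and A: "finite A" and IH: "\<forall>B. B \<subset> A \<longrightarrow> real (card (Kf l B)) \<le> C * real (card (Col l B))"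
    let ?n = "real (card A)"
    have e: "D1 - \<delta>1 * ?n \<le> max D1 D2 - ?d * ?n" "D2 - \<delta>2 * ?n \<le> max D1 D2 - ?d * ?n"
      by (auto intro!: diff_mono mult_right_mono)
    have "real (card (X A \<union> Y A)) \<le> card (X A) + card (Y A)" using card_Un_le[of "X A" "Y A"] by linarith
    also have "\<dots> \<le> C * 2 powr (D1 - \<delta>1 * ?n) * card (Col l A) + C * 2 powr (D2 - \<delta>2 * ?n) * card (Col l A)"
      using 1(2)[OF C A IH] 2(2)[OF C A IH] by simp
    also have "\<dots> \<le> C * 2 powr (max D1 D2 - ?d * ?n) * card (Col l A) + C * 2 powr (max D1 D2 - ?d * ?n) * card (Col l A)"
      using e C by (intro add_mono mult_right_mono mult_left_mono powr_mono) auto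
    also have "\<dots> = C * 2 powr (?D - ?d * ?n) * card (Col l A)" by (simp add: powr_add powr_diff)
    finally show "real (card (X A \<union> Y A)) \<le> C * 2 powr (?D - ?d * ?n) * card (Col l A)" .
  qed
qed

lemma negligible_subset:
  assumes "negligible l Y" "\<And>A. finite A \<Longrightarrow> X A \<subseteq> Y A \<and> finite (Y A)"
  shows "negligible l X"
proof -
  from assms(1) obtain \<delta> D where 1: "\<delta> > 0" "\<And>C A. C \<ge> 1 \<Longrightarrow> finite A \<Longrightarrow> (\<forall>B. B \<subset> A \<longrightarrow> real (card (Kf l B)) \<le> C * real (card (Col l B))) \<Longrightarrow>
     real (card (Y A)) \<le> C * 2 powr (D - \<delta> * real (card A)) * real (card (Col l A))" unfolding negligible_def by metis
  have "real (card (X A)) \<le> real (card (Y A))" if "finite A" for A using assms(2)[OF that] card_mono by (intro of_nat_mono) blast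
  then show ?thesis unfolding negligible_def using 1 by (meson order.trans)
qed

lemma negligible_not_colourable:
  assumes l: "l \<ge> 2"
  shows "negligible l (\<lambda>A :: 'a set. Kf l A - Col l A)"
proof -
  \<comment> \<open>The constants are fixed in the order \<open>d'\<close>, \<open>d\<close>,
    \<open>q\<close>, \<open>\<rho>\<close>, \<open>Q\<close>. The cubes serve \<open>small\<close>:
    \<open>4 * l^2 * d'\<close> equals \<open>1 / 4 * (1 / l)\<close>, and the terms with
    \<open>d\<close> add up to at most \<open>28 / 128 * (1 / l)\<close>.\<close>
  define d' :: real where "d' = 1 / (16 * l^3)"
  define \<eta> where "\<eta> = - log 2 (1 - (1/4) ^ (l - 1) :: real)"
  have eta: "\<eta> > 0" unfolding \<eta>_def using l by (simp add: power_less_one_iff)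
  \<comment> \<open>The second bound makes the error \<open>d\<close> in the size of links small
    against the gain per tile from overlapping links.\<close>
  define d where "d = min (1 / (128 * l^3)) (\<eta> * d' / 16)"
  have d': "d' > 0" using l by (simp add: d'_def)
  have d: "d > 0" using l eta d' by (simp add: d_def)
  have small: "4 * l * d + 4 * l^2 * (6 * d + d') < 1 / l"
  proof -
    have "d \<le> 1 / (128 * l^3)" by (simp add: d_def)
    then have "(4 * l + 24 * l^2) * d \<le> (4 * l + 24 * l^2) * (1 / (128 * l^3))" by (intro mult_left_mono) auto
    also have "\<dots> \<le> 28 * l^2 * (1 / (128 * l^3))"
      using l by (intro mult_right_mono) (auto simp: power2_eq_square)
    also have "\<dots> = 28 / 128 * (1 / l)" using l by (simp add: power2_eq_square power3_eq_cube)
    finally have "(4 * l + 24 * l^2) * d \<le> 28 / 128 * (1 / l)" .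
    moreover have "4 * l^2 * d' = 1 / 4 * (1 / l)" using l by (simp add: d'_def power2_eq_square power3_eq_cube)
    moreover have "1 / real l > 0" using l by simp
    ultimately have "(4 * l + 24 * l^2) * d + 4 * l^2 * d' < 1 / l" by linarith
    then show ?thesis by (simp add: algebra_simps)
  qed
  obtain q0 where q0: "\<And>q. q \<ge> q0 \<Longrightarrow> 2 * real (l - 1) * (real q + 1) ^ 1 \<le> 2 powr (d / 2 * q)"
    using poly_le_powr[of "d / 2" "2 * real (l - 1)" 1] d by auto
  define q where "q = max q0 1"
  have q: "q \<ge> q0" "q \<ge> 1" by (auto simp: q_def)
  \<comment> \<open>The first bound serves \<open>negligible_overlapping_links\<close>, the second
    \<open>negligible_poor_nbhd\<close>.\<close>
  define \<rho> where "\<rho> = min (d' / 4) (1 / (4 * l))"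
  have rho: "\<rho> > 0" "\<rho> \<le> d' / 4" "\<rho> \<le> 1 / (4 * l)" using d' l by (auto simp: \<rho>_def)
  obtain Q1 where Q1: "\<And>Q. Q \<ge> Q1 \<Longrightarrow> real (l * l) * (real Q + 1) ^ (2 * Suc q) \<le> 2 powr (1/4 * Q)"
    using poly_le_powr[of "1/4" "real (l * l)" "2 * Suc q"] by auto
  obtain Q2 where Q2: "\<And>Q. Q \<ge> Q2 \<Longrightarrow> negligible l (\<lambda>A :: 'a set. {E \<in> Kf l A. \<not> tiled E l Q (\<rho> * card A) A})"
    using negligible_untiled[OF l rho(1), where 'a = 'a] by blast
  define Q where "Q = max Q1 Q2"
  have Q: "Q \<ge> Q1" "Q \<ge> Q2" by (auto simp: Q_def)
  \<comment> \<open>The fraction \<open>(l - 2) / l\<close> comes from the two nearly missed parts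
    of a tile, the rest from the polynomial factor in \<open>Q\<close>. With
    \<open>\<rho> \<le> 1 / (4 * l)\<close> the sum \<open>\<rho> + \<gamma>\<close> stays below
    \<open>(l - 1) / l = dens l\<close>.\<close>
  define \<gamma> where "\<gamma> = (real l - 2) / l + 1 / (4 * l)"
  let ?T = "\<lambda>A :: 'a set. {E \<in> Kf l A. \<not> tiled E l Q (\<rho> * card A) A}"
  let ?N = "\<lambda>A :: 'a set. {E \<in> Kf l A. tiled E l Q (\<rho> * card A) A \<and> (\<exists>x\<in>A. \<not> (\<exists>P. blow E (nb E x) (l - 1) (Suc q) P))}"
  let ?L = "\<lambda>A :: 'a set. {E \<in> Kf l A. \<exists>P. blow E A (l - 1) q P \<and>
    real (card (link E A (l - 1) P)) < (1/l - d) * card A}"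
  let ?U = "\<lambda>A :: 'a set. {E \<in> Kf l A. \<exists>x\<in>A. \<exists>P P'. blow E (nb E x) (l - 1) q P \<and> blow E (nb E x) (l - 1) q P' \<and>
    (1/l + d) * card A < real (card (link E A (l - 1) P \<union> link E A (l - 1) P'))}"
  let ?O = "\<lambda>A :: 'a set. {E \<in> Kf l A. tiled E l Q (\<rho> * card A) A \<and>
    (\<exists>x\<in>A. \<exists>z\<in>A. x \<noteq> z \<and> (\<exists>P P'. blow E (nb E x - {z}) (l - 1) q P \<and> blow E (nb E z - {x}) (l - 1) q P' \<and>
      (1/l - d) * card A \<le> card (link E A (l - 1) P) \<and> (1/l - d) * card A \<le> card (link E A (l - 1) P') \<and>
      card (link E A (l - 1) P \<union> link E A (l - 1) P') < (2/l - d') * card A \<and>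
      \<not> (\<exists>f. tup E (nb E x \<inter> nb E z) (l - 1) f)))}"
  have T: "negligible l ?T" by (rule Q2[OF Q(2)])
  have N: "negligible l ?N"
  proof (rule negligible_poor_nbhd)
    show "\<gamma> \<ge> 0" unfolding \<gamma>_def using l by simp
    have "\<rho> + \<gamma> \<le> 1 / (4 * l) + ((real l - 2) / l + 1 / (4 * l))" using rho(3) by (simp add: \<gamma>_def)
    also have "\<dots> < dens l" using l by (simp add: dens_def field_simps)
    finally show "\<rho> + \<gamma> < dens l" .
    have "real l * real l * ((real Q + 1) ^ (2 * Suc q) * 2 ^ ((l - 2) * Q)) = (real (l * l) * (real Q + 1) ^ (2 * Suc q)) * 2 ^ ((l - 2) * Q)"
      by simp
    also have "\<dots> \<le> 2 powr (1/4 * Q) * 2 ^ ((l - 2) * Q)" by (rule mult_right_mono[OF Q1[OF Q(1)]]) simp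
    also have "\<dots> = 2 powr (1/4 * Q + real ((l - 2) * Q))" by (simp only: powr_add two_pow_powr)
    also have "1/4 * Q + real ((l - 2) * Q) = \<gamma> * (real l * real Q)" unfolding \<gamma>_def using l by (simp add: of_nat_diff field_simps)
    finally show "real l * real l * ((real Q + 1) ^ (2 * Suc q) * 2 ^ ((l - 2) * Q)) \<le> 2 powr (\<gamma> * (real l * real Q))" .
  qed (use l in simp)
  have L: "negligible l ?L"
    by (rule negligible_small_link[OF l q(2) d]) (use q0[OF q(1)] in simp)
  have U: "negligible l ?U" by (rule negligible_large_link[OF l d])
  have O: "negligible l ?O"
  proof (rule negligible_overlapping_links[OF l _ rho(2) d d'])
    have "d \<le> \<eta> * d' / 16" by (simp add: d_def)
    then show "2 * d \<le> - log 2 (1 - (1/4) ^ (l - 1)) * d' / 8" unfolding \<eta>_def by simp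
  qed (use rho in simp)
  have "negligible l (\<lambda>A. ?T A \<union> (?N A \<union> (?L A \<union> (?U A \<union> ?O A))))"
    by (intro negligible_Un T N L U O)
  then show ?thesis
  proof (rule negligible_subset)
    fix A :: "'a set" assume A: "finite A"
    have "E \<in> Col l A" if E: "E \<in> Kf l A" and no: "E \<notin> ?T A \<union> (?N A \<union> (?L A \<union> (?U A \<union> ?O A)))" for E
    proof -
      have t: "tiled E l Q (\<rho> * card A) A" using no E by blast
      have low: "(1/l - d) * card A \<le> card (link E A (l - 1) P)" if "blow E A (l - 1) q P" for P
        using no E that by (force simp: not_less)
      interpret typical l A E q d d'
      proof
        show "\<exists>P. blow E (nb E x) (l - 1) (Suc q) P" if "x \<in> A" for x using no E that t by blast
        show "card (link E A (l - 1) P \<union> link E A (l - 1) P') \<le> (1/l + d) * card A"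
          if "x \<in> A" "blow E (nb E x) (l - 1) q P" "blow E (nb E x) (l - 1) q P'" for x P P'
          using no E that by (force simp: not_less)
        show "\<exists>f. tup E (nb E x \<inter> nb E z) (l - 1) f"
          if "x \<in> A" "z \<in> A" "x \<noteq> z" "blow E (nb E x - {z}) (l - 1) q P" "blow E (nb E z - {x}) (l - 1) q P'"
            "card (link E A (l - 1) P \<union> link E A (l - 1) P') < (2/l - d') * card A" for x z P P'
        proof -
          have "nb E x - {z} \<subseteq> A" "nb E z - {x} \<subseteq> A" using nb_subset[OF Kf_gr[OF E]] by blast+
          then have "blow E A (l - 1) q P" "blow E A (l - 1) q P'" using that(4,5) blow_mono by blast+
          then have "(1/l - d) * card A \<le> card (link E A (l - 1) P)" "(1/l - d) * card A \<le> card (link E A (l - 1) P')"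
            using low by blast+
          then show ?thesis using no E t that by blast
        qed
      qed (use l A E d d' small low in auto)
      show ?thesis by (rule colourable)
    qed
    moreover have "finite (?T A \<union> (?N A \<union> (?L A \<union> (?U A \<union> ?O A))))" using Kf_finite[OF A] by simp
    ultimately show "Kf l A - Col l A \<subseteq> ?T A \<union> (?N A \<union> (?L A \<union> (?U A \<union> ?O A))) \<and>
      finite (?T A \<union> (?N A \<union> (?L A \<union> (?U A \<union> ?O A))))" by blast
  qed
qed

section \<open>The extension property\<close>

lemma Col_pos: assumes "l \<ge> 1" "finite A" shows "1 \<le> card (Col l A)"
proof -
  have "(\<lambda>_ _. False) \<in> Col l A"
    unfolding Col_def gr_def graph_def proper_def using assms(1) by (auto intro!: exI[where x = "\<lambda>_. 0"])
  then have "Col l A \<noteq> {}" by blast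
  then have "0 < card (Col l A)" using Col_finite[OF assms(2)] by (simp add: card_gt_0_iff)
  then show ?thesis by simp
qed

text \<open>From size \<open>n0\<close> on, the exponential factor is at most 1/2, so the number of
  all graphs is at most \<open>(1 + C / 2)\<close> times that of the colourable ones, and this is at
  most \<open>C\<close> times because \<open>C \<ge> 2\<close>. Smaller vertex sets are covered by
  taking \<open>C\<close> large. With this constant the hypothesis in \<open>negligible\<close>
  holds for every set.\<close>

lemma Kf_le_Col:
  assumes l: "l \<ge> 1" and neg: "negligible l (\<lambda>A :: 'a set. Kf l A - Col l A)"
  shows "\<exists>\<delta>::real. \<delta> > 0 \<and> (\<exists>D. \<forall>A :: 'a set. finite A \<longrightarrow>
    real (card (Kf l A - Col l A)) \<le> 2 powr (D - \<delta> * real (card A)) * card (Col l A))"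
proof -
  obtain \<delta> D where \<delta>: "\<delta> > 0" and b: "\<And>C (A :: 'a set). C \<ge> 1 \<Longrightarrow> finite A \<Longrightarrow>
     (\<forall>B. B \<subset> A \<longrightarrow> real (card (Kf l B)) \<le> C * real (card (Col l B))) \<Longrightarrow>
     real (card (Kf l A - Col l A)) \<le> C * 2 powr (D - \<delta> * real (card A)) * real (card (Col l A))"
    using neg unfolding negligible_def by metis
  define n0 where "n0 = nat \<lceil>(D + 1) / \<delta>\<rceil>"
  define C :: real where "C = 2 * 2 ^ (n0^2)"
  have C: "C \<ge> 2" by (simp add: C_def)
  have main: "finite A \<Longrightarrow> real (card (Kf l A)) \<le> C * card (Col l A)" for A :: "'a set"
  proof (induction "card A" arbitrary: A rule: less_induct)
    case less
    have IH: "\<forall>B. B \<subset> A \<longrightarrow> real (card (Kf l B)) \<le> C * real (card (Col l B))"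
      using less by (meson finite_subset psubset_card_mono psubset_imp_subset)
    show ?case
    proof (cases "card A \<ge> n0")
      case True
      then have "(D + 1) / \<delta> \<le> card A" unfolding n0_def by linarith
      then have "D - \<delta> * card A \<le> -1" using \<delta> by (simp add: field_simps)
      then have "2 powr (D - \<delta> * card A) \<le> 2 powr (-1)" by (intro powr_mono) auto
      also have "2 powr (-1) = (1/2 :: real)" by (simp add: powr_minus)
      finally have h: "2 powr (D - \<delta> * card A) \<le> 1/2" .
      have "Kf l A \<subseteq> Col l A \<union> (Kf l A - Col l A)" by blast
      then have "card (Kf l A) \<le> card (Col l A \<union> (Kf l A - Col l A))"
        by (rule card_mono[rotated]) (use Kf_finite Col_finite less.prems in auto)
      also have "\<dots> \<le> card (Col l A) + card (Kf l A - Col l A)" by (rule card_Un_le)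
      finally have "real (card (Kf l A)) \<le> real (card (Col l A)) + real (card (Kf l A - Col l A))" by linarith
      also have "real (card (Kf l A - Col l A)) \<le> C * 2 powr (D - \<delta> * real (card A)) * real (card (Col l A))"
        by (rule b[OF _ less.prems IH]) (use C in simp)
      also have "\<dots> \<le> C * (1/2) * real (card (Col l A))" using h C by (intro mult_right_mono mult_left_mono) auto
      also have "card (Col l A) + C * (1/2) * real (card (Col l A)) = (1 + C/2) * card (Col l A)" by (simp add: algebra_simps)
      also have "\<dots> \<le> C * card (Col l A)" using C by (intro mult_right_mono) auto
      finally show ?thesis by simp
    next
      case False
      have "card (Kf l A) \<le> card (gr A)" by (rule card_mono[OF gr_finite[OF less.prems]]) (auto simp: Kf_def)
      also have "\<dots> \<le> 2 ^ (card A)^2" by (rule gr_card[OF less.prems])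
      also have "\<dots> \<le> 2 ^ n0^2" using False by (intro power_increasing power_mono) auto
      finally have "real (card (Kf l A)) \<le> real (2 ^ n0^2)" by (rule of_nat_mono)
      also have "\<dots> \<le> C * 1" by (simp add: C_def)
      also have "\<dots> \<le> C * card (Col l A)" using Col_pos[OF l less.prems] C by (intro mult_left_mono) auto
      finally show ?thesis .
    qed
  qed
  show ?thesis
  proof (rule exI[where x = \<delta>], rule conjI[OF \<delta>], rule exI[where x = "D + log 2 C"], intro allI impI)
    fix A :: "'a set" assume A: "finite A"
    have IH: "\<forall>B. B \<subset> A \<longrightarrow> real (card (Kf l B)) \<le> C * real (card (Col l B))"
      using main A finite_subset psubset_imp_subset by metis
    have "real (card (Kf l A - Col l A)) \<le> C * 2 powr (D - \<delta> * real (card A)) * real (card (Col l A))"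
      by (rule b[OF _ A IH]) (use C in simp)
    also have "C * 2 powr (D - \<delta> * real (card A)) = 2 powr (D + log 2 C - \<delta> * card A)"
      using C by (simp add: powr_add powr_diff)
    finally show "real (card (Kf l A - Col l A)) \<le> 2 powr (D + log 2 C - \<delta> * card A) * card (Col l A)" .
  qed
qed

lemma Kf_one: "Kf 1 A \<subseteq> Col 1 A"
proof
  fix E assume E: "E \<in> Kf 1 A"
  have "\<not> E x y" for x y
  proof
    assume xy: "E x y"
    have "tup E A (Suc 1) (\<lambda>i. if i = 0 then x else y)"
      using xy gr_dom[OF Kf_gr[OF E] xy] gr_sym[OF Kf_gr[OF E] xy] by (auto simp: tup_def less_Suc_eq)
    then show False using E by (auto simp: Kf_def)
  qed
  then show "E \<in> Col 1 A" using Kf_gr[OF E] by (auto simp: Col_def proper_def intro!: exI[where x = "\<lambda>_. 0"])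
qed

lemma almost_all_colourable:
  assumes l: "l \<ge> 1" and \<epsilon>: "(\<epsilon>::real) > 0"
  shows "\<exists>n0. \<forall>A :: 'a set. finite A \<longrightarrow> card A \<ge> n0 \<longrightarrow> real (card (Kf l A - Col l A)) \<le> \<epsilon> * card (Col l A)"
proof (cases "l = 1")
  case True
  have e: "Kf l A - Col l A = {}" for A :: "'a set" using Kf_one True by blast
  show ?thesis unfolding e using \<epsilon> by simp
next
  case False
  obtain \<delta> D :: real where \<delta>: "\<delta> > 0" and b: "\<And>A :: 'a set. finite A \<Longrightarrow>
    real (card (Kf l A - Col l A)) \<le> 2 powr (D - \<delta> * card A) * card (Col l A)"
    using Kf_le_Col[OF l negligible_not_colourable, where 'a = 'a] False l by auto
  show ?thesis
  proof (rule exI[where x = "nat \<lceil>(D - log 2 \<epsilon>) / \<delta>\<rceil>"], intro allI impI)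
    fix A :: "'a set" assume A: "finite A" "card A \<ge> nat \<lceil>(D - log 2 \<epsilon>) / \<delta>\<rceil>"
    then have "(D - log 2 \<epsilon>) / \<delta> \<le> card A" by linarith
    then have "D - \<delta> * card A \<le> log 2 \<epsilon>" using \<delta> by (simp add: field_simps)
    then have "2 powr (D - \<delta> * card A) \<le> 2 powr (log 2 \<epsilon>)" by (intro powr_mono) auto
    then have "2 powr (D - \<delta> * card A) \<le> \<epsilon>" using \<epsilon> by simp
    then show "real (card (Kf l A - Col l A)) \<le> \<epsilon> * card (Col l A)"
      using b[OF A(1)] mult_right_mono[of "2 powr (D - \<delta> * card A)" \<epsilon> "real (card (Col l A))"] by linarith
  qed
qed

text \<open>The coloured analogue of the extension axioms of the random graph: that no element of
  \<open>X\<close> has colour \<open>i\<close> is the only obstruction which properness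
  imposes.\<close>

definition ext :: "nat \<Rightarrow> 'a set \<Rightarrow> ('a \<Rightarrow> 'a \<Rightarrow> bool) \<Rightarrow> ('a \<Rightarrow> nat) \<Rightarrow> nat \<Rightarrow> bool" where
  "ext l V E c m \<longleftrightarrow> proper l V E c \<and> (\<forall>T X i. T \<subseteq> V \<longrightarrow> finite T \<longrightarrow> card T \<le> m \<longrightarrow> X \<subseteq> T \<longrightarrow> i < l \<longrightarrow>
     (\<forall>x\<in>X. c x \<noteq> i) \<longrightarrow> (\<exists>v\<in>V - T. c v = i \<and> (\<forall>t\<in>T. E v t \<longleftrightarrow> t \<in> X)))"

lemma extD:
  assumes "ext l V E c m" "T \<subseteq> V" "finite T" "card T \<le> m" "X \<subseteq> T" "i < l" "\<And>x. x \<in> X \<Longrightarrow> c x \<noteq> i"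
  obtains v where "v \<in> V" "v \<notin> T" "c v = i" "\<And>t. t \<in> T \<Longrightarrow> E v t \<longleftrightarrow> t \<in> X"
  using assms unfolding ext_def by (metis Diff_iff)

lemma ext_proper: "ext l V E c m \<Longrightarrow> proper l V E c"
  by (simp add: ext_def)

lemma ext_mono: "ext l V E c m \<Longrightarrow> m' \<le> m \<Longrightarrow> ext l V E c m'"
  unfolding ext_def by (meson le_trans)

text \<open>Such a clique in all the other colours forces \<open>x\<close> and \<open>y\<close> to
  agree in every proper colouring. It is built one colour at a time; the sets to be extended,
  \<open>x\<close> and \<open>y\<close> included, have at most \<open>l\<close> elements.\<close>

lemma ext_clique_through:
  assumes ext: "ext l V E c m" and G: "graph V E" and m: "l \<le> m" and xy: "x \<in> V" "y \<in> V" "c x = i" "c y = i"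
    and J: "J \<subseteq> {..<l} - {i}"
  shows "\<exists>f. \<forall>j\<in>J. f j \<in> V \<and> c (f j) = j \<and> E (f j) x \<and> E (f j) y \<and> (\<forall>j'\<in>J. j \<noteq> j' \<longrightarrow> E (f j) (f j'))"
proof -
  have "finite J" using J finite_subset by blast
  then show ?thesis using J
  proof (induction J rule: finite_induct)
    case (insert j J)
    from insert.prems have "J \<subseteq> {..<l} - {i}" by simp
    from insert.IH[OF this] obtain f where
      "\<forall>j\<in>J. f j \<in> V \<and> c (f j) = j \<and> E (f j) x \<and> E (f j) y \<and> (\<forall>j'\<in>J. j \<noteq> j' \<longrightarrow> E (f j) (f j'))" by (elim exE)
    note f = bspec[OF this]
    let ?T = "insert x (insert y (f ` J))"
    have il: "i < l" using xy ext by (auto simp: ext_def proper_def)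
    have "card (insert j J) \<le> card ({..<l} - {i})" by (rule card_mono) (use insert.prems in auto)
    then have "Suc (card J) \<le> l - 1" using insert.hyps il by simp
    moreover have "card ?T \<le> Suc (Suc (card J))"
    proof -
      have "card ?T \<le> Suc (card (insert y (f ` J)))" using insert.hyps(1) by (simp add: card_insert_if)
      moreover have "card (insert y (f ` J)) \<le> Suc (card (f ` J))" using insert.hyps(1) by (simp add: card_insert_if)
      moreover have "card (f ` J) \<le> card J" by (rule card_image_le[OF insert.hyps(1)])
      ultimately show ?thesis by linarith
    qed
    ultimately have cT: "card ?T \<le> m" using m il by linarith
    obtain v where v: "v \<in> V" "v \<notin> ?T" "c v = j" "\<And>t. t \<in> ?T \<Longrightarrow> E v t \<longleftrightarrow> t \<in> ?T"
    proof (rule extD[OF ext _ _ cT order_refl])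
      show "?T \<subseteq> V" using f xy by auto
      show "j < l" using insert.prems by auto
      show "\<And>z. z \<in> ?T \<Longrightarrow> c z \<noteq> j" using f xy insert by auto
    qed (use insert.hyps in auto)
    have sym: "E a b \<Longrightarrow> E b a" for a b using G by (auto simp: graph_def)
    show ?case
    proof (rule exI[where x = "f(j := v)"], intro ballI)
      fix a assume a: "a \<in> insert j J"
      show "(f(j := v)) a \<in> V \<and> c ((f(j := v)) a) = a \<and> E ((f(j := v)) a) x \<and> E ((f(j := v)) a) y \<and>
         (\<forall>j'\<in>insert j J. a \<noteq> j' \<longrightarrow> E ((f(j := v)) a) ((f(j := v)) j'))"
      proof (cases "a = j")
        case True
        then show ?thesis using v by auto
      next
        case False
        then have aJ: "a \<in> J" using a by blast
        have "E v (f a)" using v(4)[of "f a"] aJ by simp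
        then show ?thesis using f[OF aJ] False sym by auto
      qed
    qed
  qed simp
qed

text \<open>Two vertices of one class see a common clique on which any proper \<open>c'\<close>
  takes \<open>l - 1\<close> values, so both get the value left over. Distinct classes keep distinct
  values because some vertex of the one is adjacent to the representative of the other.\<close>

lemma ext_unique_colouring:
  assumes ext: "ext l V E c m" and G: "graph V E" and m: "l \<le> m" "1 \<le> m" and c': "proper l V E c'"
  shows "\<exists>\<pi>. inj_on \<pi> {..<l} \<and> \<pi> ` {..<l} \<subseteq> {..<l} \<and> (\<forall>x\<in>V. c' x = \<pi> (c x))"
proof -
  have c: "proper l V E c" using ext_proper[OF ext] .
  have same: "c' x = c' y" if xy: "x \<in> V" "y \<in> V" "c x = c y" for x y
  proof -
    let ?i = "c x"
    let ?J = "{..<l} - {?i}"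
    obtain f where f: "\<And>j. j \<in> ?J \<Longrightarrow> f j \<in> V \<and> c (f j) = j \<and> E (f j) x \<and> E (f j) y \<and> (\<forall>j'\<in>?J. j \<noteq> j' \<longrightarrow> E (f j) (f j'))"
      using ext_clique_through[OF ext G m(1) xy(1,2) refl xy(3)[symmetric] order_refl] by metis
    have il: "?i < l" using c xy by (auto simp: proper_def)
    have inj: "inj_on (c' \<circ> f) ?J"
      using f c' unfolding inj_on_def proper_def by (metis comp_apply)
    have eq: "(c' \<circ> f) ` ?J = {..<l} - {c' z}" if "z \<in> {x, y}" for z
    proof (rule card_subset_eq)
      have zV: "z \<in> V" using that xy by blast
      show "(c' \<circ> f) ` ?J \<subseteq> {..<l} - {c' z}"
      proof
        fix k assume "k \<in> (c' \<circ> f) ` ?J"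
        then obtain j where j: "j \<in> ?J" "k = c' (f j)" by auto
        have "E (f j) z" using f[OF j(1)] that by blast
        then have "c' (f j) \<noteq> c' z" using c' by (auto simp: proper_def)
        moreover have "c' (f j) < l" using f[OF j(1)] c' by (auto simp: proper_def)
        ultimately show "k \<in> {..<l} - {c' z}" using j by simp
      qed
      have "c' z < l" using zV c' by (auto simp: proper_def)
      then show "card ((c' \<circ> f) ` ?J) = card ({..<l} - {c' z})"
        using card_image[OF inj] il by simp
    qed simp
    have "{..<l} - {c' x} = {..<l} - {c' y}" using eq[of x] eq[of y] by simp
    moreover have "c' x < l" "c' y < l" using xy c' by (auto simp: proper_def)
    ultimately show ?thesis by blast
  qed
  have ex: "\<exists>v. v \<in> V \<and> c v = i" if "i < l" for i
    by (rule extD[OF ext, of "{}" "{}" i]) (use that in auto)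
  define r where "r i = (SOME v. v \<in> V \<and> c v = i)" for i
  have r: "r i \<in> V" "c (r i) = i" if "i < l" for i
    using someI_ex[OF ex[OF that]] unfolding r_def by auto
  show ?thesis
  proof (intro exI[where x = "c' \<circ> r"] conjI ballI)
    show "(c' \<circ> r) ` {..<l} \<subseteq> {..<l}" using r c' by (auto simp: proper_def)
    show "c' x = (c' \<circ> r) (c x)" if "x \<in> V" for x
    proof -
      have "c x < l" using that c by (auto simp: proper_def)
      then show ?thesis using same[OF that r(1)] r(2) by simp
    qed
    show "inj_on (c' \<circ> r) {..<l}"
    proof (rule inj_onI, rule ccontr)
      fix i j assume ij: "i \<in> {..<l}" "j \<in> {..<l}" "(c' \<circ> r) i = (c' \<circ> r) j" "i \<noteq> j"
      obtain v where v: "v \<in> V" "c v = j" "E v (r i)"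
        by (rule extD[OF ext, of "{r i}" "{r i}" j]) (use r[of i] ij m in auto)
      have "c' v = c' (r j)" using same[OF v(1) r(1)] v(2) r(2)[of j] ij by simp
      moreover have "c' v \<noteq> c' (r i)" using v(3) c' by (auto simp: proper_def)
      ultimately show False using ij by simp
    qed
  qed
qed

section \<open>Counting coloured graphs\<close>

definition gcol :: "'a set \<Rightarrow> ('a \<Rightarrow> nat) \<Rightarrow> ('a \<Rightarrow> 'a \<Rightarrow> bool) set" where
  "gcol A c = {E \<in> gr A. \<forall>x y. E x y \<longrightarrow> c x \<noteq> c y}"

definition cls :: "'a set \<Rightarrow> ('a \<Rightarrow> nat) \<Rightarrow> nat \<Rightarrow> 'a set" where
  "cls A c i = {v \<in> A. c v = i}"

lemma gcol_finite: "finite A \<Longrightarrow> finite (gcol A c)"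
  unfolding gcol_def by (rule finite_subset[OF _ gr_finite]) auto

text \<open>The exponent is the number of pairs of vertices with different colours.\<close>

lemma card_gcol:
  assumes "finite A" "\<forall>v\<in>A. c v < l"
  shows "card (gcol A c) \<le> 2 powr (((card A)^2 - (\<Sum>i<l. (real (card (cls A c i)))^2)) / 2)"
  using assms
proof (induction A rule: finite_induct)
  case empty
  have "gcol {} c \<subseteq> {\<lambda>_ _. False}" by (auto simp: gcol_def gr_def graph_def fun_eq_iff)
  from card_mono[OF _ this] show ?case by (simp add: cls_def)
next
  case (insert v A)
  let ?B = "insert v A" and ?j = "c v"
  let ?N = "A - cls A c ?j"
  have j: "?j < l" using insert by auto
  have "card (gcol ?B c) \<le> card (gcol A c \<times> Pow ?N)"
  proof (rule card_inj_on_le[where f = "\<lambda>E. (res A E, nb E v)"])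
    show "inj_on (\<lambda>E. (res A E, nb E v)) (gcol ?B c)"
    proof (rule inj_onI)
      fix E E' assume a: "E \<in> gcol ?B c" "E' \<in> gcol ?B c" "(res A E, nb E v) = (res A E', nb E' v)"
      have g: "E \<in> gr ?B" "E' \<in> gr ?B" using a by (auto simp: gcol_def)
      have "res {v} E = (\<lambda>_ _. False)" "res {v} E' = (\<lambda>_ _. False)"
        using gr_irrefl[OF g(1), of v] gr_irrefl[OF g(2), of v] by (auto simp: res_def fun_eq_iff)
      then show "E = E'" by (intro determined_by_nbhds[OF g, of "{v}"]) (use a insert.hyps in auto)
    qed
    show "(\<lambda>E. (res A E, nb E v)) ` gcol ?B c \<subseteq> gcol A c \<times> Pow ?N"
    proof clarify
      fix E assume E: "E \<in> gcol ?B c"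
      have g: "E \<in> gr ?B" and p: "\<And>x y. E x y \<Longrightarrow> c x \<noteq> c y" using E by (auto simp: gcol_def)
      have "res A E \<in> gcol A c" using res_gr[OF g, of A] p by (auto simp: gcol_def res_def)
      moreover have "nb E v \<subseteq> ?N" using nb_subset[OF g, of v] p by (force simp: nb_def cls_def)
      ultimately show "res A E \<in> gcol A c \<and> nb E v \<in> Pow ?N" by simp
    qed
  qed (use gcol_finite insert in auto)
  then have "real (card (gcol ?B c)) \<le> card (gcol A c) * card (Pow ?N)"
    by (simp add: card_cartesian_product flip: of_nat_mult)
  also have "\<dots> = card (gcol A c) * 2 powr (real (card A) - card (cls A c ?j))"
  proof -
    have "real (card ?N) = real (card A) - card (cls A c ?j)"
      using insert.hyps(1) by (subst card_Diff_subset) (auto simp: cls_def card_mono of_nat_diff)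
    moreover have "real (card (Pow ?N)) = 2 powr (card ?N)" by (rule two_powr_card_Pow) (use insert in simp)
    ultimately show ?thesis by simp
  qed
  also have "card (gcol A c) * 2 powr (real (card A) - card (cls A c ?j)) \<le>
      2 powr (((card A)^2 - (\<Sum>i<l. (real (card (cls A c i)))^2)) / 2) * 2 powr (real (card A) - card (cls A c ?j))"
    using insert by (intro mult_right_mono) auto
  also have "\<dots> = 2 powr (((card ?B)^2 - (\<Sum>i<l. (real (card (cls ?B c i)))^2)) / 2)"
  proof -
    have ci: "cls ?B c i = (if i = ?j then insert v (cls A c i) else cls A c i)" for i
      by (auto simp: cls_def)
    have fin: "finite (cls A c i)" for i using insert.hyps by (simp add: cls_def)
    have vn: "v \<notin> cls A c ?j" using insert.hyps by (simp add: cls_def)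
    have "(\<Sum>i<l. (real (card (cls ?B c i)))^2) = (real (card (cls ?B c ?j)))^2 + (\<Sum>i\<in>{..<l} - {?j}. (real (card (cls ?B c i)))^2)"
      by (rule sum.remove) (use j in auto)
    also have "(\<Sum>i\<in>{..<l} - {?j}. (real (card (cls ?B c i)))^2) = (\<Sum>i\<in>{..<l} - {?j}. (real (card (cls A c i)))^2)"
      by (rule sum.cong) (auto simp: ci)
    also have "(real (card (cls ?B c ?j)))^2 = (real (card (cls A c ?j)))^2 + 2 * card (cls A c ?j) + 1"
      using fin vn by (simp add: ci power2_eq_square algebra_simps)
    also have "(real (card (cls A c ?j)))^2 + 2 * card (cls A c ?j) + 1 + (\<Sum>i\<in>{..<l} - {?j}. (real (card (cls A c i)))^2)
       = (\<Sum>i<l. (real (card (cls A c i)))^2) + 2 * card (cls A c ?j) + 1"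
      using sum.remove[of "{..<l}" ?j "\<lambda>i. (real (card (cls A c i)))^2"] j by simp
    finally show ?thesis using insert.hyps
      by (simp add: power2_eq_square algebra_simps add_divide_distrib diff_divide_distrib flip: powr_add)
  qed
  finally show ?case .
qed

lemma sum_cls: assumes "finite A" "\<forall>v\<in>A. c v < l" shows "(\<Sum>i<l. real (card (cls A c i))) = card A"
proof -
  have "A = (\<Union>i<l. cls A c i)" using assms(2) by (auto simp: cls_def)
  then have "card A = (\<Sum>i<l. card (cls A c i))"
    using card_UN_disjoint[of "{..<l}" "cls A c"] assms(1) by (auto simp: cls_def)
  then show ?thesis by simp
qed

text \<open>The excess over the minimum \<open>n^2 / l\<close> is the sum of the squared deviations
  from the mean, and the small class alone contributes \<open>(n / (2 * l))^2\<close>.\<close>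

lemma sum_squares_unbalanced:
  fixes x :: "nat \<Rightarrow> real"
  assumes "l \<ge> 1" "(\<Sum>i<l. x i) = n" "i0 < l" "x i0 < n / (2 * real l)" "n \<ge> 0"
  shows "n^2 / l + n^2 / (4 * (real l)^2) \<le> (\<Sum>i<l. (x i)^2)"
proof -
  have "(\<Sum>i<l. (x i - n / l)^2) = (\<Sum>i<l. (x i)^2 - 2 * (n / l) * x i + (n / l)^2)"
    by (rule sum.cong) (auto simp: power2_eq_square algebra_simps)
  also have "\<dots> = (\<Sum>i<l. (x i)^2) - 2 * (n / l) * n + l * (n / l)^2"
    by (simp only: sum.distrib sum_subtractf sum_distrib_left[symmetric] assms(2)) simp
  also have "\<dots> = (\<Sum>i<l. (x i)^2) - n^2 / l" using assms(1) by (simp add: power2_eq_square field_simps)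
  finally have eq: "(\<Sum>i<l. (x i - n / l)^2) = (\<Sum>i<l. (x i)^2) - n^2 / l" .
  have "n / (2 * real l) = n / l - n / (2 * real l)" using assms(1) by (simp add: field_simps)
  then have "n / (2 * real l) \<le> n / l - x i0" using assms(4) by linarith
  then have "(n / (2 * real l))^2 \<le> (n / l - x i0)^2" using assms(5) by (intro power_mono) auto
  also have "\<dots> = (x i0 - n / l)^2" by (rule power2_commute)
  also have "\<dots> \<le> (\<Sum>i<l. (x i - n / l)^2)" by (rule member_le_sum) (use assms(3) in auto)
  finally show ?thesis unfolding eq by (simp add: power_divide power_mult_distrib)
qed

definition unrealised :: "'a set \<Rightarrow> ('a \<Rightarrow> nat) \<Rightarrow> 'a set \<Rightarrow> 'a set \<Rightarrow> nat \<Rightarrow> ('a \<Rightarrow> 'a \<Rightarrow> bool) set" where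
  "unrealised A c T X i = {E \<in> gcol A c. \<forall>v\<in>A - T. c v = i \<longrightarrow> \<not> (\<forall>t\<in>T. E v t \<longleftrightarrow> t \<in> X)}"

text \<open>The traces on \<open>T'\<close> of the vertices in \<open>Z\<close> can be chosen independently of each other and of the rest of the graph.\<close>
lemma card_unrealised:
  assumes "finite A" "T \<subseteq> A" "card T \<le> m" "X \<subseteq> T" "\<forall>x\<in>X. c x \<noteq> i"
  shows "card (unrealised A c T X i) \<le> (1 - 1 / 2 ^ (m + 1)) ^ card {v \<in> A - T. c v = i} * real (card (gcol A c))"
proof -
  \<comment> \<open>A vertex of colour \<open>i\<close> has no neighbour of its own colour, so only
    its trace on \<open>T'\<close> is open.\<close>
  define T' where "T' = {t \<in> T. c t \<noteq> i}"
  define Z where "Z = {v \<in> A - T. c v = i}"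
  \<comment> \<open>\<open>R\<close> is the rest of the graph: with arbitrary traces it injects into
    \<open>gcol A c\<close>, and with traces different from \<open>X\<close> it covers the graphs to
    be counted.\<close>
  define R where "R = {E \<in> gcol A c. \<forall>v\<in>Z. \<forall>t\<in>T'. \<not> E v t}"
  let ?t = "card T'" and ?z = "card Z"
  have fin: "finite T" "finite T'" "finite Z"
    using assms(1) finite_subset[OF assms(2,1)] by (simp_all add: T'_def Z_def)
  have fR: "finite R" using gcol_finite[OF assms(1)] by (simp add: R_def)
  have disj: "Z \<inter> T' = {}" by (auto simp: Z_def T'_def)
  have ZA: "Z \<subseteq> A" "T' \<subseteq> A" using assms by (auto simp: Z_def T'_def)
  have XT: "X \<subseteq> T'" using assms by (auto simp: T'_def)
  have 1: "card (unrealised A c T X i) \<le> card (R \<times> PiE Z (\<lambda>_. Pow T' - {X}))"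
  proof (rule card_inj_on_le[where f = "\<lambda>E. ((\<lambda>u v. E u v \<and> \<not> (u \<in> Z \<and> v \<in> T') \<and> \<not> (v \<in> Z \<and> u \<in> T')), \<lambda>v\<in>Z. nb E v \<inter> T')"])
    show "inj_on (\<lambda>E. ((\<lambda>u v. E u v \<and> \<not> (u \<in> Z \<and> v \<in> T') \<and> \<not> (v \<in> Z \<and> u \<in> T')), \<lambda>v\<in>Z. nb E v \<inter> T')) (unrealised A c T X i)"
    proof (rule inj_onI, clarify, intro ext)
      fix E E' u v assume a: "E \<in> unrealised A c T X i" "E' \<in> unrealised A c T X i"
        and r: "(\<lambda>u v. E u v \<and> \<not> (u \<in> Z \<and> v \<in> T') \<and> \<not> (v \<in> Z \<and> u \<in> T')) = (\<lambda>u v. E' u v \<and> \<not> (u \<in> Z \<and> v \<in> T') \<and> \<not> (v \<in> Z \<and> u \<in> T'))"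
        and h: "(\<lambda>v\<in>Z. nb E v \<inter> T') = (\<lambda>v\<in>Z. nb E' v \<inter> T')"
      have g: "E \<in> gr A" "E' \<in> gr A" using a by (auto simp: unrealised_def gcol_def)
      have cross: "E u v = E' u v" if "u \<in> Z" "v \<in> T'" for u v
        using fun_cong[OF h, of u] that by (auto simp: nb_def)
      have sym: "E u v = E v u" "E' u v = E' v u" using gr_sym g by metis+
      have "(E u v \<and> \<not> (u \<in> Z \<and> v \<in> T') \<and> \<not> (v \<in> Z \<and> u \<in> T')) = (E' u v \<and> \<not> (u \<in> Z \<and> v \<in> T') \<and> \<not> (v \<in> Z \<and> u \<in> T'))"
        using fun_cong[OF fun_cong[OF r, of u], of v] .
      then show "E u v = E' u v" using cross[of u v] cross[of v u] sym by blast
    qed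
    show "(\<lambda>E. ((\<lambda>u v. E u v \<and> \<not> (u \<in> Z \<and> v \<in> T') \<and> \<not> (v \<in> Z \<and> u \<in> T')), \<lambda>v\<in>Z. nb E v \<inter> T')) ` unrealised A c T X i
       \<subseteq> R \<times> PiE Z (\<lambda>_. Pow T' - {X})"
    proof clarify
      fix E assume E: "E \<in> unrealised A c T X i"
      have g: "E \<in> gr A" and p: "\<And>x y. E x y \<Longrightarrow> c x \<noteq> c y" using E by (auto simp: unrealised_def gcol_def)
      have "(\<lambda>u v. E u v \<and> \<not> (u \<in> Z \<and> v \<in> T') \<and> \<not> (v \<in> Z \<and> u \<in> T')) \<in> R"
        using g p by (auto simp: R_def gcol_def gr_def graph_def)
      moreover have "nb E v \<inter> T' \<noteq> X" if v: "v \<in> Z" for v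
      proof
        assume e: "nb E v \<inter> T' = X"
        have "E v t \<longleftrightarrow> t \<in> X" if t: "t \<in> T" for t
        proof (cases "c t = i")
          case True
          then show ?thesis using p[of v t] v assms(5) by (auto simp: Z_def)
        next
          case False
          then have "t \<in> T'" using t by (simp add: T'_def)
          then show ?thesis using e by (auto simp: nb_def)
        qed
        then show False using E v by (auto simp: unrealised_def Z_def)
      qed
      ultimately show "(\<lambda>u v. E u v \<and> \<not> (u \<in> Z \<and> v \<in> T') \<and> \<not> (v \<in> Z \<and> u \<in> T')) \<in> R \<and> (\<lambda>v\<in>Z. nb E v \<inter> T') \<in> PiE Z (\<lambda>_. Pow T' - {X})"
        by auto
    qed
    show "finite (R \<times> PiE Z (\<lambda>_. Pow T' - {X}))" using fR fin by (intro finite_cartesian_product finite_PiE) auto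
  qed
  have 2: "card (R \<times> PiE Z (\<lambda>_. Pow T')) \<le> card (gcol A c)"
  proof (rule card_inj_on_le[where f = "\<lambda>(H, h). \<lambda>u v. H u v \<or> (u \<in> Z \<and> v \<in> h u) \<or> (v \<in> Z \<and> u \<in> h v)"])
    show "inj_on (\<lambda>(H, h). \<lambda>u v. H u v \<or> (u \<in> Z \<and> v \<in> h u) \<or> (v \<in> Z \<and> u \<in> h v)) (R \<times> PiE Z (\<lambda>_. Pow T'))"
    proof (rule inj_onI, clarify)
      fix H h H' h' assume a: "H \<in> R" "H' \<in> R" "h \<in> PiE Z (\<lambda>_. Pow T')" "h' \<in> PiE Z (\<lambda>_. Pow T')"
        and e: "(\<lambda>u v. H u v \<or> (u \<in> Z \<and> v \<in> h u) \<or> (v \<in> Z \<and> u \<in> h v)) = (\<lambda>u v. H' u v \<or> (u \<in> Z \<and> v \<in> h' u) \<or> (v \<in> Z \<and> u \<in> h' v))"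
      have ev: "(H u v \<or> (u \<in> Z \<and> v \<in> h u) \<or> (v \<in> Z \<and> u \<in> h v)) = (H' u v \<or> (u \<in> Z \<and> v \<in> h' u) \<or> (v \<in> Z \<and> u \<in> h' v))" for u v
        using fun_cong[OF fun_cong[OF e, of u], of v] .
      have hT: "h u \<subseteq> T'" "h' u \<subseteq> T'" if "u \<in> Z" for u using a(3,4) that by auto
      have sym: "H u v \<Longrightarrow> H v u" "H' u v \<Longrightarrow> H' v u" for u v
        using a(1,2) gr_sym by (auto simp: R_def gcol_def)
      have noH: "\<not> H u v" "\<not> H' u v" "\<not> H v u" "\<not> H' v u" if "u \<in> Z" "v \<in> T'" for u v
      proof -
        show 1: "\<not> H u v" "\<not> H' u v" using a(1,2) that by (auto simp: R_def)
        show "\<not> H v u" "\<not> H' v u" using 1 sym by blast+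
      qed
      have "h u = h' u" for u
      proof (cases "u \<in> Z")
        case True
        have "t \<in> h u \<longleftrightarrow> t \<in> h' u" for t
        proof (cases "t \<in> T'")
          case t: True
          then have "t \<notin> Z" using disj by blast
          then show ?thesis using ev[of u t] noH[OF True t] True by blast
        next
          case False then show ?thesis using hT[OF True] by blast
        qed
        then show ?thesis by blast
      next
        case False
        then show ?thesis using a(3,4) by (auto simp: PiE_def extensional_def)
      qed
      then have hh: "h = h'" by blast
      have "H u v = H' u v" for u v
        using ev[of u v] noH[of u v] noH[of v u] hT[of u] hT[of v] unfolding hh by blast
      then show "H = H' \<and> h = h'" using hh by blast
    qed
    show "(\<lambda>(H, h). \<lambda>u v. H u v \<or> (u \<in> Z \<and> v \<in> h u) \<or> (v \<in> Z \<and> u \<in> h v)) ` (R \<times> PiE Z (\<lambda>_. Pow T')) \<subseteq> gcol A c"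
    proof clarify
      fix H h assume a: "H \<in> R" "h \<in> PiE Z (\<lambda>_. Pow T')"
      have hT: "v \<in> h u \<Longrightarrow> u \<in> Z \<Longrightarrow> v \<in> T'" for u v using a(2) by auto
      have g: "H \<in> gr A" and p: "\<And>x y. H x y \<Longrightarrow> c x \<noteq> c y" using a(1) by (auto simp: R_def gcol_def)
      have cc: "c u \<noteq> c v" "u \<noteq> v" if "u \<in> Z" "v \<in> T'" for u v using that disj by (auto simp: Z_def T'_def)
      have "(\<lambda>u v. H u v \<or> (u \<in> Z \<and> v \<in> h u) \<or> (v \<in> Z \<and> u \<in> h v)) \<in> gr A"
        unfolding gr_def graph_def
      proof (intro CollectI conjI allI impI)
        fix x y assume "H x y \<or> (x \<in> Z \<and> y \<in> h x) \<or> (y \<in> Z \<and> x \<in> h y)"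
        then show "x \<in> A" "y \<in> A" using gr_dom[OF g] ZA hT by blast+
      next
        fix x y assume "H x y \<or> (x \<in> Z \<and> y \<in> h x) \<or> (y \<in> Z \<and> x \<in> h y)"
        then show "H y x \<or> (y \<in> Z \<and> x \<in> h y) \<or> (x \<in> Z \<and> y \<in> h x)" using gr_sym[OF g] by blast
      next
        fix x show "\<not> (H x x \<or> (x \<in> Z \<and> x \<in> h x) \<or> (x \<in> Z \<and> x \<in> h x))"
          using gr_irrefl[OF g] hT cc(2) by blast
      qed
      then show "(\<lambda>u v. H u v \<or> (u \<in> Z \<and> v \<in> h u) \<or> (v \<in> Z \<and> u \<in> h v)) \<in> gcol A c"
        unfolding gcol_def using p cc(1) hT by fastforce
    qed
  qed (rule gcol_finite[OF assms(1)])
  have cp: "card (Pow T' - {X}) = 2 ^ ?t - 1" using XT fin by (simp add: card_Pow)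
  have "real (card (unrealised A c T X i)) \<le> card R * (2 ^ ?t - 1) ^ ?z"
    using of_nat_mono[OF 1, where 'a = real] fin by (simp add: card_cartesian_product card_PiE cp of_nat_diff)
  also have "\<dots> = (1 - 1 / 2 ^ ?t) ^ ?z * (real (card R) * (2 ^ ?t) ^ ?z)"
  proof -
    have "(2 ^ ?t - 1 :: real) = (1 - 1 / 2 ^ ?t) * 2 ^ ?t" by (simp add: algebra_simps)
    then show ?thesis by (simp add: power_mult_distrib)
  qed
  also have "\<dots> \<le> (1 - 1 / 2 ^ (m + 1)) ^ ?z * real (card (gcol A c))"
  proof (intro mult_mono power_mono)
    have "?t \<le> card T" by (rule card_mono) (use fin in \<open>auto simp: T'_def\<close>)
    then have "(2::real) ^ ?t \<le> 2 ^ (m + 1)" using assms(3) by (intro power_increasing) auto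
    then show "1 - 1 / 2 ^ ?t \<le> 1 - 1 / (2::real) ^ (m + 1)" by (simp add: frac_le)
    show "real (card R) * (2 ^ ?t) ^ ?z \<le> card (gcol A c)"
      using of_nat_mono[OF 2, where 'a = real] fin by (simp add: card_cartesian_product card_PiE card_Pow)
    have "(1::real) \<le> 2 ^ (m + 1)" by (rule one_le_power) simp
    then show "0 \<le> (1 - 1 / 2 ^ (m + 1) :: real) ^ ?z" by (intro zero_le_power) (simp add: divide_le_eq)
  qed auto
  finally show ?thesis by (simp add: Z_def)
qed

text \<open>A union bound over the polynomially many triples of \<open>T\<close>, \<open>X\<close>
  and \<open>i\<close>: each class leaves at least \<open>n / (2 * l) - m\<close> vertices outside
  \<open>T\<close>, all of which have to miss the pattern. The exponent \<open>m + 1\<close> keeps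
  the base of the power positive also for \<open>m = 0\<close>.\<close>

lemma card_not_ext:
  assumes A: "finite A" and c: "\<forall>v\<in>A. c v < l" and l: "l \<ge> 1" and bal: "\<forall>i<l. card A / (2 * real l) \<le> card (cls A c i)"
  shows "card {E \<in> gcol A c. \<not> ext l A E c m} \<le>
    (real (2 ^ m * l) * (real (card A) + 1) ^ (m + 1) * (1 - 1 / 2 ^ (m + 1)) powr (card A / (2 * real l) - real m)) * card (gcol A c)"
proof -
  let ?\<theta> = "1 - 1 / 2 ^ (m + 1) :: real"
  let ?\<T> = "{T. T \<subseteq> A \<and> card T < m + 1}"
  let ?I = "SIGMA T:?\<T>. (Pow T \<times> {..<l})"
  have "(1::real) < 2 ^ (m + 1)" by (rule one_less_power) auto
  then have th: "0 < ?\<theta>" "?\<theta> < 1" by (simp_all add: divide_less_eq)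
  have fT: "finite ?\<T>" using A by simp
  have fTT: "finite T" if "T \<subseteq> A" for T using that A finite_subset by blast
  have fP: "\<forall>T\<in>?\<T>. finite (Pow T \<times> {..<l})"
    by (intro ballI finite_cartesian_product) (simp_all add: fTT)
  have fI: "finite ?I" by (rule finite_SigmaI[OF fT]) (rule bspec[OF fP])
  have cI: "card ?I \<le> (card A + 1) ^ (m + 1) * (2 ^ m * l)"
  proof -
    have "card ?I = (\<Sum>T\<in>?\<T>. card (Pow T \<times> {..<l}))" by (rule card_SigmaI[OF fT fP])
    also have "\<dots> \<le> (\<Sum>T\<in>?\<T>. 2 ^ m * l)"
    proof (rule sum_mono)
      fix T assume T: "T \<in> ?\<T>"
      then have "(2::nat) ^ card T \<le> 2 ^ m" by (intro power_increasing) auto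
      then show "card (Pow T \<times> {..<l}) \<le> 2 ^ m * l" using fTT T by (simp add: card_cartesian_product card_Pow)
    qed
    also have "\<dots> = card ?\<T> * (2 ^ m * l)" by simp
    also have "\<dots> \<le> (card A + 1) ^ (m + 1) * (2 ^ m * l)" by (rule mult_le_mono1[OF card_small_subsets[OF A]])
    finally show ?thesis .
  qed
  let ?b = "\<lambda>(T, X, i). if \<forall>x\<in>X. c x \<noteq> i then unrealised A c T X i else {}"
  have "real (card {E \<in> gcol A c. \<not> ext l A E c m}) \<le> card ?I * (?\<theta> powr (card A / (2 * real l) - real m) * card (gcol A c))"
  proof (rule card_UN_bound[OF fI])
    show "{E \<in> gcol A c. \<not> ext l A E c m} \<subseteq> (\<Union>p\<in>?I. ?b p)"
    proof clarify
      fix E assume E: "E \<in> gcol A c" "\<not> ext l A E c m"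
      have "proper l A E c" using E c by (auto simp: proper_def gcol_def)
      then obtain T X i where h: "T \<subseteq> A" "card T \<le> m" "X \<subseteq> T" "i < l" "\<forall>x\<in>X. c x \<noteq> i"
        "\<not> (\<exists>v\<in>A - T. c v = i \<and> (\<forall>t\<in>T. E v t \<longleftrightarrow> t \<in> X))"
        using E(2) unfolding ext_def by blast
      have "E \<in> ?b (T, X, i)" using h E by (auto simp: unrealised_def)
      moreover have "(T, X, i) \<in> ?I" using h by simp
      ultimately show "E \<in> (\<Union>p\<in>?I. ?b p)" by (rule UN_I[rotated])
    qed
    fix p assume p: "p \<in> ?I"
    then obtain T X i where pT: "p = (T, X, i)" and h: "T \<subseteq> A" "card T \<le> m" "X \<subseteq> T" "i < l" by (cases p) auto
    show "finite (?b p)" unfolding pT using gcol_finite[OF A] by (simp add: unrealised_def)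
    show "real (card (?b p)) \<le> ?\<theta> powr (card A / (2 * real l) - real m) * card (gcol A c)"
    proof (cases "\<forall>x\<in>X. c x \<noteq> i")
      case True
      let ?Z = "{v \<in> A - T. c v = i}"
      have "?Z = cls A c i - T" by (auto simp: cls_def)
      then have "card (cls A c i) - card T \<le> card ?Z"
        using diff_card_le_card_Diff[of T "cls A c i"] h(1) A finite_subset by auto
      then have "card A / (2 * real l) - m \<le> card ?Z" using bal h(2,4) by force
      then have "?\<theta> powr (card ?Z) \<le> ?\<theta> powr (card A / (2 * real l) - real m)" using th by (intro powr_mono') auto
      then have "?\<theta> ^ card ?Z \<le> ?\<theta> powr (card A / (2 * real l) - real m)" using th by (simp add: powr_realpow)
      then have "?\<theta> ^ card ?Z * card (gcol A c) \<le> ?\<theta> powr (card A / (2 * real l) - real m) * card (gcol A c)"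
        by (rule mult_right_mono) simp
      then show ?thesis using card_unrealised[OF A h(1-3) True] True unfolding pT by simp
    next
      case False
      then have e: "?b (T, X, i) = {}" by auto
      show ?thesis unfolding pT e by simp
    qed
  qed
  also have "\<dots> \<le> real ((card A + 1) ^ (m + 1) * (2 ^ m * l)) * (?\<theta> powr (card A / (2 * real l) - real m) * card (gcol A c))"
    using cI by (intro mult_right_mono of_nat_mono) auto
  finally show ?thesis by (simp add: algebra_simps)
qed

lemma polynomial_times_exponential_small:
  fixes K \<theta> \<epsilon> :: real
  assumes "0 < \<theta>" "\<theta> < 1" "\<epsilon> > 0" "l \<ge> 1"
  shows "\<exists>n0. \<forall>n::nat. n \<ge> n0 \<longrightarrow> K * (real n + 1) ^ p * \<theta> powr (n / (2 * real l) - real m) \<le> \<epsilon>"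
proof -
  define \<eta> where "\<eta> = - log 2 \<theta>"
  have eta: "\<eta> > 0" unfolding \<eta>_def using assms by simp
  have "\<eta> / (4 * l) > 0" using eta assms by simp
  from poly_le_powr[OF this, of K p] obtain Q0 where Q0: "\<And>Q. Q \<ge> Q0 \<Longrightarrow> K * (real Q + 1) ^ p \<le> 2 powr (\<eta> / (4 * l) * Q)" by blast
  show ?thesis
  proof (intro exI[where x = "max Q0 (nat \<lceil>(\<eta> * m - log 2 \<epsilon>) / (\<eta> / (4 * l))\<rceil>)"] allI impI)
    fix n :: nat assume n: "n \<ge> max Q0 (nat \<lceil>(\<eta> * m - log 2 \<epsilon>) / (\<eta> / (4 * l))\<rceil>)"
    then have "(\<eta> * m - log 2 \<epsilon>) / (\<eta> / (4 * l)) \<le> n" by linarith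
    then have le: "\<eta> * m - log 2 \<epsilon> \<le> \<eta> / (4 * l) * n"
      by (subst (asm) pos_divide_le_eq) (use eta assms in \<open>simp_all add: mult.commute\<close>)
    have "K * (real n + 1) ^ p * \<theta> powr (n / (2 * real l) - real m) \<le> 2 powr (\<eta> / (4 * l) * n) * \<theta> powr (n / (2 * real l) - real m)"
      using Q0 n by (intro mult_right_mono) auto
    also have "\<dots> = 2 powr (\<eta> * m - \<eta> / (4 * l) * n)"
    proof -
      have "\<theta> powr (n / (2 * real l) - real m) = 2 powr (- \<eta> * (n / (2 * real l) - real m))"
        unfolding \<eta>_def using assms by (simp add: powr_powr[symmetric])
      then show ?thesis using assms(4) by (simp add: field_simps flip: powr_add)
    qed
    also have "\<dots> \<le> 2 powr (log 2 \<epsilon>)" using le by (intro powr_mono) auto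
    also have "\<dots> = \<epsilon>" using assms by simp
    finally show "K * (real n + 1) ^ p * \<theta> powr (n / (2 * real l) - real m) \<le> \<epsilon>" .
  qed
qed

text \<open>Here \<open>l ^ n\<close> counts all colourings, \<open>2 powr n\<close> is the loss in
  \<open>Col_lower\<close>, and the quadratic term is the deficit of an unbalanced
  colouring.\<close>

lemma exponential_over_gaussian_small:
  fixes \<epsilon> :: real
  assumes "\<epsilon> > 0" "l \<ge> 1"
  shows "\<exists>n0. \<forall>n::nat. n \<ge> n0 \<longrightarrow> real l ^ n * 2 powr (n - (real n)^2 / (8 * (real l)^2)) \<le> \<epsilon>"
proof -
  define L where "L = log 2 l + 1"
  define a where "a = 1 / (8 * (real l)^2)"
  have L: "L \<ge> 0" and a: "a > 0" using assms by (auto simp: L_def a_def)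
  show ?thesis
  proof (intro exI[where x = "max 1 (nat \<lceil>(L^2 / (a/2) - log 2 \<epsilon>) / (a/2)\<rceil>)"] allI impI)
    fix n :: nat assume n: "n \<ge> max 1 (nat \<lceil>(L^2 / (a/2) - log 2 \<epsilon>) / (a/2)\<rceil>)"
    then have "(L^2 / (a/2) - log 2 \<epsilon>) / (a/2) \<le> n" by linarith
    then have 1: "L^2 / (a/2) - log 2 \<epsilon> \<le> a/2 * n"
      by (subst (asm) pos_divide_le_eq) (use a in \<open>simp_all add: mult.commute\<close>)
    have "L * n \<le> a/2 * (real n)^2 + L^2 / (a/2)" by (rule linear_le_quadratic) (use a L in auto)
    moreover have "a/2 * n \<le> a/2 * (real n)^2" using n a by (intro mult_left_mono) (auto simp: power2_eq_square)
    ultimately have 2: "L * n - a * (real n)^2 \<le> log 2 \<epsilon>" using 1 by (simp add: field_simps)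
    have "real l ^ n = 2 powr (log 2 l * n)" using assms by (simp add: powr_powr[symmetric] powr_realpow)
    then have "real l ^ n * 2 powr (n - (real n)^2 / (8 * (real l)^2)) = 2 powr (L * n - a * (real n)^2)"
      by (simp add: L_def a_def algebra_simps flip: powr_add)
    also have "\<dots> \<le> 2 powr (log 2 \<epsilon>)" using 2 by (intro powr_mono) auto
    also have "\<dots> = \<epsilon>" using assms by simp
    finally show "real l ^ n * 2 powr (n - (real n)^2 / (8 * (real l)^2)) \<le> \<epsilon>" .
  qed
qed

text \<open>By \<open>ext_unique_colouring\<close> any two such colourings of one graph differ by a
  map on the colours; \<open>l ^ l\<close> counts all maps, not only the permutations.\<close>

lemma card_good_pairs:
  assumes A: "finite A" and m: "l \<le> m" "1 \<le> m"
  shows "(\<Sum>c\<in>PiE A (\<lambda>_. {..<l}). real (card {E \<in> gcol A c. ext l A E c m})) \<le> real (l ^ l) * card (Col l A)"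
proof -
  let ?C = "PiE A (\<lambda>_. {..<l})"
  let ?G = "\<lambda>c. {E \<in> gcol A c. ext l A E c m}"
  have fC: "finite ?C" by (rule finite_PiE) (use A in auto)
  have fG: "finite (?G c)" for c using gcol_finite[OF A] by simp
  have "real (card (Sigma ?C ?G)) \<le> card (Col l A) * real (l ^ l)"
  proof (rule card_fibres[where r = snd])
    show "finite (Sigma ?C ?G)" using fC fG by (intro finite_SigmaI) auto
    show "finite (Col l A)" by (rule Col_finite[OF A])
    show "snd p \<in> Col l A" if "p \<in> Sigma ?C ?G" for p
      using that ext_proper by (fastforce simp: Col_def gcol_def)
    fix H assume "H \<in> Col l A"
    then have H: "graph A H" by (simp add: Col_def gr_def)
    let ?F = "{p \<in> Sigma ?C ?G. snd p = H}"
    have "card ?F \<le> l ^ l"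
    proof (cases "?F = {}")
      case True show ?thesis unfolding True by simp
    next
      case False
      then obtain c0 where c0: "ext l A H c0 m" by auto
      have "\<exists>\<pi>. \<pi> \<in> PiE {..<l} (\<lambda>_. {..<l}) \<and> (\<forall>x\<in>A. c x = \<pi> (c0 x))" if e: "ext l A H c m" for c
      proof -
        obtain \<pi> where \<pi>: "\<pi> ` {..<l} \<subseteq> {..<l}" "\<forall>x\<in>A. c x = \<pi> (c0 x)"
          using ext_unique_colouring[OF c0 H m ext_proper[OF e]] by blast
        have "c0 x < l" if "x \<in> A" for x using ext_proper[OF c0] that by (simp add: proper_def)
        then show ?thesis using \<pi> by (intro exI[where x = "restrict \<pi> {..<l}"]) auto
      qed
      then obtain P where P: "\<And>c. ext l A H c m \<Longrightarrow> P c \<in> PiE {..<l} (\<lambda>_. {..<l}) \<and> (\<forall>x\<in>A. c x = P c (c0 x))" by metis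
      have "card ?F \<le> card (PiE {..<l} (\<lambda>_. {..<l}))"
      proof (rule card_inj_on_le[where f = "P \<circ> fst"])
        show "inj_on (P \<circ> fst) ?F"
        proof (rule inj_onI)
          fix p p' assume pp: "p \<in> ?F" "p' \<in> ?F" "(P \<circ> fst) p = (P \<circ> fst) p'"
          obtain c where c: "p = (c, H)" "c \<in> ?C" "ext l A H c m" using pp(1) by (cases p) auto
          obtain c' where c': "p' = (c', H)" "c' \<in> ?C" "ext l A H c' m" using pp(2) by (cases p') auto
          note a = c(2) c'(2) c(3) c'(3) pp(3)[unfolded c(1) c'(1)]
          have "c x = c' x" for x
          proof (cases "x \<in> A")
            case True
            then show ?thesis using P[OF a(3)] P[OF a(4)] a(5) by simp
          next
            case False
            then show ?thesis using a(1,2) by (auto simp: PiE_def extensional_def)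
          qed
          then show "p = p'" using c(1) c'(1) by blast
        qed
        show "(P \<circ> fst) ` ?F \<subseteq> PiE {..<l} (\<lambda>_. {..<l})" using P by fastforce
        show "finite (PiE {..<l} (\<lambda>_. {..<l}))" by (rule finite_PiE) auto
      qed
      also have "\<dots> = l ^ l" by (simp add: card_PiE)
      finally show ?thesis .
    qed
    then show "real (card ?F) \<le> real (l ^ l)" by (rule of_nat_mono)
  qed
  moreover have "card (Sigma ?C ?G) = (\<Sum>c\<in>?C. card (?G c))" by (rule card_SigmaI) (use fC fG in auto)
  ultimately show ?thesis by (simp add: mult.commute flip: of_nat_sum)
qed

text \<open>Count pairs of a colouring and a graph: a graph with the extension property has at most \<open>l\<close> to the \<open>l\<close> colourings,
  so that the number of pairs is comparable to the number of graphs, and for a balanced colouring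
  few graphs fail the extension property.\<close>
lemma almost_all_ext_aux:
  fixes \<phi> \<psi> :: real
  assumes A: "finite A" and l: "l \<ge> 1" and m: "l \<le> m"
    and \<phi>: "real (2 ^ m * l) * (real (card A) + 1) ^ (m + 1) * (1 - 1 / 2 ^ (m + 1)) powr (card A / (2 * real l) - real m) \<le> \<phi>" "\<phi> \<le> 1/2"
    and \<psi>: "real l ^ card A * 2 powr (card A - (real (card A))^2 / (8 * (real l)^2)) \<le> \<psi>"
  shows "card {E \<in> Col l A. \<not> (\<exists>c. ext l A E c m)} \<le> (\<phi> * (2 * (real (l ^ l) + \<psi>)) + \<psi>) * card (Col l A)"
proof -
  let ?C = "PiE A (\<lambda>_. {..<l})" and ?n = "real (card A)" and ?K = "real (card (Col l A))"
  let ?N = "\<lambda>c. {E \<in> gcol A c. \<not> ext l A E c m}"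
  define bal where "bal c \<longleftrightarrow> (\<forall>i<l. card A / (2 * real l) \<le> card (cls A c i))" for c
  have fC: "finite ?C" by (rule finite_PiE) (use A in auto)
  have cC: "\<forall>v\<in>A. c v < l" if "c \<in> ?C" for c using that by auto
  have phi0: "0 \<le> \<phi>"
  proof -
    have "0 \<le> real (2 ^ m * l) * (?n + 1) ^ (m + 1) * (1 - 1 / 2 ^ (m + 1)) powr (card A / (2 * real l) - real m)" by simp
    then show ?thesis using \<phi>(1) by linarith
  qed
  define P where "P = (\<Sum>c\<in>?C. real (card (gcol A c)))"
  define B where "B = (\<Sum>c\<in>?C. real (card (?N c)))"
  have unbalanced: "real (card (gcol A c)) \<le> 2 powr (dens l * ?n^2 / 2 - ?n^2 / (8 * (real l)^2))"
    if c: "c \<in> ?C" and nb: "\<not> bal c" for c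
  proof -
    obtain i where i: "i < l" "card (cls A c i) < ?n / (2 * real l)" using nb by (auto simp: bal_def not_le)
    have sq: "?n^2 / l + ?n^2 / (4 * (real l)^2) \<le> (\<Sum>i<l. (real (card (cls A c i)))^2)"
      by (rule sum_squares_unbalanced[OF l sum_cls[OF A cC[OF c]] i]) simp
    have "dens l * ?n^2 = ?n^2 - ?n^2 / l" using l by (simp add: dens_eq algebra_simps)
    then have "(?n^2 - (\<Sum>i<l. (real (card (cls A c i)))^2)) / 2 \<le> dens l * ?n^2 / 2 - ?n^2 / (8 * (real l)^2)"
    proof -
      have "?n^2 / (8 * (real l)^2) = ?n^2 / (4 * (real l)^2) / 2" by simp
      then show ?thesis using sq \<open>dens l * ?n^2 = _\<close> by argo
    qed
    then have pw: "2 powr ((?n^2 - (\<Sum>i<l. (real (card (cls A c i)))^2)) / 2) \<le> 2 powr (dens l * ?n^2 / 2 - ?n^2 / (8 * (real l)^2))"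
      by (intro powr_mono) auto
    show ?thesis by (rule order.trans[OF _ pw]) (use card_gcol[OF A cC[OF c]] in simp)
  qed
  let ?u = "2 powr (dens l * ?n^2 / 2 - ?n^2 / (8 * (real l)^2))"
  have each: "real (card (?N c)) \<le> \<phi> * real (card (gcol A c)) + ?u" if c: "c \<in> ?C" for c
  proof (cases "bal c")
    case True
    have "real (card (?N c)) \<le> (real (2 ^ m * l) * (?n + 1) ^ (m + 1) * (1 - 1 / 2 ^ (m + 1)) powr (card A / (2 * real l) - real m)) * card (gcol A c)"
      by (rule card_not_ext[OF A cC[OF c] l]) (use True in \<open>simp add: bal_def\<close>)
    also have "\<dots> \<le> \<phi> * card (gcol A c)" using \<phi>(1) by (rule mult_right_mono) simp
    finally show ?thesis by (simp add: add_increasing2)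
  next
    case False
    have "card (?N c) \<le> card (gcol A c)" by (rule card_mono[OF gcol_finite[OF A]]) auto
    then have "real (card (?N c)) \<le> card (gcol A c)" by (rule of_nat_mono)
    also have "\<dots> \<le> ?u" by (rule unbalanced[OF c False])
    finally show ?thesis using phi0 by (simp add: add_increasing)
  qed
  have "B \<le> (\<Sum>c\<in>?C. \<phi> * real (card (gcol A c)) + ?u)" unfolding B_def by (rule sum_mono[OF each])
  also have "\<dots> = \<phi> * P + card ?C * ?u" by (simp add: P_def sum.distrib sum_distrib_left)
  also have "real (card ?C) = real l ^ card A" using A by (simp add: card_PiE)
  also have "real l ^ card A * ?u \<le> \<psi> * ?K"
  proof -
    have "?u = 2 powr (?n - ?n^2 / (8 * (real l)^2)) * 2 powr (dens l * ?n^2 / 2 - ?n)"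
      by (simp flip: powr_add)
    also have "\<dots> \<le> 2 powr (?n - ?n^2 / (8 * (real l)^2)) * ?K" using Col_lower[OF A l] by (intro mult_left_mono) auto
    finally have "real l ^ card A * ?u \<le> real l ^ card A * (2 powr (?n - ?n^2 / (8 * (real l)^2)) * ?K)"
      by (rule mult_left_mono) simp
    also have "\<dots> = (real l ^ card A * 2 powr (?n - ?n^2 / (8 * (real l)^2))) * ?K" by (simp only: mult.assoc)
    also have "\<dots> \<le> \<psi> * ?K" by (rule mult_right_mono[OF \<psi>]) simp
    finally show ?thesis .
  qed
  finally have B: "B \<le> \<phi> * P + \<psi> * ?K" by simp
  have "P = (\<Sum>c\<in>?C. real (card {E \<in> gcol A c. ext l A E c m})) + B"
  proof -
    have "real (card (gcol A c)) = real (card {E \<in> gcol A c. ext l A E c m}) + real (card (?N c))" for c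
    proof -
      have "gcol A c = {E \<in> gcol A c. ext l A E c m} \<union> ?N c" by auto
      then have "card (gcol A c) = card ({E \<in> gcol A c. ext l A E c m} \<union> ?N c)" by simp
      also have "\<dots> = card {E \<in> gcol A c. ext l A E c m} + card (?N c)"
        by (rule card_Un_disjoint) (use gcol_finite[OF A] in auto)
      finally show ?thesis by simp
    qed
    then show ?thesis unfolding P_def B_def by (simp add: sum.distrib)
  qed
  moreover have "1 \<le> m" using l m by simp
  ultimately have "P \<le> real (l ^ l) * ?K + (\<phi> * P + \<psi> * ?K)" using card_good_pairs[OF A m] B by linarith
  \<comment> \<open>As \<open>\<phi> \<le> 1/2\<close>, the term \<open>\<phi> * P\<close> can be
    moved to the left, which bounds the number of pairs by a multiple of the number of
    graphs.\<close>
  moreover have "\<phi> * P \<le> 1/2 * P" by (rule mult_right_mono[OF \<phi>(2)]) (simp add: P_def sum_nonneg)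
  ultimately have "P \<le> 2 * (real (l ^ l) + \<psi>) * ?K" by (simp add: algebra_simps)
  then have "\<phi> * P \<le> \<phi> * (2 * (real (l ^ l) + \<psi>) * ?K)" using phi0 by (rule mult_left_mono)
  then have B2: "B \<le> (\<phi> * (2 * (real (l ^ l) + \<psi>)) + \<psi>) * ?K" using B by (simp add: algebra_simps)
  have "{E \<in> Col l A. \<not> (\<exists>c. ext l A E c m)} \<subseteq> (\<Union>c\<in>?C. ?N c)"
  proof clarify
    fix E assume E: "E \<in> Col l A" "\<not> (\<exists>c. ext l A E c m)"
    then obtain c where c: "proper l A E c" by (auto simp: Col_def)
    have "restrict c A \<in> ?C" using c by (auto simp: proper_def)
    moreover have "E \<in> gcol A (restrict c A)"
      using c E(1) gr_dom[OF Col_gr[OF E(1)]] by (auto simp: gcol_def Col_def proper_def)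
    ultimately show "E \<in> (\<Union>c\<in>?C. ?N c)" using E(2) by blast
  qed
  then have "card {E \<in> Col l A. \<not> (\<exists>c. ext l A E c m)} \<le> card (\<Union>c\<in>?C. ?N c)"
    by (rule card_mono[rotated])
      (rule finite_UN_I[OF fC], rule finite_subset[OF _ gcol_finite[OF A]], rule Collect_restrict)
  also have "\<dots> \<le> (\<Sum>c\<in>?C. card (?N c))" by (rule card_UN_le[OF fC])
  finally have "real (card {E \<in> Col l A. \<not> (\<exists>c. ext l A E c m)}) \<le> B"
    unfolding B_def of_nat_sum[symmetric] by (rule of_nat_mono)
  then show ?thesis using B2 by linarith
qed

theorem almost_all_ext:
  fixes \<epsilon> :: real
  assumes l: "l \<ge> 1" and \<epsilon>: "\<epsilon> > 0"
  shows "\<exists>n0. \<forall>A :: 'a set. finite A \<longrightarrow> card A \<ge> n0 \<longrightarrow>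
    card {E \<in> Kf l A. \<not> (\<exists>c. ext l A E c m)} \<le> \<epsilon> * card (Col l A)"
proof -
  \<comment> \<open>Uniqueness of the colouring requires the extension property for at least
    \<open>l\<close> elements, hence the maximum.\<close>
  define M where "M = max m l"
  define \<psi> where "\<psi> = min 1 (\<epsilon> / 4)"
  define \<phi> where "\<phi> = min (1/2) (\<epsilon> / (8 * (real (l ^ l) + 1)))"
  have "8 * (real (l ^ l) + 1) > 0" by (intro mult_pos_pos add_nonneg_pos) auto
  then have pos: "\<psi> > 0" "\<phi> > 0" using \<epsilon> unfolding \<psi>_def \<phi>_def by (simp_all only: min_less_iff_conj divide_pos_pos) auto
  let ?\<theta> = "1 - 1 / 2 ^ (M + 1) :: real"
  have "(1::real) < 2 ^ (M + 1)" by (rule one_less_power) auto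
  then have th: "0 < ?\<theta>" "?\<theta> < 1" by (simp_all add: divide_less_eq)
  obtain n1 where n1: "\<And>n::nat. n \<ge> n1 \<Longrightarrow> real (2 ^ M * l) * (real n + 1) ^ (M + 1) * ?\<theta> powr (n / (2 * real l) - real M) \<le> \<phi>"
    using polynomial_times_exponential_small[OF th pos(2) l, of "real (2 ^ M * l)" "M + 1" M] by blast
  obtain n2 where n2: "\<And>n::nat. n \<ge> n2 \<Longrightarrow> real l ^ n * 2 powr (n - (real n)^2 / (8 * (real l)^2)) \<le> \<psi>"
    using exponential_over_gaussian_small[OF pos(1) l] by blast
  have "\<epsilon> / 4 > 0" using \<epsilon> by simp
  from almost_all_colourable[OF l this, where 'a = 'a] obtain n3 where
    n3: "\<And>A :: 'a set. finite A \<Longrightarrow> card A \<ge> n3 \<Longrightarrow> real (card (Kf l A - Col l A)) \<le> \<epsilon> / 4 * card (Col l A)" by blast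
  show ?thesis
  proof (intro exI[where x = "max n1 (max n2 n3)"] allI impI)
    fix A :: "'a set" assume A: "finite A" "card A \<ge> max n1 (max n2 n3)"
    let ?K = "real (card (Col l A))"
    have 1: "card {E \<in> Col l A. \<not> (\<exists>c. ext l A E c M)} \<le> (\<phi> * (2 * (real (l ^ l) + \<psi>)) + \<psi>) * ?K"
    proof (rule almost_all_ext_aux[OF A(1) l])
      show "l \<le> M" by (simp add: M_def)
      show "\<phi> \<le> 1/2" unfolding \<phi>_def by (rule min.cobounded1)
    qed (use n1[of "card A"] n2[of "card A"] A(2) in auto)
    have "\<phi> * (2 * (real (l ^ l) + \<psi>)) \<le> \<epsilon> / (8 * (real (l ^ l) + 1)) * (2 * (real (l ^ l) + 1))"
      using pos \<epsilon> by (intro mult_mono) (auto simp: \<phi>_def \<psi>_def)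
    also have "\<dots> = \<epsilon> / 4"
    proof -
      have "real (l ^ l) + 1 > 0" by (simp add: add_nonneg_pos)
      then show ?thesis by (simp add: divide_simps)
    qed
    finally have "\<phi> * (2 * (real (l ^ l) + \<psi>)) + \<psi> \<le> \<epsilon> / 2" by (simp add: \<psi>_def)
    then have 2: "(\<phi> * (2 * (real (l ^ l) + \<psi>)) + \<psi>) * ?K \<le> \<epsilon> / 2 * ?K" by (rule mult_right_mono) simp
    have "{E \<in> Kf l A. \<not> (\<exists>c. ext l A E c m)} \<subseteq> (Kf l A - Col l A) \<union> {E \<in> Col l A. \<not> (\<exists>c. ext l A E c M)}"
    proof
      fix E assume "E \<in> {E \<in> Kf l A. \<not> (\<exists>c. ext l A E c m)}"
      then have "E \<in> Kf l A" "\<And>c. \<not> ext l A E c M" using ext_mono[of l A E _ M m] by (auto simp: M_def)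
      then show "E \<in> (Kf l A - Col l A) \<union> {E \<in> Col l A. \<not> (\<exists>c. ext l A E c M)}" by blast
    qed
    then have "card {E \<in> Kf l A. \<not> (\<exists>c. ext l A E c m)} \<le> card ((Kf l A - Col l A) \<union> {E \<in> Col l A. \<not> (\<exists>c. ext l A E c M)})"
      by (rule card_mono[rotated]) (use Kf_finite[OF A(1)] Col_finite[OF A(1)] in auto)
    also have "\<dots> \<le> card (Kf l A - Col l A) + card {E \<in> Col l A. \<not> (\<exists>c. ext l A E c M)}" by (rule card_Un_le)
    finally have "real (card {E \<in> Kf l A. \<not> (\<exists>c. ext l A E c m)}) \<le>
      real (card (Kf l A - Col l A)) + real (card {E \<in> Col l A. \<not> (\<exists>c. ext l A E c M)})" by linarith
    moreover have "real (card (Kf l A - Col l A)) \<le> \<epsilon> / 4 * ?K" using n3 A by simp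
    moreover have "\<epsilon> / 4 * ?K + \<epsilon> / 2 * ?K \<le> \<epsilon> * ?K" using \<epsilon> by (simp add: field_simps)
    ultimately show "real (card {E \<in> Kf l A. \<not> (\<exists>c. ext l A E c m)}) \<le> \<epsilon> * ?K" using 1 2 by linarith
  qed
qed

section \<open>Transfer of sentences and existentially closed models\<close>

fun vars :: "fm \<Rightarrow> nat set" where
  "vars FTrue = {}"
| "vars (Eq x y) = {x, y}"
| "vars (Adj x y) = {x, y}"
| "vars (Neg p) = vars p"
| "vars (Conj p q) = vars p \<union> vars q"
| "vars (Ex x p) = insert x (vars p)"

lemma finite_vars: "finite (vars \<phi>)"
  by (induction \<phi>) auto

lemma fv_vars: "fv \<phi> \<subseteq> vars \<phi>"
  by (induction \<phi>) auto

text \<open>Partial isomorphisms indexed by variables. They preserve colours because it is the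
  colours that decide through \<open>ext\<close> which vertices can be added.\<close>

definition piso :: "'a set \<Rightarrow> ('a \<Rightarrow> 'a \<Rightarrow> bool) \<Rightarrow> ('a \<Rightarrow> nat) \<Rightarrow> 'b set \<Rightarrow> ('b \<Rightarrow> 'b \<Rightarrow> bool) \<Rightarrow> ('b \<Rightarrow> nat) \<Rightarrow>
    nat set \<Rightarrow> (nat \<Rightarrow> 'a) \<Rightarrow> (nat \<Rightarrow> 'b) \<Rightarrow> bool" where
  "piso V E c V' E' c' D s s' \<longleftrightarrow> (\<forall>x\<in>D. s x \<in> V \<and> s' x \<in> V' \<and> c (s x) = c' (s' x)) \<and>
     (\<forall>x\<in>D. \<forall>y\<in>D. (s x = s y \<longleftrightarrow> s' x = s' y) \<and> (E (s x) (s y) \<longleftrightarrow> E' (s' x) (s' y)))"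

lemma piso_sym: "piso V E c V' E' c' D s s' \<Longrightarrow> piso V' E' c' V E c D s' s"
  unfolding piso_def by auto

lemma piso_mono: "piso V E c V' E' c' D s s' \<Longrightarrow> D' \<subseteq> D \<Longrightarrow> piso V E c V' E' c' D' s s'"
  unfolding piso_def by blast

text \<open>The colour of a new vertex \<open>v\<close> differs from that of each of its neighbours.
  The images of these neighbours have the same colours, so \<open>ext\<close> provides a vertex of
  the colour of \<open>v\<close> with the corresponding trace.\<close>

lemma piso_extend:
  assumes p: "piso V E c V' E' c' D s s'" and D: "finite D" "card D \<le> m" "x \<notin> D"
    and ext: "ext l V' E' c' m" and G: "graph V E" "graph V' E'" and c: "proper l V E c" and v: "v \<in> V"
  shows "\<exists>v'\<in>V'. piso V E c V' E' c' (insert x D) (s(x := v)) (s'(x := v'))"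
proof -
  have symE: "E a b \<longleftrightarrow> E b a" "\<not> E a a" for a b using G(1) by (auto simp: graph_def)
  have symE': "E' a b \<longleftrightarrow> E' b a" "\<not> E' a a" for a b using G(2) by (auto simp: graph_def)
  have p1: "s y \<in> V" "s' y \<in> V'" "c (s y) = c' (s' y)" if "y \<in> D" for y using p that by (auto simp: piso_def)
  have p2: "s y = s z \<longleftrightarrow> s' y = s' z" "E (s y) (s z) \<longleftrightarrow> E' (s' y) (s' z)" if "y \<in> D" "z \<in> D" for y z
    using p that by (auto simp: piso_def)
  have build: "piso V E c V' E' c' (insert x D) (s(x := v)) (s'(x := v'))"
    if v': "v' \<in> V'" "c' v' = c v" "\<And>y. y \<in> D \<Longrightarrow> (v = s y \<longleftrightarrow> v' = s' y) \<and> (E v (s y) \<longleftrightarrow> E' v' (s' y))" for v'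
    unfolding piso_def
  proof (intro conjI ballI)
    fix y assume "y \<in> insert x D"
    then show "(s(x := v)) y \<in> V" "(s'(x := v')) y \<in> V'" "c ((s(x := v)) y) = c' ((s'(x := v')) y)"
      using v v'(1,2) p1 by auto
  next
    fix y z assume yz: "y \<in> insert x D" "z \<in> insert x D"
    have e: "s y = v \<longleftrightarrow> s' y = v'" "E (s y) v \<longleftrightarrow> E' (s' y) v'" if "y \<in> D" for y
      using v'(3)[OF that] symE(1) symE'(1) by metis+
    show "((s(x := v)) y = (s(x := v)) z) = ((s'(x := v')) y = (s'(x := v')) z)"
      using yz by (cases "y = x"; cases "z = x") (simp_all add: p2(1) e(1) v'(3))
    show "E ((s(x := v)) y) ((s(x := v)) z) = E' ((s'(x := v')) y) ((s'(x := v')) z)"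
      using yz by (cases "y = x"; cases "z = x") (simp_all add: p2(2) e(2) v'(3) symE(2) symE'(2))
  qed
  show ?thesis
  proof (cases "v \<in> s ` D")
    case True
    then obtain y where y: "y \<in> D" "v = s y" by blast
    have "piso V E c V' E' c' (insert x D) (s(x := v)) (s'(x := s' y))"
      by (rule build) (use y p1 p2 in auto)
    then show ?thesis using p1(2)[OF y(1)] by blast
  next
    case False
    let ?X = "s' ` {y \<in> D. E v (s y)}"
    have cv: "c v < l" using c v by (auto simp: proper_def)
    have cT: "card (s' ` D) \<le> m" using card_image_le[OF D(1), of s'] D(2) by linarith
    obtain v' where v': "v' \<in> V'" "v' \<notin> s' ` D" "c' v' = c v" "\<And>t. t \<in> s' ` D \<Longrightarrow> E' v' t \<longleftrightarrow> t \<in> ?X"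
    proof (rule extD[OF ext _ _ cT _ cv])
      show "s' ` D \<subseteq> V'" using p1 by auto
      show "finite (s' ` D)" using D by simp
      show "?X \<subseteq> s' ` D" by auto
      show "\<And>z. z \<in> ?X \<Longrightarrow> c' z \<noteq> c v" using p1(3) c by (auto simp: proper_def) metis
    qed auto
    have "E v (s y) \<longleftrightarrow> E' v' (s' y)" if y: "y \<in> D" for y
    proof -
      have "s' y \<in> ?X \<longleftrightarrow> E v (s y)"
      proof
        assume "s' y \<in> ?X"
        then obtain z where "z \<in> D" "E v (s z)" "s' y = s' z" by auto
        then show "E v (s y)" using p2(1)[OF y] by metis
      qed (use y in blast)
      then show ?thesis using v'(4)[of "s' y"] y by blast
    qed
    then have "piso V E c V' E' c' (insert x D) (s(x := v)) (s'(x := v'))"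
      using v' False by (intro build) auto
    then show ?thesis using v'(1) by blast
  qed
qed

text \<open>A quantifier first discards the old value of its variable, so at most one vertex per
  variable is in play. Hence the number of all variables, bound ones included, bounds the degree of
  extension required.\<close>

lemma sat_transfer:
  assumes G: "graph V E" "graph V' E'" and S: "finite S" "card S \<le> m"
    and ext: "ext l V E c m" "ext l V' E' c' m"
  shows "vars \<phi> \<subseteq> S \<Longrightarrow> D \<subseteq> S \<Longrightarrow> fv \<phi> \<subseteq> D \<Longrightarrow> piso V E c V' E' c' D s s' \<Longrightarrow> sat V E s \<phi> \<longleftrightarrow> sat V' E' s' \<phi>"
proof (induction \<phi> arbitrary: D s s')
  case (Ex x p)
  let ?D = "D - {x}"
  have D: "finite ?D" "card ?D \<le> m" "x \<notin> ?D"
    using Ex.prems(2) S by (auto intro: finite_subset card_mono[OF S(1), of "D - {x}", THEN order_trans])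
  have p: "piso V E c V' E' c' ?D s s'" using piso_mono[OF Ex.prems(4)] by blast
  have IH: "sat V E (s(x := v)) p \<longleftrightarrow> sat V' E' (s'(x := v')) p"
    if "piso V E c V' E' c' (insert x ?D) (s(x := v)) (s'(x := v'))" for v v'
    by (rule Ex.IH[OF _ _ _ that]) (use Ex.prems in auto)
  show ?case
  proof
    assume "sat V E s (Ex x p)"
    then obtain v where v: "v \<in> V" "sat V E (s(x := v)) p" by auto
    from piso_extend[OF p D ext(2) G ext_proper[OF ext(1)] v(1)]
    show "sat V' E' s' (Ex x p)" using IH v(2) by auto
  next
    assume "sat V' E' s' (Ex x p)"
    then obtain v' where v': "v' \<in> V'" "sat V' E' (s'(x := v')) p" by auto
    from piso_extend[OF piso_sym[OF p] D ext(1) G(2,1) ext_proper[OF ext(2)] v'(1)]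
    show "sat V E s (Ex x p)" using IH v'(2) piso_sym by fastforce
  qed
next
  case (Conj p q)
  have "sat V E s p \<longleftrightarrow> sat V' E' s' p" by (rule Conj.IH(1)) (use Conj.prems in auto)
  moreover have "sat V E s q \<longleftrightarrow> sat V' E' s' q" by (rule Conj.IH(2)) (use Conj.prems in auto)
  ultimately show ?case by simp
next
  case (Neg p)
  have "sat V E s p \<longleftrightarrow> sat V' E' s' p" by (rule Neg.IH) (use Neg.prems in auto)
  then show ?case by simp
next
  case (Eq x y)
  then have "x \<in> D" "y \<in> D" by simp_all
  then show ?case using Eq.prems(4) unfolding piso_def sat.simps by blast
next
  case (Adj x y)
  then have "x \<in> D" "y \<in> D" by simp_all
  then show ?case using Adj.prems(4) unfolding piso_def sat.simps by blast
qed (simp only: sat.simps)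

lemma sat_cong: "(\<And>x. x \<in> fv \<phi> \<Longrightarrow> s x = s' x) \<Longrightarrow> sat V E s \<phi> \<longleftrightarrow> sat V E s' \<phi>"
proof (induction \<phi> arbitrary: s s')
  case (Ex x p)
  have "sat V E (s(x := v)) p \<longleftrightarrow> sat V E (s'(x := v)) p" for v
    by (rule Ex.IH) (use Ex.prems in auto)
  then show ?case by simp
next
  case (Conj p q)
  have "sat V E s p \<longleftrightarrow> sat V E s' p" "sat V E s q \<longleftrightarrow> sat V E s' q"
    by (rule Conj.IH; use Conj.prems in simp)+
  then show ?case by simp
next
  case (Neg p)
  have "sat V E s p \<longleftrightarrow> sat V E s' p" by (rule Neg.IH) (use Neg.prems in simp)
  then show ?case by simp
qed simp_all

lemma models_iff_sat: "sentence \<phi> \<Longrightarrow> models V E \<phi> \<longleftrightarrow> sat V E s \<phi>"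
  unfolding models_def sentence_def using sat_cong by (metis empty_iff)

lemma models_transfer:
  assumes "graph V E" "graph V' E'" "ext l V E c (card (vars \<phi>))" "ext l V' E' c' (card (vars \<phi>))" "sentence \<phi>"
  shows "models V E \<phi> \<longleftrightarrow> models V' E' \<phi>"
proof -
  fix s s'
  have "sat V E s \<phi> \<longleftrightarrow> sat V' E' s' \<phi>"
    by (rule sat_transfer[OF assms(1,2) finite_vars order_refl assms(3,4) order_refl, of "{}"])
       (use assms(5) in \<open>auto simp: sentence_def piso_def\<close>)
  then show ?thesis using models_iff_sat[OF assms(5)] by metis
qed

section \<open>Models of the primitive positive theory are the colourable graphs\<close>

lemma hom_pp: "pp \<phi> \<Longrightarrow> sat V E s \<phi> \<Longrightarrow> hom V E W D f \<Longrightarrow> (\<forall>x\<in>fv \<phi>. s x \<in> V) \<Longrightarrow> sat W D (f \<circ> s) \<phi>"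
proof (induction \<phi> arbitrary: s)
  case (Ex x p)
  then obtain v where v: "v \<in> V" "sat V E (s(x := v)) p" by auto
  have "sat W D (f \<circ> (s(x := v))) p"
    by (rule Ex.IH[OF _ v(2)]) (use Ex.prems v(1) in auto)
  moreover have "f \<circ> (s(x := v)) = (f \<circ> s)(x := f v)" by auto
  moreover have "f v \<in> W" using v(1) Ex.prems(3) by (auto simp: hom_def)
  ultimately show ?case unfolding sat.simps by metis
qed (auto simp: hom_def)

lemma colourable_modT:
  assumes "graph V E" "proper l V E c"
  shows "modT l V E"
  unfolding modT_def
proof (intro conjI allI impI notI)
  fix \<phi> assume a: "pp \<phi> \<and> sentence \<phi> \<and> \<not> models (KV l) (KE l) \<phi>" and m: "models V E \<phi>"
  have "hom V E (KV l) (KE l) c" using assms by (auto simp: hom_def KV_def KE_def proper_def)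
  moreover have "sat V E s \<phi>" for s using m by (simp add: models_def)
  ultimately have "sat (KV l) (KE l) (c \<circ> s) \<phi>" for s
    using hom_pp a by (metis empty_iff sentence_def)
  then show False using a models_iff_sat by blast
qed (rule assms(1))

lemma sat_foldr_Ex:
  "sat V E s (foldr Ex xs p) \<longleftrightarrow> (\<exists>s'. (\<forall>x. x \<notin> set xs \<longrightarrow> s' x = s x) \<and> (\<forall>x\<in>set xs. s' x \<in> V) \<and> sat V E s' p)"
proof (induction xs arbitrary: s)
  case Nil
  have "s' = s" if "\<forall>x. x \<notin> set [] \<longrightarrow> s' x = s x" for s' using that by auto
  then show ?case by auto
next
  case (Cons a xs)
  show ?case
  proof
    assume "sat V E s (foldr Ex (a # xs) p)"
    then obtain v s' where h: "v \<in> V" "\<forall>x. x \<notin> set xs \<longrightarrow> s' x = (s(a := v)) x" "\<forall>x\<in>set xs. s' x \<in> V" "sat V E s' p"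
      using Cons.IH by auto
    have "s' a \<in> V" using h by (cases "a \<in> set xs") auto
    then show "\<exists>s'. (\<forall>x. x \<notin> set (a # xs) \<longrightarrow> s' x = s x) \<and> (\<forall>x\<in>set (a # xs). s' x \<in> V) \<and> sat V E s' p"
      using h by (intro exI[where x = s']) auto
  next
    assume "\<exists>s'. (\<forall>x. x \<notin> set (a # xs) \<longrightarrow> s' x = s x) \<and> (\<forall>x\<in>set (a # xs). s' x \<in> V) \<and> sat V E s' p"
    then obtain s' where h: "\<forall>x. x \<notin> set (a # xs) \<longrightarrow> s' x = s x" "\<forall>x\<in>set (a # xs). s' x \<in> V" "sat V E s' p" by blast
    then have "sat V E (s(a := s' a)) (foldr Ex xs p)"
      unfolding Cons.IH by (intro exI[where x = s']) auto
    then show "sat V E s (foldr Ex (a # xs) p)" using h(2) by auto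
  qed
qed

lemma sat_foldr_Conj: "sat V E s (foldr Conj ps FTrue) \<longleftrightarrow> (\<forall>p\<in>set ps. sat V E s p)"
  by (induction ps) auto

lemma fv_foldr_Ex: "fv (foldr Ex xs p) = fv p - set xs"
  by (induction xs) auto

lemma fv_foldr_Conj: "fv (foldr Conj ps FTrue) = (\<Union>p\<in>set ps. fv p)"
  by (induction ps) auto

lemma pp_foldr_Ex: "pp (foldr Ex xs p) = pp p"
  by (induction xs) auto

lemma pp_foldr_Conj: "pp (foldr Conj ps FTrue) \<longleftrightarrow> (\<forall>p\<in>set ps. pp p)"
  by (induction ps) auto

lemma qf_foldr_Conj: "qf (foldr Conj ps FTrue) \<longleftrightarrow> (\<forall>p\<in>set ps. qf p)"
  by (induction ps) auto

text \<open>The canonical conjunctive query of a finite induced subgraph, with its vertices as variables.\<close>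
lemma modT_finite_colouring:
  fixes V :: "nat set"
  assumes "modT l V E" "finite W" "W \<subseteq> V"
  shows "\<exists>c. (\<forall>x\<in>W. c x < l) \<and> (\<forall>x\<in>W. \<forall>y\<in>W. E x y \<longrightarrow> c x \<noteq> c y)"
proof -
  obtain ws where ws: "set ws = W" using finite_list[OF assms(2)] by blast
  define ps where "ps = [Adj x y. x \<leftarrow> ws, y \<leftarrow> ws, E x y]"
  define \<phi> where "\<phi> = foldr Ex ws (foldr Conj ps FTrue)"
  have ps: "set ps = {Adj x y | x y. x \<in> W \<and> y \<in> W \<and> E x y}" unfolding ps_def ws[symmetric] by auto
  have sen: "sentence \<phi>" unfolding sentence_def \<phi>_def fv_foldr_Ex fv_foldr_Conj ws ps by auto
  have pp: "pp \<phi>" unfolding \<phi>_def pp_foldr_Ex pp_foldr_Conj ps by auto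
  have "models V E \<phi>" unfolding models_def
  proof
    fix s
    show "sat V E s \<phi>" unfolding \<phi>_def sat_foldr_Ex sat_foldr_Conj ws ps
      by (rule exI[where x = "\<lambda>x. if x \<in> W then x else s x"]) (use assms(3) in auto)
  qed
  then have "models (KV l) (KE l) \<phi>" using assms(1) sen pp by (auto simp: modT_def)
  then have "sat (KV l) (KE l) (\<lambda>_. 0) \<phi>" by (simp add: models_def)
  then obtain c where "\<forall>x\<in>W. c x \<in> KV l" "\<forall>p\<in>set ps. sat (KV l) (KE l) c p"
    unfolding \<phi>_def sat_foldr_Ex sat_foldr_Conj ws by blast
  moreover have "c x \<noteq> c y" if "x \<in> W" "y \<in> W" "E x y" for x y
  proof -
    have "Adj x y \<in> set ps" using that ps by blast
    then have "sat (KV l) (KE l) c (Adj x y)" using calculation(2) by blast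
    then show ?thesis by (simp add: KE_def)
  qed
  ultimately show ?thesis by (intro exI[where x = c]) (auto simp: KV_def)
qed

text \<open>Koenig's lemma: a finite sequence of values is kept if it extends to a good colouring of
  every initial segment of the vertices, and such a sequence can always be prolonged. Bounding the
  values by \<open>l\<close> also off \<open>V\<close> makes the tree finitely branching.\<close>

lemma compactness_colouring:
  fixes V :: "nat set"
  assumes G: "graph V E" and fin: "\<And>W. finite W \<Longrightarrow> W \<subseteq> V \<Longrightarrow> \<exists>c. (\<forall>x\<in>W. c x < l) \<and> (\<forall>x\<in>W. \<forall>y\<in>W. E x y \<longrightarrow> c x \<noteq> c y)"
  shows "\<exists>c. proper l V E c"
proof -
  define good where "good N c \<longleftrightarrow> (\<forall>k. c k \<le> l) \<and> (\<forall>x\<in>V \<inter> {..<N}. c x < l) \<and>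
    (\<forall>x\<in>V \<inter> {..<N}. \<forall>y\<in>V \<inter> {..<N}. E x y \<longrightarrow> c x \<noteq> c y)" for N c
  have good_mono: "good N c \<Longrightarrow> M \<le> N \<Longrightarrow> good M c" for M N c unfolding good_def by auto
  have good_ex: "\<exists>c. good N c" for N
  proof -
    obtain c where "\<forall>x\<in>V \<inter> {..<N}. c x < l" "\<forall>x\<in>V \<inter> {..<N}. \<forall>y\<in>V \<inter> {..<N}. E x y \<longrightarrow> c x \<noteq> c y"
      using fin[of "V \<inter> {..<N}"] by auto
    then have "good N (\<lambda>x. if x \<in> V \<inter> {..<N} then c x else 0)" unfolding good_def by (auto simp: less_imp_le)
    then show ?thesis by blast
  qed
  define ok where "ok n f \<longleftrightarrow> (\<forall>N. \<exists>c. good N c \<and> (\<forall>k<n. c k = f k))" for n f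
  have step: "\<exists>i. ok (Suc n) (f(n := i))" if "ok n f" for n f
  proof (rule ccontr)
    assume "\<not> ?thesis"
    then have "\<forall>i. \<exists>N. \<not> (\<exists>c. good N c \<and> (\<forall>k<Suc n. c k = (f(n := i)) k))" unfolding ok_def by blast
    then obtain N where N: "\<And>i c. good (N i) c \<Longrightarrow> \<exists>k<Suc n. c k \<noteq> (f(n := i)) k" by metis
    \<comment> \<open>If each of the finitely many values at \<open>n\<close> failed at some
      segment, all of them would fail at the largest of these.\<close>
    define M where "M = Max (N ` {..l})"
    obtain c where c: "good M c" "\<forall>k<n. c k = f k" using \<open>ok n f\<close> unfolding ok_def by blast
    have "c n \<le> l" using c(1) by (simp add: good_def)
    then have "N (c n) \<le> M" unfolding M_def by (intro Max_ge) auto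
    then have "good (N (c n)) c" using good_mono c(1) by blast
    then show False using N[of "c n" c] c(2) by (auto simp: less_Suc_eq)
  qed
  define F where "F = rec_nat (\<lambda>_. 0) (\<lambda>n f. f(n := (SOME i. ok (Suc n) (f(n := i)))))"
  have F0: "F 0 = (\<lambda>_. 0)" by (simp add: F_def)
  have FS: "F (Suc n) = (F n)(n := (SOME i. ok (Suc n) ((F n)(n := i))))" for n by (simp add: F_def)
  have okF: "ok n (F n)" for n
  proof (induction n)
    case 0 then show ?case using good_ex by (simp add: ok_def)
  next
    case (Suc n)
    show ?case unfolding FS by (rule someI_ex[OF step[OF Suc]])
  qed
  define col where "col k = F (Suc k) k" for k
  have colF: "k < n \<Longrightarrow> F n k = col k" for n k
  proof (induction n)
    case (Suc n)
    show ?case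
    proof (cases "k = n")
      case True then show ?thesis by (simp add: col_def)
    next
      case False
      then have "F (Suc n) k = F n k" by (simp add: FS)
      then show ?thesis using Suc False by simp
    qed
  qed simp
  have "proper l V E col" unfolding proper_def
  proof (intro conjI ballI allI impI)
    fix x assume x: "x \<in> V"
    obtain c where "good (Suc x) c" "\<forall>k<Suc x. c k = F (Suc x) k" using okF[of "Suc x"] unfolding ok_def by blast
    moreover have "x \<in> V \<inter> {..<Suc x}" using x by simp
    ultimately have "c x < l" "c x = col x" using colF[of x "Suc x"] unfolding good_def by (blast, simp)
    then show "col x < l" by simp
  next
    fix x y assume xy: "E x y"
    then have V: "x \<in> V" "y \<in> V" using G by (auto simp: graph_def)
    let ?n = "Suc (max x y)"
    obtain c where c: "good ?n c" "\<forall>k<?n. c k = F ?n k" using okF[of ?n] unfolding ok_def by blast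
    have "c x \<noteq> c y" using c(1) xy V by (auto simp: good_def)
    moreover have "c x = col x" "c y = col y" using c(2) colF[of x ?n] colF[of y ?n] by auto
    ultimately show "col x \<noteq> col y" by simp
  qed
  then show ?thesis by blast
qed

lemma modT_colourable:
  fixes V :: "nat set"
  assumes "modT l V E"
  shows "\<exists>c. proper l V E c"
  using compactness_colouring[of V E l] modT_finite_colouring[OF assms] assms by (auto simp: modT_def)

text \<open>Adding a vertex of colour \<open>i\<close> with neighbourhood \<open>X\<close> keeps the
  graph \<open>l\<close>-colourable, so the extension is a model, and existential closedness finds
  such a vertex inside \<open>V\<close>. Nothing is said about the colour of the vertex found; this
  is repaired in \<open>ec_ext\<close>.\<close>

lemma ec_realise:
  fixes V :: "nat set"
  assumes ec: "ec_model l V E" and c: "proper l V E c" and T: "finite T" "T \<subseteq> V" "X \<subseteq> T" and i: "i < l" "\<And>x. x \<in> X \<Longrightarrow> c x \<noteq> i"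
  shows "\<exists>v\<in>V. v \<notin> T \<and> (\<forall>t\<in>T. E v t \<longleftrightarrow> t \<in> X)"
proof -
  have G: "graph V E" using ec by (simp add: ec_model_def modT_def)
  \<comment> \<open>The vertices in \<open>T\<close> serve as their own variables, under the
    identity assignment; \<open>z\<close> is a fresh variable.\<close>
  define z where "z = Suc (Max (insert 0 T))"
  have z: "z \<notin> T"
  proof
    assume "z \<in> T"
    then have "z \<le> Max (insert 0 T)" using T(1) by (intro Max_ge) auto
    then show False by (simp add: z_def)
  qed
  \<comment> \<open>Shifting by \<open>Suc\<close> makes room for the new vertex 0 even if
    \<open>V\<close> contains all natural numbers.\<close>
  define W where "W = insert 0 (Suc ` V)"
  define D where "D = (\<lambda>a b. (\<exists>x y. a = Suc x \<and> b = Suc y \<and> E x y) \<or> (\<exists>t\<in>X. a = 0 \<and> b = Suc t) \<or> (\<exists>t\<in>X. a = Suc t \<and> b = (0::nat)))"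
  have D_simps: "D (Suc x) (Suc y) \<longleftrightarrow> E x y" "D 0 (Suc t) \<longleftrightarrow> t \<in> X" for x y t by (auto simp: D_def)
  have GD: "graph W D" using G T(2,3) unfolding graph_def W_def D_def by blast
  have pD: "proper l W D (\<lambda>a. case a of 0 \<Rightarrow> i | Suc x \<Rightarrow> c x)"
    using c i unfolding proper_def W_def D_def by auto blast
  have mod: "modT l W D" by (rule colourable_modT[OF GD pD])
  have emb: "emb V E W D Suc" by (auto simp: emb_def W_def D_simps)
  obtain ts where ts: "set ts = T" using finite_list[OF T(1)] by blast
  define ps where "ps = map (\<lambda>t. Conj (Neg (Eq z t)) (if t \<in> X then Adj z t else Neg (Adj z t))) ts"
  define \<phi> where "\<phi> = Ex z (foldr Conj ps FTrue)"
  have sat_ps: "sat U H s (foldr Conj ps FTrue) \<longleftrightarrow> (\<forall>t\<in>T. s z \<noteq> s t \<and> (H (s z) (s t) \<longleftrightarrow> t \<in> X))" for U :: "nat set" and H s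
    unfolding sat_foldr_Conj ps_def set_map ts by auto
  have qf: "qf (foldr Conj ps FTrue)" unfolding qf_foldr_Conj ps_def by auto
  have "exf \<phi>"
  proof -
    have "exf p" if "qf p" for p using that by (cases p) auto
    then show ?thesis using qf by (simp add: \<phi>_def)
  qed
  moreover have "fv \<phi> \<subseteq> T" unfolding \<phi>_def fv.simps fv_foldr_Conj ps_def set_map ts by (auto split: if_splits)
  moreover have "sat W D (Suc \<circ> id) \<phi>"
  proof -
    have "sat W D ((Suc \<circ> id)(z := 0)) (foldr Conj ps FTrue)"
      unfolding sat_ps using z D_simps by auto
    then show ?thesis unfolding \<phi>_def by (auto simp: W_def)
  qed
  ultimately have "sat V E id \<phi>"
    using ec mod emb T(2) unfolding ec_model_def by (metis id_apply subsetD)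
  then obtain v where v: "v \<in> V" "sat V E (id(z := v)) (foldr Conj ps FTrue)" by (auto simp: \<phi>_def)
  then have "\<forall>t\<in>T. v \<noteq> t \<and> (E v t \<longleftrightarrow> t \<in> X)" unfolding sat_ps using z by (metis fun_upd_apply id_apply)
  then show ?thesis using v(1) by blast
qed

text \<open>A clique on \<open>k\<close> vertices uses at most \<open>k\<close> colours; as long as
  one is left over, a vertex joined to the whole clique can be realised.\<close>

lemma ec_clique:
  fixes V :: "nat set"
  assumes ec: "ec_model l V E" and c: "proper l V E c" and T: "finite T" "T \<subseteq> V"
  shows "k \<le> l \<Longrightarrow> \<exists>u. tup E V k u \<and> (\<forall>i<k. u i \<notin> T)"
proof (induction k)
  case 0 show ?case by (auto simp: tup_def)
next
  case (Suc k)
  then obtain u where u: "tup E V k u" "\<forall>i<k. u i \<notin> T" by auto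
  let ?X = "u ` {..<k}"
  have "card (c ` ?X) \<le> k" using card_image_le[of "{..<k}" "c \<circ> u"] by (simp add: image_comp)
  then have "\<not> {..<l} \<subseteq> c ` ?X" using card_mono[of "c ` ?X" "{..<l}"] Suc.prems by auto
  then obtain i where i: "i < l" "i \<notin> c ` ?X" by auto
  have "\<exists>v\<in>V. v \<notin> T \<union> ?X \<and> (\<forall>t\<in>T \<union> ?X. E v t \<longleftrightarrow> t \<in> ?X)"
    by (rule ec_realise[OF ec c _ _ _ i(1)]) (use T u i in \<open>auto simp: tup_def\<close>)
  then obtain v where v: "v \<in> V" "v \<notin> T" "\<And>i. i < k \<Longrightarrow> E v (u i)" by auto
  have "E \<in> gr V" using ec by (simp add: ec_model_def modT_def gr_def)
  then have "tup E V (Suc k) (u(k := v))" using tup_Suc[OF u(1) v(1) _ v(3)] by blast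
  moreover have "\<forall>i<Suc k. (u(k := v)) i \<notin> T" using u(2) v(2) by (simp add: less_Suc_eq)
  ultimately show ?case by blast
qed

text \<open>A colour is forced on the new vertex by joining it to a clique meeting all the other colours.\<close>
lemma ec_ext:
  fixes V :: "nat set"
  assumes ec: "ec_model l V E" and c: "proper l V E c"
  shows "ext l V E c m"
  unfolding ext_def
proof (intro conjI allI impI)
  fix T X i assume T: "T \<subseteq> V" "finite T" "card T \<le> m" "X \<subseteq> T" "i < l" "\<forall>x\<in>X. c x \<noteq> i"
  obtain u where u: "tup E V l u" and uT: "\<And>j. j < l \<Longrightarrow> u j \<notin> T" using ec_clique[OF ec c T(2,1) order_refl] by blast
  have cu: "c (u j) < l" if "j < l" for j using u c that by (auto simp: tup_def proper_def)
  have inj: "inj_on (c \<circ> u) {..<l}"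
    using u c unfolding inj_on_def tup_def proper_def by (metis comp_apply lessThan_iff)
  have surj: "(c \<circ> u) ` {..<l} = {..<l}"
    by (rule card_subset_eq) (use cu card_image[OF inj] in auto)
  let ?U = "{x \<in> u ` {..<l}. c x \<noteq> i}"
  have "\<exists>v\<in>V. v \<notin> T \<union> ?U \<and> (\<forall>t\<in>T \<union> ?U. E v t \<longleftrightarrow> t \<in> X \<union> ?U)"
  proof (rule ec_realise[OF ec c])
    show "T \<union> ?U \<subseteq> V" using T(1) u by (auto simp: tup_def)
  qed (use T in auto)
  then obtain v where v: "v \<in> V" "v \<notin> T" "\<And>t. t \<in> T \<union> ?U \<Longrightarrow> E v t \<longleftrightarrow> t \<in> X \<union> ?U" by auto
  have "c v \<noteq> k" if k: "k < l" "k \<noteq> i" for k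
  proof -
    obtain j where j: "j < l" "c (u j) = k" using surj k(1) by (metis (no_types, lifting) comp_apply imageE lessThan_iff)
    then have "E v (u j)" using v(3)[of "u j"] k(2) by auto
    then show ?thesis using c j(2) by (auto simp: proper_def)
  qed
  moreover have "c v < l" using c v(1) by (auto simp: proper_def)
  ultimately have "c v = i" by blast
  moreover have "E v t \<longleftrightarrow> t \<in> X" if t: "t \<in> T" for t
    using v(3)[of t] t uT by auto
  ultimately show "\<exists>v\<in>V - T. c v = i \<and> (\<forall>t\<in>T. E v t \<longleftrightarrow> t \<in> X)" using v by blast
qed (rule c)

lemma ext_permute:
  assumes ext: "ext l V E c m" and c': "proper l V E c'" and \<pi>: "inj_on \<pi> {..<l}" "\<pi> ` {..<l} \<subseteq> {..<l}"
    and eq: "\<forall>x\<in>V. c' x = \<pi> (c x)"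
  shows "ext l V E c' m"
  unfolding ext_def
proof (intro conjI allI impI)
  fix T X i assume T: "T \<subseteq> V" "finite T" "card T \<le> m" "X \<subseteq> T" "i < l" "\<forall>x\<in>X. c' x \<noteq> i"
  have "\<pi> ` {..<l} = {..<l}" by (rule card_subset_eq) (use \<pi> card_image[OF \<pi>(1)] in auto)
  then obtain j where j: "j < l" "\<pi> j = i" using T(5) by (metis (no_types, lifting) imageE lessThan_iff)
  have "c x \<noteq> j" if "x \<in> X" for x using T(1,4,6) eq j(2) that by auto
  then obtain v where v: "v \<in> V" "v \<notin> T" "c v = j" "\<And>t. t \<in> T \<Longrightarrow> E v t \<longleftrightarrow> t \<in> X"
    using extD[OF ext T(1-4) j(1)] by metis
  then show "\<exists>v\<in>V - T. c' v = i \<and> (\<forall>t\<in>T. E v t \<longleftrightarrow> t \<in> X)" using eq j(2) by (intro bexI[where x = v]) auto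
qed (rule c')

lemma qf_piso: "qf \<phi> \<Longrightarrow> fv \<phi> \<subseteq> D \<Longrightarrow> piso V E c V' E' c' D s s' \<Longrightarrow> sat V E s \<phi> \<longleftrightarrow> sat V' E' s' \<phi>"
proof (induction \<phi>)
  case (Eq x y)
  then have "x \<in> D" "y \<in> D" by simp_all
  then show ?case using Eq.prems(3) unfolding piso_def sat.simps by blast
next
  case (Adj x y)
  then have "x \<in> D" "y \<in> D" by simp_all
  then show ?case using Adj.prems(3) unfolding piso_def sat.simps by blast
qed auto

text \<open>For existential formulas the forth half of the argument suffices, so the extension
  property is required of \<open>V\<close> only.\<close>

lemma exf_piso:
  assumes G: "graph W D" "graph V E" and ext: "\<And>m. ext l V E c m" and cW: "proper l W D cW"
  shows "exf \<phi> \<Longrightarrow> finite S \<Longrightarrow> fv \<phi> \<subseteq> S \<Longrightarrow> piso W D cW V E c S t s \<Longrightarrow> sat W D t \<phi> \<Longrightarrow> sat V E s \<phi>"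
proof (induction \<phi> arbitrary: S s t)
  case (Ex x p)
  let ?S = "S - {x}"
  from Ex.prems(5) obtain w where w: "w \<in> W" "sat W D (t(x := w)) p" by auto
  have p: "piso W D cW V E c ?S t s" using piso_mono[OF Ex.prems(4)] by blast
  obtain v where v: "v \<in> V" "piso W D cW V E c (insert x ?S) (t(x := w)) (s(x := v))"
    using piso_extend[OF p _ order_refl _ ext G cW w(1)] Ex.prems(2) by blast
  have "sat V E (s(x := v)) p" by (rule Ex.IH[OF _ _ _ v(2) w(2)]) (use Ex.prems in auto)
  then show ?case using v(1) by auto
next
  case FTrue then show ?case by simp
next
  case (Eq x y) then show ?case using qf_piso[OF _ Eq.prems(3,4)] by simp
next
  case (Adj x y) then show ?case using qf_piso[OF _ Adj.prems(3,4)] by simp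
next
  case (Neg q) then show ?case using qf_piso[OF _ Neg.prems(3,4)] by simp
next
  case (Conj q r) then show ?case using qf_piso[OF _ Conj.prems(3,4)] by simp
qed

text \<open>A model \<open>W\<close> containing \<open>V\<close> has a proper colouring by
  compactness, and its restriction to \<open>V\<close> agrees with \<open>c\<close> up to a
  permutation of the colours. The extension property therefore holds for the restriction too, and
  the embedding becomes a colour-preserving partial isomorphism on the parameters.\<close>

lemma ext_ec:
  fixes V :: "nat set"
  assumes G: "graph V E" and ext: "\<And>m. ext l V E c m"
  shows "ec_model l V E"
  unfolding ec_model_def
proof (intro conjI allI impI)
  show "modT l V E" by (rule colourable_modT[OF G ext_proper[OF ext]])
  fix W :: "nat set" and D f \<phi> s
  assume a: "modT l W D \<and> emb V E W D f \<and> exf \<phi> \<and> (\<forall>x\<in>fv \<phi>. s x \<in> V) \<and> sat W D (f \<circ> s) \<phi>"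
  then have GW: "graph W D" by (simp add: modT_def)
  obtain cW where cW: "proper l W D cW" using modT_colourable a by blast
  have f: "inj_on f V" "f ` V \<subseteq> W" "\<And>x y. x \<in> V \<Longrightarrow> y \<in> V \<Longrightarrow> E x y \<longleftrightarrow> D (f x) (f y)" using a by (auto simp: emb_def)
  have p: "proper l V E (cW \<circ> f)"
    unfolding proper_def
  proof (intro conjI ballI allI impI)
    fix x assume "x \<in> V"
    then have "f x \<in> W" using f(2) by blast
    then show "(cW \<circ> f) x < l" using cW by (simp add: proper_def)
  next
    fix x y assume xy: "E x y"
    then have "x \<in> V" "y \<in> V" using G by (simp_all add: graph_def)
    then have "D (f x) (f y)" using f(3) xy by blast
    then show "(cW \<circ> f) x \<noteq> (cW \<circ> f) y" using cW by (simp add: proper_def)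
  qed
  obtain \<pi> where "inj_on \<pi> {..<l}" "\<pi> ` {..<l} \<subseteq> {..<l}" "\<forall>x\<in>V. (cW \<circ> f) x = \<pi> (c x)"
    using ext_unique_colouring[OF ext G _ _ p, of "Suc l"] by auto
  then have ext': "ext l V E (cW \<circ> f) m" for m by (rule ext_permute[OF ext p])
  have fin: "finite (fv \<phi>)" using fv_vars finite_vars finite_subset by blast
  have "piso W D cW V E (cW \<circ> f) (fv \<phi>) (f \<circ> s) s"
    unfolding piso_def using a f by (auto dest: inj_onD)
  then show "sat V E s \<phi>" using exf_piso[OF GW G ext' cW _ fin order_refl] a by blast
qed

text \<open>The vertex \<open>x\<close> has colour \<open>x mod l\<close>; adjacency is read off the binary digits of \<open>max x y div l\<close>.\<close>
definition bitE :: "nat \<Rightarrow> nat \<Rightarrow> nat \<Rightarrow> bool" where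
  "bitE l x y \<longleftrightarrow> x mod l \<noteq> y mod l \<and> min x y \<in> set_decode (max x y div l)"

lemma bitE_graph: "graph UNIV (bitE l)"
  by (auto simp: graph_def bitE_def min.commute max.commute)

lemma bitE_ext:
  assumes "l \<ge> 1"
  shows "ext l UNIV (bitE l) (\<lambda>x. x mod l) m"
  unfolding ext_def
proof (intro conjI allI impI)
  show "proper l UNIV (bitE l) (\<lambda>x. x mod l)" using assms by (auto simp: proper_def bitE_def)
  fix T X :: "nat set" and i assume T: "finite T" "X \<subseteq> T" "i < l" "\<forall>x\<in>X. x mod l \<noteq> i"
  define N where "N = Suc (Max (insert 0 T))"
  have N: "t < N" if "t \<in> T" for t
    unfolding N_def by (rule le_imp_less_Suc, rule Max_ge) (use T(1) that in auto)
  \<comment> \<open>As in the binary coding of the random graph. The extra digit \<open>N\<close>,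
    which is not in \<open>T\<close>, makes \<open>e\<close> and hence \<open>v\<close> larger than
    all elements of \<open>T\<close>, so that adjacency of \<open>v\<close> to \<open>T\<close> is
    read off the digits of \<open>e\<close>.\<close>
  define e where "e = set_encode (insert N X)"
  have fin: "finite (insert N X)" using T finite_subset by auto
  have "2 ^ N \<le> e" unfolding e_def set_encode_def using fin by (intro member_le_sum) auto
  then have e: "N < e" using less_exp[of N] by linarith
  define v where "v = l * e + i"
  have v: "v mod l = i" "v div l = e" using T(3) by (auto simp: v_def)
  have "1 * e \<le> l * e" using assms by (rule mult_le_mono1)
  then have "N < v" using e unfolding v_def by linarith
  then have tv: "t < v" if "t \<in> T" for t using N[OF that] by simp
  have "bitE l v t \<longleftrightarrow> t \<in> X" if t: "t \<in> T" for t
  proof -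
    have "bitE l v t \<longleftrightarrow> i \<noteq> t mod l \<and> t \<in> insert N X"
      unfolding bitE_def v using tv[OF t] fin by (simp add: v e_def min_def max_def)
    then show ?thesis using N[OF t] T(4) by auto
  qed
  moreover have "v \<notin> T" using tv by blast
  ultimately show "\<exists>v\<in>UNIV - T. v mod l = i \<and> (\<forall>t\<in>T. bitE l v t \<longleftrightarrow> t \<in> X)" using v(1) by blast
qed

text \<open>All existentially closed models agree on sentences, by \<open>ec_ext\<close> and
  \<open>models_transfer\<close>; the explicit one ensures that the quantification over them is not
  vacuous.\<close>

lemma generic_iff_bitE:
  assumes "l \<ge> 1" "sentence \<phi>"
  shows "\<phi> \<in> generic_theory l \<longleftrightarrow> models UNIV (bitE l) \<phi>"
proof -
  have "ec_model l UNIV (bitE l)" by (rule ext_ec[OF bitE_graph bitE_ext[OF assms(1)]])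
  moreover have "models V E \<phi> \<longleftrightarrow> models UNIV (bitE l) \<phi>" if ec: "ec_model l V E" for V :: "nat set" and E
  proof -
    have "graph V E" "modT l V E" using ec by (auto simp: ec_model_def modT_def)
    moreover obtain c where "proper l V E c" using modT_colourable calculation(2) by blast
    ultimately show ?thesis
      using models_transfer[OF _ bitE_graph ec_ext[OF ec] bitE_ext[OF assms(1)] assms(2)] by blast
  qed
  ultimately show ?thesis unfolding generic_theory_def using assms(2) by blast
qed

section \<open>The class \<open>Forb_n F n\<close> and its limit probabilities\<close>

lemma finite_graph_colourable:
  assumes "graph V E" "finite V"
  shows "homto V E (KV (chi V E)) (KE (chi V E))"
proof -
  obtain h where h: "bij_betw h V {0..<card V}" using ex_bij_betw_finite_nat[OF assms(2)] by blast
  have hl: "h x < card V" if "x \<in> V" for x using h that by (metis atLeastLessThan_iff bij_betwE)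
  have "h x \<noteq> h y" if "E x y" for x y
    using h assms(1) that unfolding graph_def bij_betw_def inj_on_def by metis
  then have "hom V E (KV (card V)) (KE (card V)) h" using hl by (auto simp: hom_def KV_def KE_def)
  then have "homto V E (KV (card V)) (KE (card V))" by (auto simp: homto_def)
  then show ?thesis unfolding chi_def by (rule LeastI)
qed

lemma homto_trans: "homto V E W D \<Longrightarrow> homto W D U H \<Longrightarrow> homto V E U H"
proof -
  assume "homto V E W D" "homto W D U H"
  then obtain f g where "hom V E W D f" "hom W D U H g" by (auto simp: homto_def)
  then have "hom V E U H (g \<circ> f)" by (auto simp: hom_def)
  then show ?thesis by (auto simp: homto_def)
qed

lemma Col_homto: "D \<in> Col l A \<Longrightarrow> homto A D (KV l) (KE l)"
  unfolding Col_def proper_def homto_def hom_def KV_def KE_def by blast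

lemma tup_homto: "tup D A k f \<Longrightarrow> homto (KV k) (KE k) A D"
  unfolding tup_def homto_def hom_def KV_def KE_def by auto

context
  fixes F :: "('v set \<times> ('v \<Rightarrow> 'v \<Rightarrow> bool)) set"
  assumes ne: "F \<noteq> {}" and fin: "\<forall>(V, E)\<in>F. graph V E \<and> finite V" and Forb: "\<forall>n. Forb_n F n \<noteq> {}"
begin

lemma kF_witness: "\<exists>(V, E)\<in>F. homto V E (KV (kF F)) (KE (kF F))"
proof -
  obtain V0 E0 where "(V0, E0) \<in> F" using ne by auto
  then have "\<exists>k. \<exists>(V, E)\<in>F. chi V E = k" by blast
  then have "\<exists>(V, E)\<in>F. chi V E = kF F" unfolding kF_def by (rule LeastI_ex)
  then obtain V E where VE: "(V, E) \<in> F" "chi V E = kF F" by blast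
  then have "homto V E (KV (kF F)) (KE (kF F))" using finite_graph_colourable[of V E] fin by auto
  then show ?thesis using VE(1) by blast
qed

lemma kF_le: "(V, E) \<in> F \<Longrightarrow> homto V E (KV n) (KE n) \<Longrightarrow> kF F \<le> n"
proof -
  assume VE: "(V, E) \<in> F" and h: "homto V E (KV n) (KE n)"
  have "chi V E \<le> n" unfolding chi_def using h by (rule Least_le)
  moreover have "kF F \<le> chi V E" unfolding kF_def by (rule Least_le) (use VE in blast)
  ultimately show ?thesis by simp
qed

text \<open>If some member of \<open>F\<close> were colourable with at most one colour, it would
  have no edges and map to every graph on one vertex, and \<open>Forb_n F 1\<close> would be
  empty.\<close>

lemma kF_ge_2: "kF F \<ge> 2"
proof (rule ccontr)
  assume "\<not> ?thesis"
  then have k: "kF F \<le> 1" by simp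
  obtain V E where VE: "(V, E) \<in> F" "homto V E (KV (kF F)) (KE (kF F))" using kF_witness by blast
  obtain D where D: "D \<in> Forb_n F 1" using Forb by blast
  obtain f where f: "hom V E (KV (kF F)) (KE (kF F)) f" using VE(2) by (auto simp: homto_def)
  have "\<not> E x y" if "x \<in> V" "y \<in> V" for x y
    using f k that unfolding hom_def KE_def by (metis One_nat_def le_trans less_Suc0 less_le_trans)
  then have "hom V E {1..1} D (\<lambda>_. 1)" by (auto simp: hom_def)
  then have "homto V E {1..1} D" by (auto simp: homto_def)
  then show False using D VE(1) by (auto simp: Forb_n_def in_Forb_def)
qed

lemma Col_Forb: "Col (kF F - 1) {1..n} \<subseteq> Forb_n F n"
proof
  fix D assume D: "D \<in> Col (kF F - 1) {1..n}"
  have "\<not> homto V E {1..n} D" if VE: "(V, E) \<in> F" for V E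
  proof
    assume "homto V E {1..n} D"
    then have "homto V E (KV (kF F - 1)) (KE (kF F - 1))" using homto_trans Col_homto[OF D] by blast
    then show False using kF_le[OF VE] kF_ge_2 by fastforce
  qed
  then show "D \<in> Forb_n F n" using D by (auto simp: Forb_n_def in_Forb_def Col_def gr_def)
qed

lemma Forb_Kf: "Forb_n F n \<subseteq> Kf (kF F - 1) {1..n}"
proof
  fix D assume D: "D \<in> Forb_n F n"
  obtain V E where VE: "(V, E) \<in> F" "homto V E (KV (kF F)) (KE (kF F))" using kF_witness by blast
  have S: "Suc (kF F - 1) = kF F" using kF_ge_2 by simp
  have "\<not> tup D {1..n} (Suc (kF F - 1)) f" for f
  proof
    assume "tup D {1..n} (Suc (kF F - 1)) f"
    then have "homto V E {1..n} D" using homto_trans[OF VE(2)] tup_homto unfolding S by blast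
    then show False using D VE(1) by (auto simp: Forb_n_def in_Forb_def)
  qed
  then show "D \<in> Kf (kF F - 1) {1..n}" using D by (auto simp: Kf_def Forb_n_def in_Forb_def gr_def)
qed

text \<open>A graph that disagrees with the generic one on \<open>\<phi>\<close> has no colouring
  with the extension property for the variables of \<open>\<phi>\<close>. Such graphs are rare in
  \<open>Kf\<close> relative to \<open>Col\<close>, hence all the more relative to the larger
  \<open>Forb_n F n\<close>.\<close>

lemma almost_all_generic:
  fixes \<epsilon> :: real
  assumes s: "sentence \<phi>" and \<epsilon>: "\<epsilon> > 0"
  shows "\<exists>n0. \<forall>n\<ge>n0. card {D \<in> Forb_n F n. models {1..n} D \<phi> \<longleftrightarrow> \<not> models UNIV (bitE (kF F - 1)) \<phi>} \<le> \<epsilon> * card (Forb_n F n)"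
proof -
  let ?l = "kF F - 1" and ?m = "card (vars \<phi>)"
  have l: "?l \<ge> 1" using kF_ge_2 by simp
  obtain n0 where n0: "\<And>A :: nat set. finite A \<Longrightarrow> card A \<ge> n0 \<Longrightarrow>
    card {E \<in> Kf ?l A. \<not> (\<exists>c. ext ?l A E c ?m)} \<le> \<epsilon> * card (Col ?l A)"
    using almost_all_ext[OF l \<epsilon>, of ?m, where 'a = nat] by blast
  show ?thesis
  proof (intro exI[where x = n0] allI impI)
    fix n assume n: "n \<ge> n0"
    let ?X = "{D \<in> Forb_n F n. models {1..n} D \<phi> \<longleftrightarrow> \<not> models UNIV (bitE ?l) \<phi>}"
    let ?Y = "{E \<in> Kf ?l {1..n}. \<not> (\<exists>c. ext ?l {1..n} E c ?m)}"
    have "?X \<subseteq> ?Y"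
    proof
      fix D assume D: "D \<in> ?X"
      then have K: "D \<in> Kf ?l {1..n}" using Forb_Kf by blast
      then have "graph {1..n} D" by (simp add: Kf_def gr_def)
      then have "\<not> ext ?l {1..n} D c ?m" for c
        using models_transfer[OF _ bitE_graph _ bitE_ext[OF l] s] D by blast
      then show "D \<in> ?Y" using K by blast
    qed
    then have "card ?X \<le> card ?Y" by (rule card_mono[rotated]) (use Kf_finite[of "{1..n}" ?l] in auto)
    then have "real (card ?X) \<le> card ?Y" by (rule of_nat_mono)
    also have "\<dots> \<le> \<epsilon> * card (Col ?l {1..n})" by (rule n0) (use n in auto)
    also have "\<dots> \<le> \<epsilon> * card (Forb_n F n)"
    proof -
      have "finite (Forb_n F n)" by (rule finite_subset[OF Forb_Kf Kf_finite]) simp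
      then have "card (Col ?l {1..n}) \<le> card (Forb_n F n)" using Col_Forb by (rule card_mono)
      then show ?thesis using \<epsilon> by simp
    qed
    finally show "real (card ?X) \<le> \<epsilon> * card (Forb_n F n)" .
  qed
qed

lemma prob_Forb_tendsto:
  assumes s: "sentence \<phi>"
  shows "prob_Forb F \<phi> \<longlonglongrightarrow> (if models UNIV (bitE (kF F - 1)) \<phi> then 1 else 0)"
proof (rule LIMSEQ_I)
  fix r :: real assume r: "r > 0"
  let ?b = "models UNIV (bitE (kF F - 1)) \<phi>"
  obtain n0 where n0: "\<And>n. n \<ge> n0 \<Longrightarrow>
    card {D \<in> Forb_n F n. models {1..n} D \<phi> \<longleftrightarrow> \<not> ?b} \<le> r / 2 * card (Forb_n F n)"
    using almost_all_generic[OF s, of "r / 2"] r by auto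
  show "\<exists>n0. \<forall>n\<ge>n0. norm (prob_Forb F \<phi> n - (if ?b then 1 else 0)) < r"
  proof (intro exI[where x = n0] allI impI)
    fix n assume n: "n \<ge> n0"
    let ?A = "{D \<in> Forb_n F n. models {1..n} D \<phi>}" and ?B = "{D \<in> Forb_n F n. \<not> models {1..n} D \<phi>}"
    have fin: "finite (Forb_n F n)" by (rule finite_subset[OF Forb_Kf Kf_finite]) simp
    have pos: "real (card (Forb_n F n)) > 0" using fin Forb by (simp add: card_gt_0_iff)
    have "Forb_n F n = ?A \<union> ?B" by auto
    then have "card (Forb_n F n) = card (?A \<union> ?B)" by simp
    also have "\<dots> = card ?A + card ?B" by (rule card_Un_disjoint) (use fin in auto)
    finally have sum: "real (card (Forb_n F n)) = real (card ?A) + real (card ?B)" by simp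
    have A: "real (card ?A) / card (Forb_n F n) \<le> r / 2" if "\<not> ?b"
      using n0[OF n] that pos by (simp add: divide_le_eq)
    have B: "real (card ?B) / card (Forb_n F n) \<le> r / 2" if "?b"
      using n0[OF n] that pos by (simp add: divide_le_eq)
    have "prob_Forb F \<phi> n = 1 - real (card ?B) / card (Forb_n F n)"
      unfolding prob_Forb_def using sum pos by (simp add: field_simps)
    moreover have "prob_Forb F \<phi> n = real (card ?A) / card (Forb_n F n)" by (simp only: prob_Forb_def)
    moreover have "0 \<le> real (card ?A) / card (Forb_n F n)" "0 \<le> real (card ?B) / card (Forb_n F n)" by simp_all
    ultimately have bounds: "?b \<Longrightarrow> \<bar>prob_Forb F \<phi> n - 1\<bar> < r" "\<not> ?b \<Longrightarrow> \<bar>prob_Forb F \<phi> n - 0\<bar> < r"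
      using A B r by linarith+
    then show "norm (prob_Forb F \<phi> n - (if ?b then 1 else 0)) < r"
      unfolding real_norm_def by (cases ?b) (simp_all only: if_True if_False not_False_eq_True True_implies_equals)
  qed
qed

lemma as_theory_eq: "as_theory F = generic_theory (kF F - 1)"
proof -
  have l: "kF F - 1 \<ge> 1" using kF_ge_2 by simp
  have "\<phi> \<in> as_theory F \<longleftrightarrow> \<phi> \<in> generic_theory (kF F - 1)" for \<phi>
  proof (cases "sentence \<phi>")
    case True
    have "(prob_Forb F \<phi> \<longlonglongrightarrow> 1) \<longleftrightarrow> models UNIV (bitE (kF F - 1)) \<phi>"
      using prob_Forb_tendsto[OF True] LIMSEQ_unique[of "prob_Forb F \<phi>" 0 1] by (auto split: if_splits)
    then show ?thesis using generic_iff_bitE[OF l True] True by (simp add: as_theory_def)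
  qed (simp add: as_theory_def generic_theory_def)
  then show ?thesis by blast
qed

end

theorem theorem3p1:
  fixes F :: "('v set \<times> ('v \<Rightarrow> 'v \<Rightarrow> bool)) set"
  assumes "F \<noteq> {}"
    and "\<forall>(V, E)\<in>F. graph V E \<and> finite V"
    and "\<forall>n. Forb_n F n \<noteq> {}"
  shows "as_theory F = generic_theory (kF F - 1)"
  by (rule as_theory_eq[OF assms])

end
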